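(* Let $M$ be a smooth manifold and let $\mathcal{S}_Z$ be a $p$-dimensional cone structure on the compact subset $X\subset\mathrm{int}(M)$ relative to the compact subset $Z\subset X$. Then a cohomology class $\xi\in H_Z\subset H^p(M;\mathbb{R})$ contains a relatively transversal form (i.e. a form transversal relative to $Z$) if and only if for every open neighborhood $U$ of $Z$ with $\xi\in H_U$ and every structure cycle $T$ relative to $U$ we have $$\mathcal{T}(\xi)>0,$$ where $\mathcal{T}:H_U\to\mathbb{R}$ is the homomorphism induced by $T$.
   Context: Notation: $\mathrm{int}(M)$ is the interior of $M$. $\mathcal{D}^p=\mathcal{D}^p(M)$ is the space of compactly supported smooth $p$-forms on $M$ with the $C^\infty$-topology, and $\mathcal{D}_p$ is the space of $p$-dimensional currents; with their natural topologies these are dual topological vector spaces. Compact convex cone: a convex cone $C\subset H$ based at $0$ in a topological vector space $H$ is called compact if there exists a continuous linear functional $L:H\to\mathbb{R}$ such that the set $L^{-1}(1)\cap C$ is compact in $H$. Relative cone structure: a $p$-dimensional cone structure $\mathcal{S}_Z$ on the compact subset $X\subset M$ relative to the closed subset $Z\subset X$ consists of a compact convex cone $C_p(x)\subset\Lambda_pT_xM$ (based at $0$) for each $x\in X\setminus Z$ which depends continuously on $x$; continuity is measured with respect to Hausdorff convergence of the set of unit $p$-vectors in $C_p$ in some auxiliary chart near $x$. Transversal form: a form $\lambda\in\mathcal{D}^p$ is transversal relative to $Z$ (relatively transversal) if (i) $\lambda(v)>0$ whenever $x\in X\setminus Z$ and $0\neq v\in C_p(x)$, and (ii) $\lambda=0$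 pointwise on $Z$. Cones of forms: for an open neighborhood $U$ of $Z$ put $$\mathcal{O}_U=\{\alpha\in\mathcal{D}^p(M): \alpha(v)>0\text{ for all }x\in X\setminus U\text{ and all }0\neq v\in C_p(x)\},$$ $$\mathcal{A}_{U,0}=\{\alpha\in\mathcal{D}^p(M): \alpha\equiv 0\text{ on }Z,\ \alpha(v)\ge 0\text{ for all }x\in (X\cap\overline U)\setminus Z\text{ and all }v\in C_p(x),\ d\alpha=0,\ [\alpha]=0\in H^p(M;\mathbb{R})\},$$ where "$\alpha\equiv 0$ on $Z$" means that $\alpha$ vanishes pointwise at points of $Z$. Structure cycles: a current $T\in\mathcal{D}_p$ is a structure current relative to $U$ if $T(\alpha)>0$ for all $\alpha\in\mathcal{O}_U$. If in addition $T(\alpha)\le 0$ for all $\alpha\in\mathcal{A}_{U,0}$, then $T$ is a structure cycle relative to $U$. Cohomology: $H_U\subset H^p(M;\mathbb{R})$ is the linear subspace of cohomology classes vanishing on some neighborhood of $\overline U$, and $H_Z\subset H^p(M;\mathbb{R})$ is the subspace of classes vanishing in some neighborhood of $Z$. Every structure cycle $T$ relative to $U$ induces a homomorphism $\mathcal{T}:H_U\to\mathbb{R}$, $\mathcal{T}(\xi)=T(\alpha)$, where $\alpha$ is any representative of $\xi$ vanishing on some neighborhood of $\overline U$.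
   Formalization: H_Z and H_U are taken as the classes with a compactly supported representative vanishing near Z, resp. the closure of U (automatic for compact M); the functional L of a compact convex cone must be positive on C\{0}; M has dimension at least 1. *)

theory Defs
  imports "HOL-Analysis.Analysis"
begin

text \<open>
  Multivectors over \<open>\<real>\<^sup>n\<close> (\<open>n = CARD('n)\<close>) are written in the standard basis: the component of a
  vector of type \<open>'n multivector\<close> at an index set \<open>I = {i\<^sub>1 < \<dots> < i\<^sub>p}\<close> is the coefficient of
  \<open>e\<^bsub>i\<^sub>1\<^esub> \<and> \<dots> \<and> e\<^bsub>i\<^sub>p\<^esub>\<close>, or dually of \<open>dx\<^bsub>i\<^sub>1\<^esub> \<and> \<dots> \<and> dx\<^bsub>i\<^sub>p\<^esub>\<close>. The pairing of a \<open>p\<close>-form with a \<open>p\<close>-vector is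
  then the inner product. The linear order on \<open>'n\<close> serves only to fix signs.
\<close>

type_synonym 'n multivector = "(real, 'n set) vec"
type_synonym 'n sqmatrix = "((real, 'n) vec, 'n) vec"

definition multivectors :: "nat \<Rightarrow> 'n::finite multivector set"
  where "multivectors p = {v. \<forall>I. card I \<noteq> p \<longrightarrow> v $ I = 0}"

definition minor :: "'n::{finite,linorder} sqmatrix \<Rightarrow> 'n set \<Rightarrow> 'n set \<Rightarrow> real"
  where "minor A I J =
    (\<Sum>f | f \<in> extensional I \<and> bij_betw f I J.
       (- 1) ^ card {(i, k). i \<in> I \<and> k \<in> I \<and> i < k \<and> f k < f i} * (\<Prod>i\<in>I. A $ i $ f i))"

text \<open>The matrix of the map \<open>\<Lambda>A\<close> induced by \<open>A\<close> on the exterior algebra; its transpose is the pullback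
  of forms by \<open>A\<close>.\<close>

definition compound :: "'n::{finite,linorder} sqmatrix \<Rightarrow> 'n set sqmatrix"
  where "compound A = (\<chi> I J. minor A I J)"


text \<open>Derivatives are taken within the domain \<open>S\<close>, which in all uses is a relatively open subset of
  \<open>\<real>\<^sup>n\<close> or of a closed half-space (so the derivative within \<open>S\<close> is unique).\<close>

definition partial :: "(real ^ 'n) set \<Rightarrow> 'n \<Rightarrow> (real ^ 'n \<Rightarrow> 'b::real_normed_vector) \<Rightarrow> real ^ 'n \<Rightarrow> 'b"
  where "partial S i f x = frechet_derivative f (at x within S) (axis i 1)"

definition partials :: "(real ^ 'n) set \<Rightarrow> 'n list \<Rightarrow> (real ^ 'n \<Rightarrow> 'b::real_normed_vector) \<Rightarrow> real ^ 'n \<Rightarrow> 'b"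
  where "partials S is f = foldr (partial S) is f"

definition smooth_on :: "(real ^ 'n) set \<Rightarrow> (real ^ 'n \<Rightarrow> 'b::real_normed_vector) \<Rightarrow> bool"
  where "smooth_on S f \<longleftrightarrow> (\<forall>is. \<forall>x\<in>S. partials S is f differentiable (at x within S))"


record ('a, 'n) chart =
  cdom :: "'a set"
  cmap :: "'a \<Rightarrow> (real, 'n) vec"

record ('a, 'n) manifold =
  mtop :: "'a topology"
  atlas :: "('a, 'n) chart set"

definition cimage :: "('a, 'n::finite) chart \<Rightarrow> (real ^ 'n) set"
  where "cimage c = cmap c ` cdom c"

definition cinv :: "('a, 'n) chart \<Rightarrow> real ^ 'n \<Rightarrow> 'a"
  where "cinv c = inv_into (cdom c) (cmap c)"

definition overlap :: "('a, 'n) chart \<Rightarrow> ('a, 'n) chart \<Rightarrow> (real ^ 'n) set"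
  where "overlap c c' = cmap c ` (cdom c \<inter> cdom c')"

text \<open>Manifolds may have boundary: a chart maps onto a relatively open subset of a closed half-space,
  or of the whole of \<open>\<real>\<^sup>n\<close> (the case \<open>h = 0\<close>).\<close>

definition smooth_manifold :: "('a, 'n::finite) manifold \<Rightarrow> bool"
  where "smooth_manifold M \<longleftrightarrow>
    Hausdorff_space (mtop M) \<and> second_countable (mtop M) \<and>
    (\<Union>c\<in>atlas M. cdom c) = topspace (mtop M) \<and>
    (\<forall>c\<in>atlas M.
       openin (mtop M) (cdom c) \<and>
       (\<exists>h. openin (top_of_set {y. 0 \<le> h \<bullet> y}) (cimage c)) \<and>
       homeomorphic_map (subtopology (mtop M) (cdom c)) (top_of_set (cimage c)) (cmap c)) \<and>
    (\<forall>c\<in>atlas M. \<forall>c'\<in>atlas M. smooth_on (overlap c c') (cmap c' \<circ> cinv c))"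

definition manifold_interior :: "('a, 'n::finite) manifold \<Rightarrow> 'a set"
  where "manifold_interior M = {x. \<exists>c\<in>atlas M. x \<in> cdom c \<and> cmap c x \<in> interior (cimage c)}"

text \<open>The Jacobian matrix at \<open>x\<close> of the change of coordinates from \<open>c\<close> to \<open>c'\<close>.\<close>

definition coord_jacobian :: "('a, 'n::finite) chart \<Rightarrow> ('a, 'n) chart \<Rightarrow> 'a \<Rightarrow> 'n sqmatrix"
  where "coord_jacobian c c' x = jacobian (cmap c' \<circ> cinv c) (at (cmap c x) within overlap c c')"


text \<open>A form (and below a cone field) is the family of its expressions in the charts of the atlas:
  \<open>\<alpha> c x\<close> holds the components of \<open>\<alpha>\<close> at the point \<open>x\<close> in the coordinates of \<open>c\<close>. The values outside
  the charts are fixed to be \<open>0\<close>, so that equal forms are equal as functions.\<close>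

type_synonym ('a, 'n) form = "('a, 'n) chart \<Rightarrow> 'a \<Rightarrow> 'n multivector"

definition smooth_forms :: "('a, 'n::{finite,linorder}) manifold \<Rightarrow> nat \<Rightarrow> ('a, 'n) form set"
  where "smooth_forms M p = {\<alpha>.
    (\<forall>c x. \<not> (c \<in> atlas M \<and> x \<in> cdom c) \<longrightarrow> \<alpha> c x = 0) \<and>
    (\<forall>c x. \<alpha> c x \<in> multivectors p) \<and>
    (\<forall>c\<in>atlas M. smooth_on (cimage c) (\<lambda>y. \<alpha> c (cinv c y))) \<and>
    (\<forall>c\<in>atlas M. \<forall>c'\<in>atlas M. \<forall>x\<in>cdom c \<inter> cdom c'.
       \<alpha> c x = transpose (compound (coord_jacobian c c' x)) *v \<alpha> c' x)}"

definition form_lincomb :: "real \<Rightarrow> ('a, 'n::finite) form \<Rightarrow> real \<Rightarrow> ('a, 'n) form \<Rightarrow> ('a, 'n) form"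
  where "form_lincomb a \<alpha> b \<beta> = (\<lambda>c x. a *\<^sub>R \<alpha> c x + b *\<^sub>R \<beta> c x)"

definition zero_form :: "('a, 'n::finite) form"
  where "zero_form = (\<lambda>c x. 0)"

definition vanishes_on :: "'a set \<Rightarrow> ('a, 'n::finite) form \<Rightarrow> bool"
  where "vanishes_on S \<alpha> \<longleftrightarrow> (\<forall>x\<in>S. \<forall>c. \<alpha> c x = 0)"

definition form_support :: "('a, 'n::finite) manifold \<Rightarrow> ('a, 'n) form \<Rightarrow> 'a set"
  where "form_support M \<alpha> = mtop M closure_of {x. \<exists>c. \<alpha> c x \<noteq> 0}"

text \<open>The space \<open>\<D>\<^sup>p(M)\<close>.\<close>

definition test_forms :: "('a, 'n::{finite,linorder}) manifold \<Rightarrow> nat \<Rightarrow> ('a, 'n) form set"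
  where "test_forms M p = {\<alpha> \<in> smooth_forms M p. compactin (mtop M) (form_support M \<alpha>)}"

text \<open>\<open>d (f dx\<^bsub>I\<^esub>) = (\<Sum>j. \<partial>\<^sub>j f dx\<^sub>j \<and> dx\<^bsub>I\<^esub>)\<close>, where moving \<open>dx\<^sub>j\<close> into its place produces the sign.\<close>

definition ext_deriv :: "('a, 'n::{finite,linorder}) manifold \<Rightarrow> ('a, 'n) form \<Rightarrow> ('a, 'n) form"
  where "ext_deriv M \<alpha> = (\<lambda>c x.
    if c \<in> atlas M \<and> x \<in> cdom c
    then (\<chi> J. \<Sum>j\<in>J. (- 1) ^ card {i \<in> J. i < j} *
                 partial (cimage c) j (\<lambda>y. \<alpha> c (cinv c y) $ (J - {j})) (cmap c x))
    else 0)"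


text \<open>De Rham cohomology. Exactness refers to arbitrary, not only compactly supported, primitives.\<close>

definition closed_forms :: "('a, 'n::{finite,linorder}) manifold \<Rightarrow> nat \<Rightarrow> ('a, 'n) form set"
  where "closed_forms M p = {\<alpha> \<in> smooth_forms M p. ext_deriv M \<alpha> = zero_form}"

definition exact_forms :: "('a, 'n::{finite,linorder}) manifold \<Rightarrow> nat \<Rightarrow> ('a, 'n) form set"
  where "exact_forms M p = insert zero_form {ext_deriv M \<beta> | \<beta> q. p = Suc q \<and> \<beta> \<in> smooth_forms M q}"

definition cohomologous :: "('a, 'n::{finite,linorder}) manifold \<Rightarrow> nat \<Rightarrow> (('a, 'n) form \<times> ('a, 'n) form) set"
  where "cohomologous M p =
    {(\<alpha>, \<beta>). \<alpha> \<in> closed_forms M p \<and> \<beta> \<in> closed_forms M p \<and> form_lincomb 1 \<alpha> (- 1) \<beta> \<in> exact_forms M p}"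

definition cohomology_class :: "('a, 'n::{finite,linorder}) manifold \<Rightarrow> nat \<Rightarrow> ('a, 'n) form \<Rightarrow> ('a, 'n) form set"
  where "cohomology_class M p \<alpha> = cohomologous M p `` {\<alpha>}"

definition cohomology :: "('a, 'n::{finite,linorder}) manifold \<Rightarrow> nat \<Rightarrow> ('a, 'n) form set set"
  where "cohomology M p = closed_forms M p // cohomologous M p"


text \<open>The \<open>C\<^sup>\<infinity>\<close>-topology: uniform convergence of all partial derivatives on compact subsets of charts.\<close>

definition Cinf_topology :: "('a, 'n::{finite,linorder}) manifold \<Rightarrow> nat \<Rightarrow> ('a, 'n) form topology"
  where "Cinf_topology M p = topology_generated_by
    {{\<beta> \<in> test_forms M p. \<forall>x\<in>K.
        norm (partials (cimage c) is (\<lambda>y. \<beta> c (cinv c y)) (cmap c x)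
            - partials (cimage c) is (\<lambda>y. \<alpha> c (cinv c y)) (cmap c x)) < \<epsilon>} | \<alpha> c K is \<epsilon>.
      \<alpha> \<in> test_forms M p \<and> c \<in> atlas M \<and> compactin (mtop M) K \<and> K \<subseteq> cdom c \<and> 0 < \<epsilon>}"

text \<open>As usual for an inductive limit, a linear functional on \<open>\<D>\<^sup>p(M)\<close> is continuous iff its restriction
  to the forms supported in \<open>K\<close> is continuous for every compact \<open>K\<close>.\<close>

definition current :: "('a, 'n::{finite,linorder}) manifold \<Rightarrow> nat \<Rightarrow> (('a, 'n) form \<Rightarrow> real) \<Rightarrow> bool"
  where "current M p T \<longleftrightarrow>
    (\<forall>\<alpha>\<in>test_forms M p. \<forall>\<beta>\<in>test_forms M p. \<forall>a b. T (form_lincomb a \<alpha> b \<beta>) = a * T \<alpha> + b * T \<beta>) \<and>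
    (\<forall>K. compactin (mtop M) K \<longrightarrow>
       continuous_map (subtopology (Cinf_topology M p) {\<alpha> \<in> test_forms M p. form_support M \<alpha> \<subseteq> K})
         euclideanreal T)"


text \<open>The functional \<open>L\<close> is required to be positive on \<open>C - {0}\<close>, that is, \<open>C\<close> is the cone over the
  compact set \<open>L\<^sup>-\<^sup>1(1) \<inter> C\<close>. Without this, \<open>L = 0\<close> would make every convex cone compact.\<close>

definition compact_convex_cone :: "'v::real_normed_vector set \<Rightarrow> bool"
  where "compact_convex_cone C \<longleftrightarrow> convex_cone C \<and>
    (\<exists>L :: 'v \<Rightarrow> real. bounded_linear L \<and> (\<forall>v\<in>C. v \<noteq> 0 \<longrightarrow> 0 < L v) \<and> compact (L -` {1} \<inter> C))"

text \<open>\<open>C c x\<close> is the cone at \<open>x\<close> expressed in the coordinates of the chart \<open>c\<close>.\<close>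

type_synonym ('a, 'n) cone_field = "('a, 'n) chart \<Rightarrow> 'a \<Rightarrow> 'n multivector set"

definition unit_vectors :: "'v::real_normed_vector set \<Rightarrow> 'v set"
  where "unit_vectors C = {v \<in> C. norm v = 1}"

text \<open>The continuity condition is Hausdorff convergence of the sets of unit vectors, written out because
  the set of unit vectors of the cone \<open>{0}\<close> is empty.\<close>

definition cone_structure ::
    "('a, 'n::{finite,linorder}) manifold \<Rightarrow> nat \<Rightarrow> 'a set \<Rightarrow> 'a set \<Rightarrow> ('a, 'n) cone_field \<Rightarrow> bool"
  where "cone_structure M p X Z C \<longleftrightarrow>
    (\<forall>c\<in>atlas M. \<forall>x\<in>cdom c \<inter> (X - Z). C c x \<subseteq> multivectors p \<and> compact_convex_cone (C c x)) \<and>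
    (\<forall>c\<in>atlas M. \<forall>c'\<in>atlas M. \<forall>x\<in>cdom c \<inter> cdom c' \<inter> (X - Z).
       C c' x = (\<lambda>v. compound (coord_jacobian c c' x) *v v) ` C c x) \<and>
    (\<forall>x\<in>X - Z. \<exists>c\<in>atlas M. x \<in> cdom c \<and>
       (\<forall>\<epsilon>>0. \<exists>W. openin (mtop M) W \<and> x \<in> W \<and>
          (\<forall>y\<in>W \<inter> cdom c \<inter> (X - Z).
             (\<forall>v\<in>unit_vectors (C c y). \<exists>w\<in>unit_vectors (C c x). dist v w < \<epsilon>) \<and>
             (\<forall>w\<in>unit_vectors (C c x). \<exists>v\<in>unit_vectors (C c y). dist v w < \<epsilon>))))"

definition pos_on :: "('a, 'n::finite) manifold \<Rightarrow> ('a, 'n) cone_field \<Rightarrow> 'a set \<Rightarrow> ('a, 'n) form \<Rightarrow> bool"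
  where "pos_on M C S \<alpha> \<longleftrightarrow> (\<forall>c\<in>atlas M. \<forall>x\<in>cdom c \<inter> S. \<forall>v\<in>C c x. v \<noteq> 0 \<longrightarrow> 0 < \<alpha> c x \<bullet> v)"

definition nonneg_on :: "('a, 'n::finite) manifold \<Rightarrow> ('a, 'n) cone_field \<Rightarrow> 'a set \<Rightarrow> ('a, 'n) form \<Rightarrow> bool"
  where "nonneg_on M C S \<alpha> \<longleftrightarrow> (\<forall>c\<in>atlas M. \<forall>x\<in>cdom c \<inter> S. \<forall>v\<in>C c x. 0 \<le> \<alpha> c x \<bullet> v)"

definition rel_transversal ::
    "('a, 'n::{finite,linorder}) manifold \<Rightarrow> nat \<Rightarrow> 'a set \<Rightarrow> 'a set \<Rightarrow> ('a, 'n) cone_field \<Rightarrow> ('a, 'n) form \<Rightarrow> bool"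
  where "rel_transversal M p X Z C \<alpha> \<longleftrightarrow>
    \<alpha> \<in> test_forms M p \<and> pos_on M C (X - Z) \<alpha> \<and> vanishes_on Z \<alpha>"

definition O_cone ::
    "('a, 'n::{finite,linorder}) manifold \<Rightarrow> nat \<Rightarrow> 'a set \<Rightarrow> ('a, 'n) cone_field \<Rightarrow> 'a set \<Rightarrow> ('a, 'n) form set"
  where "O_cone M p X C U = {\<alpha> \<in> test_forms M p. pos_on M C (X - U) \<alpha>}"

definition A_cone ::
    "('a, 'n::{finite,linorder}) manifold \<Rightarrow> nat \<Rightarrow> 'a set \<Rightarrow> 'a set \<Rightarrow> ('a, 'n) cone_field \<Rightarrow> 'a set \<Rightarrow> ('a, 'n) form set"
  where "A_cone M p X Z C U = {\<alpha> \<in> test_forms M p.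
    vanishes_on Z \<alpha> \<and> nonneg_on M C ((X \<inter> mtop M closure_of U) - Z) \<alpha> \<and>
    ext_deriv M \<alpha> = zero_form \<and> cohomology_class M p \<alpha> = cohomology_class M p zero_form}"

definition structure_current ::
    "('a, 'n::{finite,linorder}) manifold \<Rightarrow> nat \<Rightarrow> 'a set \<Rightarrow> ('a, 'n) cone_field \<Rightarrow> 'a set \<Rightarrow> (('a, 'n) form \<Rightarrow> real) \<Rightarrow> bool"
  where "structure_current M p X C U T \<longleftrightarrow> current M p T \<and> (\<forall>\<alpha>\<in>O_cone M p X C U. 0 < T \<alpha>)"

definition structure_cycle ::
    "('a, 'n::{finite,linorder}) manifold \<Rightarrow> nat \<Rightarrow> 'a set \<Rightarrow> 'a set \<Rightarrow> ('a, 'n) cone_field \<Rightarrow> 'a set \<Rightarrow> (('a, 'n) form \<Rightarrow> real) \<Rightarrow> bool"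
  where "structure_cycle M p X Z C U T \<longleftrightarrow>
    structure_current M p X C U T \<and> (\<forall>\<alpha>\<in>A_cone M p X Z C U. T \<alpha> \<le> 0)"

text \<open>Currents only act on compactly supported forms, so representatives are taken in \<open>\<D>\<^sup>p(M)\<close>; for
  compact \<open>M\<close> this is no restriction.\<close>

definition representatives_near ::
    "('a, 'n::{finite,linorder}) manifold \<Rightarrow> nat \<Rightarrow> 'a set \<Rightarrow> ('a, 'n) form set \<Rightarrow> ('a, 'n) form set"
  where "representatives_near M p S \<xi> =
    {\<alpha> \<in> \<xi> \<inter> test_forms M p. \<exists>V. openin (mtop M) V \<and> S \<subseteq> V \<and> vanishes_on V \<alpha>}"

text \<open>\<open>H\<^bsub>Z\<^esub>\<close> is \<open>vanishing_classes M p Z\<close> and \<open>H\<^bsub>U\<^esub>\<close> is \<open>vanishing_classes M p (mtop M closure_of U)\<close>.\<close>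

definition vanishing_classes ::
    "('a, 'n::{finite,linorder}) manifold \<Rightarrow> nat \<Rightarrow> 'a set \<Rightarrow> ('a, 'n) form set set"
  where "vanishing_classes M p S = {\<xi> \<in> cohomology M p. representatives_near M p S \<xi> \<noteq> {}}"

text \<open>For a structure cycle \<open>T\<close> relative to \<open>U\<close> the value does not depend on the representative: the
  difference \<open>\<delta>\<close> of two of them satisfies \<open>\<delta>, - \<delta> \<in> A_cone M p X Z C U\<close>.\<close>

definition induced_hom ::
    "('a, 'n::{finite,linorder}) manifold \<Rightarrow> nat \<Rightarrow> 'a set \<Rightarrow> (('a, 'n) form \<Rightarrow> real) \<Rightarrow> ('a, 'n) form set \<Rightarrow> real"
  where "induced_hom M p U T \<xi> = T (SOME \<alpha>. \<alpha> \<in> representatives_near M p (mtop M closure_of U) \<xi>)"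

end

theory Submission
  imports Defs "HOL-Library.Function_Algebras"
begin

text \<open>
  If \<open>\<alpha> \<in> \<xi>\<close> is relatively transversal and \<open>\<omega>\<close> is a representative of \<open>\<xi>\<close> that vanishes near the
  closure of \<open>U\<close>, then \<open>\<alpha>\<close> lies in the cone \<open>\<O>\<^sub>U\<close> (\<open>O_cone\<close>), and the exact form \<open>\<alpha> - \<omega>\<close> lies in the cone
  \<open>\<A>\<^bsub>U,0\<^esub>\<close> (\<open>A_cone\<close>), since it agrees with \<open>\<alpha>\<close> on the closure of \<open>U\<close>. Hence
  \<open>T \<omega> \<ge> T \<alpha> > 0\<close> for every structure cycle \<open>T\<close> relative to \<open>U\<close> (\<open>transversal_imp_positive\<close>).

  For the converse, fix \<open>U\<close> and such an \<open>\<omega>\<close>. The cone \<open>\<O>\<^sub>U\<close> is open, already for uniform convergence on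
  finitely many compact sets, because \<open>X - U\<close> is compact and the cones vary continuously
  (\<open>O_cone_open\<close>). If it missed \<open>\<omega> + \<A>\<^bsub>U,0\<^esub>\<close>, the Hahn-Banach theorem (\<open>cone_separation\<close>) would give a
  linear functional that is positive on \<open>\<O>\<^sub>U\<close> and nonpositive on \<open>\<omega>\<close> and \<open>\<A>\<^bsub>U,0\<^esub>\<close>. Positivity makes it
  continuous, so it would be a structure cycle with \<open>T \<omega> \<le> 0\<close>. Thus the hypothesis yields, for every
  small \<open>U\<close>, a form \<open>\<alpha>\<^sub>U \<in> \<xi>\<close> that vanishes on \<open>Z\<close>, is nonnegative on the cones, and is positive on
  them outside \<open>U\<close> (\<open>O_cone_meets_A_cone_translate\<close>,
  \<open>partially_transversal_form\<close>).

  Positivity all the way up to \<open>Z\<close> needs infinitely many neighbourhoods. Choose \<open>U\<^sub>0, U\<^sub>1, \<dots>\<close> such that each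
  point of \<open>X - Z\<close> lies outside some \<open>U\<^sub>k\<close>; then a sum \<open>\<Sum>k. w\<^sub>k \<alpha>\<^sub>k\<close> with positive weights of total mass \<open>1\<close> is
  positive on all of \<open>X - Z\<close>. Two points require care: the sum must converge to a form in the class \<open>\<xi>\<close>,
  and its support must be compact although the supports of the \<open>\<alpha>\<^sub>k\<close> may grow. Both are handled on the
  level of primitives. Write \<open>\<alpha>\<^sub>k = \<omega> + d \<beta>\<^sub>k\<close> (in degree \<open>0\<close> the \<open>\<alpha>\<^sub>k\<close> are all equal), let the weights decrease
  so fast that \<open>\<gamma> = \<Sum>k. w\<^sub>k \<beta>\<^sub>k\<close> converges with all derivatives (\<open>smooth_form_series\<close>), and take \<open>\<omega> + d (\<rho> \<gamma>)\<close> with a compactly supported cutoff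
  function \<open>\<rho>\<close> that is \<open>1\<close> near \<open>X\<close> (\<open>weighted_sum_transversal\<close>).

  For this, \<open>d (\<rho> \<gamma>)\<close> has to be a closed form again, that is, \<open>d \<circ> d = 0\<close> and \<open>d\<close> has to commute with
  coordinate changes. The first is the symmetry of second derivatives. The second follows from the
  Leibniz rule, \<open>d \<circ> d = 0\<close>, and the compatibility of pullback with the wedge product by a covector,
  which in terms of minors is the Laplace expansion.
\<close>


section \<open>Separation of convex cones\<close>

text \<open>Pointwise operations turn the forms on a manifold into elements of a real vector space, so that
  subspaces and the separation theorem are available for them.\<close>

instantiation "fun" :: (type, real_vector) real_vector
begin

definition scaleR_fun_def: "a *\<^sub>R f = (\<lambda>x. a *\<^sub>R f x)"

instance
  by standard (simp_all add: scaleR_fun_def fun_eq_iff scaleR_add_right scaleR_add_left)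

end

lemma scaleR_fun_apply [simp]: "(a *\<^sub>R f) x = a *\<^sub>R f x"
  by (simp add: scaleR_fun_def)

text \<open>A form of the Hahn-Banach theorem. By Zorn's lemma, \<open>N\<close> is contained in a convex cone \<open>K \<subseteq> D\<close> that is
  maximal among those disjoint from \<open>P\<close>. Then \<open>K\<close> is a half-space, that is, \<open>K \<union> - K = D\<close>: if neither \<open>v\<close>
  nor \<open>- v\<close> were in \<open>K\<close>, both enlarged cones would meet \<open>P\<close>, in \<open>x + s v\<close> and \<open>y - t v\<close> say, and
  \<open>t x + s y\<close> would lie in \<open>K \<inter> P\<close>. The functional measures how far \<open>v\<close> has to be moved in the direction
  \<open>- e\<close> to get into \<open>K\<close>. The assumption \<open>core\<close> says that \<open>P\<close> is algebraically open in \<open>D\<close>.\<close>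

lemma cone_separation:
  fixes D P N :: "'v::real_vector set"
  assumes D: "subspace D"
    and P: "P \<subseteq> D" "\<And>x y. x \<in> P \<Longrightarrow> y \<in> P \<Longrightarrow> x + y \<in> P" "\<And>a x. 0 < a \<Longrightarrow> x \<in> P \<Longrightarrow> a *\<^sub>R x \<in> P"
    and core: "\<And>x v. x \<in> P \<Longrightarrow> v \<in> D \<Longrightarrow> \<exists>t>0. x + t *\<^sub>R v \<in> P"
    and N: "N \<subseteq> D" "0 \<in> N" "\<And>x y. x \<in> N \<Longrightarrow> y \<in> N \<Longrightarrow> x + y \<in> N" "\<And>a x. 0 < a \<Longrightarrow> x \<in> N \<Longrightarrow> a *\<^sub>R x \<in> N"
    and disj: "P \<inter> N = {}" and e: "e \<in> P"
  shows "\<exists>T :: 'v \<Rightarrow> real. (\<forall>x\<in>D. \<forall>y\<in>D. \<forall>a b. T (a *\<^sub>R x + b *\<^sub>R y) = a * T x + b * T y) \<and>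
    (\<forall>x\<in>P. 0 < T x) \<and> (\<forall>x\<in>N. T x \<le> 0)"
proof -
  define \<N> where "\<N> = {K. N \<subseteq> K \<and> K \<subseteq> D \<and> (\<forall>x\<in>K. \<forall>y\<in>K. x + y \<in> K) \<and>
    (\<forall>a>0. \<forall>x\<in>K. a *\<^sub>R x \<in> K) \<and> P \<inter> K = {}}"
  have "\<exists>K\<in>\<N>. \<forall>L\<in>\<N>. K \<subseteq> L \<longrightarrow> L = K"
  proof (rule subset_Zorn_nonempty)
    show "\<N> \<noteq> {}"
    proof -
      have "N \<in> \<N>"
        unfolding \<N>_def using N disj by simp
      then show ?thesis by auto
    qed
  next
    fix \<C> assume "\<C> \<noteq> {}" and ch: "subset.chain \<N> \<C>"
    then have sub: "\<C> \<subseteq> \<N>" and tot: "\<And>A B. A \<in> \<C> \<Longrightarrow> B \<in> \<C> \<Longrightarrow> A \<subseteq> B \<or> B \<subseteq> A"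
      by (auto simp: subset_chain_def)
    have "x + y \<in> \<Union>\<C>" if x: "x \<in> \<Union>\<C>" and y: "y \<in> \<Union>\<C>" for x y
    proof -
      obtain A B where AB: "A \<in> \<C>" "x \<in> A" "B \<in> \<C>" "y \<in> B"
        using x y by blast
      then obtain E where E: "E \<in> \<C>" "x \<in> E" "y \<in> E"
        using tot[OF AB(1,3)] by auto
      then have "E \<in> \<N>"
        using sub by auto
      then have "x + y \<in> E"
        using E by (simp add: \<N>_def)
      then show ?thesis
        using E(1) by auto
    qed
    moreover have sub': "N \<subseteq> A \<and> A \<subseteq> D \<and> P \<inter> A = {}" if "A \<in> \<C>" for A
      using that sub by (auto simp: \<N>_def)
    then have "N \<subseteq> \<Union>\<C>" "\<Union>\<C> \<subseteq> D" "P \<inter> \<Union>\<C> = {}"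
      using \<open>\<C> \<noteq> {}\<close> by fast+
    moreover have "a *\<^sub>R x \<in> \<Union>\<C>" if "0 < a" "x \<in> \<Union>\<C>" for a x
      using that sub unfolding \<N>_def by auto
    ultimately show "\<Union>\<C> \<in> \<N>"
      unfolding \<N>_def by simp
  qed
  then obtain K where K: "K \<in> \<N>" and max: "\<And>L. L \<in> \<N> \<Longrightarrow> K \<subseteq> L \<Longrightarrow> L = K"
    by blast
  have NK: "N \<subseteq> K" and KD: "K \<subseteq> D" and Kadd: "\<And>x y. x \<in> K \<Longrightarrow> y \<in> K \<Longrightarrow> x + y \<in> K"
    and Kscale: "\<And>a x. 0 < a \<Longrightarrow> x \<in> K \<Longrightarrow> a *\<^sub>R x \<in> K" and PK: "P \<inter> K = {}"
    using K unfolding \<N>_def by auto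
  have K0: "0 \<in> K"
    using NK N by blast
  have meet: "\<exists>x\<in>K. \<exists>t>0. x + t *\<^sub>R v \<in> P" if v: "v \<in> D" "v \<notin> K" for v
  proof -
    define L where "L = {x + t *\<^sub>R v | x t. x \<in> K \<and> 0 \<le> t}"
    have KL: "K \<subseteq> L"
    proof
      fix x assume "x \<in> K"
      then show "x \<in> L" unfolding L_def using scaleR_zero_left[of v] by (metis (mono_tags, lifting) add.right_neutral mem_Collect_eq order.refl)
    qed
    have "0 + 1 *\<^sub>R v \<in> L"
      unfolding L_def using K0 zero_le_one by blast
    then have "L \<noteq> K"
      using v by auto
    then have "L \<notin> \<N>"
      using max KL by blast
    moreover have "x + y \<in> L" if "x \<in> L" "y \<in> L" for x y
    proof -
      obtain x' s where "x = x' + s *\<^sub>R v" "x' \<in> K" "0 \<le> s"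
        using \<open>x \<in> L\<close> by (auto simp: L_def)
      moreover obtain y' t where "y = y' + t *\<^sub>R v" "y' \<in> K" "0 \<le> t"
        using \<open>y \<in> L\<close> by (auto simp: L_def)
      ultimately have "x + y = (x' + y') + (s + t) *\<^sub>R v" "x' + y' \<in> K" "0 \<le> s + t"
        using Kadd by (auto simp: algebra_simps)
      then show ?thesis unfolding L_def by blast
    qed
    moreover have "a *\<^sub>R x \<in> L" if "0 < a" "x \<in> L" for a x
    proof -
      obtain x' s where "x = x' + s *\<^sub>R v" "x' \<in> K" "0 \<le> s"
        using \<open>x \<in> L\<close> by (auto simp: L_def)
      then have "a *\<^sub>R x = a *\<^sub>R x' + (a * s) *\<^sub>R v" "a *\<^sub>R x' \<in> K" "0 \<le> a * s"
        using Kscale \<open>0 < a\<close> by (auto simp: algebra_simps)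
      then show ?thesis unfolding L_def by blast
    qed
    moreover have "L \<subseteq> D"
      unfolding L_def using KD v D by (auto intro!: subspace_add subspace_scale)
    moreover have "N \<subseteq> L"
      using NK KL by auto
    ultimately have "P \<inter> L \<noteq> {}"
      unfolding \<N>_def by auto
    then obtain x t where xt: "x \<in> K" "0 \<le> t" "x + t *\<^sub>R v \<in> P"
      by (auto simp: L_def)
    moreover have "t \<noteq> 0"
      using xt PK by auto
    ultimately show ?thesis
      by (intro bexI[of _ x] exI[of _ t]) auto
  qed
  have total: "v \<in> K \<or> - v \<in> K" if v: "v \<in> D" for v
  proof (rule ccontr)
    assume neg: "\<not> ?thesis"
    obtain x s where x: "x \<in> K" "0 < s" "x + s *\<^sub>R v \<in> P"
      using meet[of v] v neg by blast
    obtain y t where y: "y \<in> K" "0 < t" "y + t *\<^sub>R (- v) \<in> P"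
      using meet[of "- v"] v neg D subspace_neg by blast
    have "t *\<^sub>R (x + s *\<^sub>R v) + s *\<^sub>R (y + t *\<^sub>R (- v)) \<in> P"
      by (rule P(2); rule P(3); fact x y)
    moreover have "t *\<^sub>R (x + s *\<^sub>R v) + s *\<^sub>R (y + t *\<^sub>R (- v)) = t *\<^sub>R x + s *\<^sub>R y"
      by (simp add: algebra_simps)
    moreover have "t *\<^sub>R x + s *\<^sub>R y \<in> K"
      using x y by (intro Kadd Kscale)
    ultimately show False
      using PK by auto
  qed
  have eD: "e \<in> D" and eK: "e \<notin> K"
    using e P PK by auto
  \<comment> \<open>\<open>S v\<close> is a half-line that is unbounded above; \<open>T v\<close> is its endpoint.\<close>
  define S where "S v = {t. v - t *\<^sub>R e \<in> K}" for v
  define T where "T v = Inf (S v)" for v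
  have SD: "v - t *\<^sub>R e \<in> D" if "v \<in> D" for v t
    using that D eD by (simp add: subspace_diff subspace_scale)
  have notS: "- t \<in> S (- v)" if "v \<in> D" "t \<notin> S v" for v t
  proof -
    have "- (v - t *\<^sub>R e) \<in> K"
      using total[OF SD[OF that(1), of t]] that(2) by (auto simp: S_def)
    then show ?thesis by (simp add: S_def)
  qed
  have ne: "S v \<noteq> {}" if v: "v \<in> D" for v
  proof -
    obtain t where t: "t > 0" "e + t *\<^sub>R (- v) \<in> P"
      using core[OF e, of "- v"] D v subspace_neg by blast
    then have "(1 / t) *\<^sub>R (e + t *\<^sub>R (- v)) \<in> P"
      using P(3) by simp
    then have "(1 / t) *\<^sub>R e - v \<in> P"
      using t by (simp add: algebra_simps)
    then have "- (1/t) \<notin> S (- v)"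
      using PK by (auto simp: S_def algebra_simps)
    then have "1 / t \<in> S v"
      using notS[of "- v" "- (1/t)"] v D subspace_neg by fastforce
    then show ?thesis by blast
  qed
  have lower: "s < t" if "v - s *\<^sub>R e \<in> P" "t \<in> S v" for v s t
  proof (rule ccontr)
    assume "\<not> s < t"
    then consider "t = s" | "0 < s - t" by linarith
    then have "(v - s *\<^sub>R e) + (s - t) *\<^sub>R e \<in> P"
      using that P(2) P(3) e by cases auto
    moreover have "(v - s *\<^sub>R e) + (s - t) *\<^sub>R e = v - t *\<^sub>R e"
      by (simp add: algebra_simps)
    ultimately show False
      using that(2) PK by (auto simp: S_def)
  qed
  have bdd: "bdd_below (S v)" if v: "v \<in> D" for v
  proof -
    obtain t where t: "t > 0" "e + t *\<^sub>R v \<in> P"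
      using core[OF e v] by blast
    then have "(1 / t) *\<^sub>R (e + t *\<^sub>R v) \<in> P"
      using P(3) by simp
    then have "v - (- (1 / t)) *\<^sub>R e \<in> P"
      using t by (simp add: algebra_simps)
    then show ?thesis
      using lower by (meson bdd_belowI less_imp_le)
  qed
  have Tle: "T v \<le> t" if "v \<in> D" "t \<in> S v" for v t
    unfolding T_def using bdd that by (simp add: cInf_lower)
  have Tge: "b \<le> T v" if "v \<in> D" "\<And>t. t \<in> S v \<Longrightarrow> b \<le> t" for v b
    unfolding T_def using ne that by (simp add: cInf_greatest)
  have Tlt: "\<exists>t\<in>S v. t < b" if "v \<in> D" "T v < b" for v b
    using Tge[OF that(1), of b] that(2) by force
  have sub: "T (x + y) \<le> T x + T y" if xD: "x \<in> D" and yD: "y \<in> D" for x y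
  proof (rule field_le_epsilon)
    fix \<epsilon> :: real assume "\<epsilon> > 0"
    obtain s where s: "s \<in> S x" "s < T x + \<epsilon> / 2"
      using Tlt[of x "T x + \<epsilon> / 2"] xD \<open>\<epsilon> > 0\<close> by auto
    obtain t where t: "t \<in> S y" "t < T y + \<epsilon> / 2"
      using Tlt[of y "T y + \<epsilon> / 2"] yD \<open>\<epsilon> > 0\<close> by auto
    have "s + t \<in> S (x + y)"
      using Kadd[of "x - s *\<^sub>R e" "y - t *\<^sub>R e"] s t by (simp add: S_def algebra_simps)
    then have "T (x + y) \<le> s + t"
      using Tle xD yD D subspace_add by blast
    then show "T (x + y) \<le> T x + T y + \<epsilon>"
      using s t by linarith
  qed
  have T0: "T 0 \<ge> 0"
  proof (rule Tge)
    show "0 \<in> D" using D by (rule subspace_0)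
    fix t assume t: "t \<in> S 0"
    show "0 \<le> t"
    proof (rule ccontr)
      assume "\<not> 0 \<le> t"
      then have "(- t) *\<^sub>R e \<in> P"
        using P(3)[of "- t" e] e by simp
      then show False
        using t PK by (auto simp: S_def)
    qed
  qed
  have neg: "T (- v) = - T v" if v: "v \<in> D" for v
  proof (rule antisym)
    have v': "- v \<in> D" using v D subspace_neg by blast
    show "T (- v) \<le> - T v"
    proof (rule field_le_epsilon)
      fix \<epsilon> :: real assume "\<epsilon> > 0"
      then have "T v - \<epsilon> \<notin> S v"
        using Tle[OF v, of "T v - \<epsilon>"] by force
      then have "- (T v - \<epsilon>) \<in> S (- v)"
        using notS v by blast
      then show "T (- v) \<le> - T v + \<epsilon>"
        using Tle v' by fastforce
    qed
    show "- T v \<le> T (- v)"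
      using sub[OF v v'] T0 by simp
  qed
  have add: "T (x + y) = T x + T y" if "x \<in> D" "y \<in> D" for x y
  proof (rule antisym)
    have D': "- x \<in> D" "- y \<in> D" "x + y \<in> D" using that D by (auto intro: subspace_neg subspace_add)
    have "T (- (x + y)) \<le> T (- x) + T (- y)"
      using sub[OF D'(1,2)] by (simp add: algebra_simps)
    then show "T x + T y \<le> T (x + y)"
      using neg[OF that(1)] neg[OF that(2)] neg[OF D'(3)] by linarith
  qed (use sub that in auto)
  have scale_le: "T (a *\<^sub>R v) \<le> a * T v" if "v \<in> D" "0 < a" for a v
  proof -
    have "T (a *\<^sub>R v) / a \<le> T v"
    proof (rule Tge[OF that(1)])
      fix t assume "t \<in> S v"
      then have "a *\<^sub>R (v - t *\<^sub>R e) \<in> K"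
        using Kscale that unfolding S_def by blast
      then have "a * t \<in> S (a *\<^sub>R v)"
        by (simp add: S_def algebra_simps)
      then have "T (a *\<^sub>R v) \<le> a * t"
        using Tle that D subspace_scale by blast
      then show "T (a *\<^sub>R v) / a \<le> t"
        using that by (simp add: field_simps)
    qed
    then show ?thesis
      using that by (simp add: field_simps)
  qed
  have scale_pos: "T (a *\<^sub>R v) = a * T v" if "v \<in> D" "0 < a" for a v
  proof -
    have "T ((1 / a) *\<^sub>R (a *\<^sub>R v)) \<le> (1 / a) * T (a *\<^sub>R v)"
      using that D subspace_scale by (intro scale_le) auto
    then have "a * T v \<le> T (a *\<^sub>R v)"
      using that by (simp add: field_simps)
    then show ?thesis using scale_le[OF that] by linarith
  qed
  have scale: "T (a *\<^sub>R v) = a * T v" if v: "v \<in> D" for a v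
  proof -
    consider "0 < a" | "a = 0" | "0 < - a" by linarith
    then show ?thesis
    proof cases
      case 1 then show ?thesis using scale_pos v by blast
    next
      case 2
      have "T 0 = 0" using neg[of 0] D subspace_0 by fastforce
      then show ?thesis using 2 by simp
    next
      case 3
      have "T (- ((- a) *\<^sub>R v)) = - T ((- a) *\<^sub>R v)"
        using neg D v subspace_scale by blast
      then show ?thesis using scale_pos[OF v 3] by simp
    qed
  qed
  show ?thesis
  proof (intro exI[of _ T] conjI ballI allI)
    show "T (a *\<^sub>R x + b *\<^sub>R y) = a * T x + b * T y" if "x \<in> D" "y \<in> D" for a b x y
      using that D add scale by (simp add: subspace_scale)
    show "0 < T x" if x: "x \<in> P" for x
    proof -
      obtain t where t: "t > 0" "x + t *\<^sub>R (- e) \<in> P"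
        using core[OF x, of "- e"] D eD subspace_neg by blast
      have "t \<le> T x"
        using x P(1) t lower[of x t] by (intro Tge) (auto intro: less_imp_le)
      then show ?thesis using t by linarith
    qed
    show "T x \<le> 0" if "x \<in> N" for x
      using that NK N(1) by (intro Tle) (auto simp: S_def)
  qed
qed


section \<open>Smooth functions on relatively open subsets of half-spaces\<close>

text \<open>The images of charts. The case \<open>h = 0\<close> covers the open subsets of the whole space.\<close>

definition halfspace_open :: "(real ^ 'n) set \<Rightarrow> bool"
  where "halfspace_open S \<longleftrightarrow> (\<exists>h. openin (top_of_set {y. 0 \<le> h \<bullet> y}) S)"

lemma halfspace_openE:
  assumes "halfspace_open S"
  obtains h where "\<And>x. x \<in> S \<Longrightarrow> 0 \<le> h \<bullet> x"
    and "\<And>x. x \<in> S \<Longrightarrow> \<exists>e>0. ball x e \<inter> {y. 0 \<le> h \<bullet> y} \<subseteq> S"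
proof -
  obtain h where h: "openin (top_of_set {y. 0 \<le> h \<bullet> y}) S"
    using assms unfolding halfspace_open_def by blast
  then obtain U where U: "open U" "S = {y. 0 \<le> h \<bullet> y} \<inter> U"
    unfolding openin_open by blast
  show ?thesis
  proof
    show "0 \<le> h \<bullet> x" if "x \<in> S" for x
      using that U by auto
    show "\<exists>e>0. ball x e \<inter> {y. 0 \<le> h \<bullet> y} \<subseteq> S" if "x \<in> S" for x
      using that U by (metis IntD2 Int_commute inf_mono open_contains_ball subset_refl)
  qed
qed

lemma halfspace_open_openin:
  assumes "halfspace_open S" and "openin (top_of_set S) T"
  shows "halfspace_open T"
  using assms openin_trans unfolding halfspace_open_def by blast

text \<open>At a boundary point of a half-space, each coordinate direction can still be followed a short way with
  one of the two signs, which is enough to determine the derivative.\<close>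

lemma frechet_derivative_within_halfspace:
  fixes f :: "real ^ 'n \<Rightarrow> 'b::real_normed_vector"
  assumes S: "halfspace_open S" and x: "x \<in> S" and f: "(f has_derivative f') (at x within S)"
  shows "frechet_derivative f (at x within S) = f'"
proof -
  obtain h where h: "0 \<le> h \<bullet> x" and "\<exists>e>0. ball x e \<inter> {y. 0 \<le> h \<bullet> y} \<subseteq> S"
    using S x by (metis halfspace_openE)
  then obtain r where r: "r > 0" "ball x r \<inter> {y. 0 \<le> h \<bullet> y} \<subseteq> S"
    by blast
  have "(f has_derivative frechet_derivative f (at x within S)) (at x within S)"
    using f frechet_derivative_works differentiableI by blast
  then show ?thesis
  proof (rule frechet_derivative_unique_within[OF _ f])
    fix i :: "real ^ 'n" and e :: real
    assume i: "i \<in> Basis" and e: "e > 0"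
    define d where "d = (if 0 \<le> h \<bullet> i then 1 else - 1) * (min e r / 2)"
    have d: "0 < \<bar>d\<bar>" "\<bar>d\<bar> < e" "\<bar>d\<bar> < r"
      using e r by (auto simp: d_def)
    have "0 \<le> d * (h \<bullet> i)"
      using e r by (auto simp: d_def mult_nonneg_nonneg zero_le_mult_iff)
    then have "0 \<le> h \<bullet> (x + d *\<^sub>R i)"
      using h by (simp add: inner_add_right)
    moreover have "x + d *\<^sub>R i \<in> ball x r"
      using d i by (simp add: dist_norm)
    ultimately show "\<exists>d. 0 < \<bar>d\<bar> \<and> \<bar>d\<bar> < e \<and> x + d *\<^sub>R i \<in> S"
      using d r by blast
  qed
qed

lemma partial_eqI:
  assumes "halfspace_open S" and "x \<in> S" and "(f has_derivative f') (at x within S)"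
  shows "partial S i f x = f' (axis i 1)"
  using frechet_derivative_within_halfspace[OF assms] by (simp add: partial_def)

text \<open>The derivative is selected by a choice operator. Functions that agree on \<open>S\<close> have the same derivatives
  within \<open>S\<close>, so the choice is the same, even where they are not differentiable.\<close>

lemma partial_cong:
  assumes "\<And>y. y \<in> S \<Longrightarrow> f y = g y" and "x \<in> S"
  shows "partial S i f x = partial S i g x"
proof -
  have "(f has_derivative f') (at x within S) \<longleftrightarrow> (g has_derivative f') (at x within S)" for f'
    using assms by (metis has_derivative_transform)
  then show ?thesis
    by (simp add: partial_def frechet_derivative_def)
qed

lemma at_within_openin:
  assumes "openin (top_of_set S) T" and "x \<in> T"
  shows "at x within T = at x within S"
proof -
  obtain U where U: "open U" "T = S \<inter> U"
    using assms unfolding openin_open by blast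
  show ?thesis
    by (rule at_within_nhd[of _ U]) (use assms U in auto)
qed

lemma partial_openin:
  assumes "openin (top_of_set S) T" and "x \<in> T"
  shows "partial T i f x = partial S i f x"
  using at_within_openin[OF assms] by (simp add: partial_def)

lemma partials_Nil [simp]: "partials S [] f = f"
  and partials_Cons [simp]: "partials S (i # is) f = partial S i (partials S is f)"
  and partials_snoc: "partials S (is @ [i]) f = partials S is (partial S i f)"
  by (simp_all add: partials_def)

lemma partials_cong:
  assumes "\<And>y. y \<in> S \<Longrightarrow> f y = g y" and "x \<in> S"
  shows "partials S is f x = partials S is g x"
  using assms(2) by (induction "is" arbitrary: x) (auto simp: assms(1) intro!: partial_cong)

lemma partials_openin:
  assumes T: "openin (top_of_set S) T" and "x \<in> T"
  shows "partials T is f x = partials S is f x"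
  using assms(2)
proof (induction "is" arbitrary: x)
  case (Cons i "is")
  have "partial T i (partials T is f) x = partial T i (partials S is f) x"
    using Cons by (intro partial_cong) auto
  also have "\<dots> = partial S i (partials S is f) x"
    using T Cons.prems by (rule partial_openin)
  finally show ?case by simp
qed simp

text \<open>Smoothness is proved degree by degree: the statement that all partial derivatives of order at most
  \<open>n\<close> are differentiable is accessible to induction on \<open>n\<close>.\<close>

primrec smooth_upto :: "nat \<Rightarrow> (real ^ 'n) set \<Rightarrow> (real ^ 'n \<Rightarrow> 'b::real_normed_vector) \<Rightarrow> bool"
  where
    "smooth_upto 0 S f \<longleftrightarrow> (\<forall>x\<in>S. f differentiable (at x within S))"
  | "smooth_upto (Suc n) S f \<longleftrightarrow>
      (\<forall>x\<in>S. f differentiable (at x within S)) \<and> (\<forall>i. smooth_upto n S (partial S i f))"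

lemma smooth_upto_iff:
  "smooth_upto n S f \<longleftrightarrow>
    (\<forall>is. length is \<le> n \<longrightarrow> (\<forall>x\<in>S. partials S is f differentiable (at x within S)))"
proof (induction n arbitrary: f)
  case (Suc n)
  show ?case (is "?L \<longleftrightarrow> ?R")
  proof
    assume L: ?L
    show ?R
    proof (intro allI impI)
      fix "is" :: "'a list" assume len: "length is \<le> Suc n"
      show "\<forall>x\<in>S. partials S is f differentiable (at x within S)"
      proof (cases "is" rule: rev_cases)
        case Nil
        then show ?thesis using L by simp
      next
        case (snoc js i)
        then show ?thesis using L Suc len by (simp add: partials_snoc)
      qed
    qed
  next
    assume R: ?R
    have "\<forall>x\<in>S. f differentiable (at x within S)"
      using R[rule_format, of "[]"] by simp
    moreover have "smooth_upto n S (partial S i f)" for i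
      unfolding Suc
    proof (intro allI impI)
      fix "is" :: "'a list" assume "length is \<le> n"
      then show "\<forall>x\<in>S. partials S is (partial S i f) differentiable (at x within S)"
        using R[rule_format, of "is @ [i]"] by (simp add: partials_snoc)
    qed
    ultimately show ?L by simp
  qed
qed simp

lemma smooth_on_iff: "smooth_on S f \<longleftrightarrow> (\<forall>n. smooth_upto n S f)"
  unfolding smooth_on_def smooth_upto_iff by blast

lemma smooth_uptoD: "smooth_upto n S f \<Longrightarrow> x \<in> S \<Longrightarrow> f differentiable (at x within S)"
  by (cases n) auto

lemma smooth_upto_Suc_D: "smooth_upto (Suc n) S f \<Longrightarrow> smooth_upto n S f"
  by (simp add: smooth_upto_iff)

lemma differentiable_cong_within:
  assumes "\<And>y. y \<in> S \<Longrightarrow> f y = g y" and "x \<in> S"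
  shows "f differentiable (at x within S) \<longleftrightarrow> g differentiable (at x within S)"
  unfolding differentiable_def using assms by (metis has_derivative_transform)

lemma smooth_upto_cong:
  assumes "\<And>y. y \<in> S \<Longrightarrow> f y = g y"
  shows "smooth_upto n S f \<longleftrightarrow> smooth_upto n S g"
proof -
  have "partials S is f differentiable (at x within S) \<longleftrightarrow> partials S is g differentiable (at x within S)"
    if "x \<in> S" for x "is"
    using that assms partials_cong by (intro differentiable_cong_within) blast+
  then show ?thesis by (simp add: smooth_upto_iff)
qed

lemma smooth_on_cong: "(\<And>y. y \<in> S \<Longrightarrow> f y = g y) \<Longrightarrow> smooth_on S f \<longleftrightarrow> smooth_on S g"
  unfolding smooth_on_iff using smooth_upto_cong by metis

lemma smooth_on_differentiable: "smooth_on S f \<Longrightarrow> x \<in> S \<Longrightarrow> f differentiable (at x within S)"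
  using smooth_on_iff smooth_uptoD by blast

lemma smooth_on_partial: "smooth_on S f \<Longrightarrow> smooth_on S (partial S i f)"
  by (simp add: smooth_on_iff) (metis smooth_upto.simps(2))

lemma smooth_on_partials: "smooth_on S f \<Longrightarrow> smooth_on S (partials S is f)"
  by (induction "is") (auto intro: smooth_on_partial)

lemma smooth_on_continuous_on: "smooth_on S f \<Longrightarrow> continuous_on S f"
  by (simp add: smooth_on_differentiable differentiable_imp_continuous_on differentiable_on_def)

lemma differentiable_openin:
  assumes "openin (top_of_set S) T" and "x \<in> T"
  shows "partials T is f differentiable (at x within T) \<longleftrightarrow> partials S is f differentiable (at x within S)"
proof -
  have "partials T is f differentiable (at x within T) \<longleftrightarrow> partials S is f differentiable (at x within T)"
    using assms partials_openin by (intro differentiable_cong_within) blast+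
  then show ?thesis using at_within_openin[OF assms] by simp
qed

lemma smooth_on_openin:
  assumes "smooth_on S f" and T: "openin (top_of_set S) T"
  shows "smooth_on T f"
  unfolding smooth_on_def
proof (intro allI ballI)
  fix "is" x assume "x \<in> T"
  moreover from this have "x \<in> S"
    using T by (meson openin_imp_subset subsetD)
  ultimately show "partials T is f differentiable (at x within T)"
    using assms(1) differentiable_openin[OF T \<open>x \<in> T\<close>] unfolding smooth_on_def by blast
qed

lemma smooth_on_local:
  assumes "\<And>x. x \<in> S \<Longrightarrow> \<exists>T. openin (top_of_set S) T \<and> x \<in> T \<and> smooth_on T f"
  shows "smooth_on S f"
  unfolding smooth_on_def using assms by (meson differentiable_openin smooth_on_def)

lemma partial_linear:
  assumes S: "halfspace_open S" and L: "bounded_linear L" and f: "f differentiable (at x within S)" and x: "x \<in> S"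
  shows "partial S i (\<lambda>y. L (f y)) x = L (partial S i f x)"
  using bounded_linear.has_derivative[OF L f[unfolded frechet_derivative_works]]
  by (subst partial_eqI[OF S x]) (simp_all add: partial_def)

lemma smooth_upto_linear:
  assumes S: "halfspace_open S" and L: "bounded_linear L"
  shows "smooth_upto n S f \<Longrightarrow> smooth_upto n S (\<lambda>x. L (f x))"
proof (induction n arbitrary: f)
  case 0
  then show ?case
    using bounded_linear.has_derivative[OF L] unfolding differentiable_def smooth_upto.simps by blast
next
  case (Suc n)
  have diff: "\<And>x. x \<in> S \<Longrightarrow> f differentiable (at x within S)"
    using Suc.prems by simp
  have "smooth_upto n S (partial S i (\<lambda>x. L (f x)))" for i
  proof -
    have "smooth_upto n S (\<lambda>x. L (partial S i f x))"
      using Suc by simp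
    then show ?thesis
      using partial_linear[OF S L diff] by (subst smooth_upto_cong) auto
  qed
  moreover have "\<forall>x\<in>S. (\<lambda>x. L (f x)) differentiable (at x within S)"
    using bounded_linear.has_derivative[OF L] diff unfolding differentiable_def by blast
  ultimately show ?case
    by simp
qed

lemma smooth_on_linear:
  "halfspace_open S \<Longrightarrow> bounded_linear L \<Longrightarrow> smooth_on S f \<Longrightarrow> smooth_on S (\<lambda>x. L (f x))"
  using smooth_upto_linear unfolding smooth_on_iff by blast

lemma partial_add:
  assumes S: "halfspace_open S" and f: "f differentiable (at x within S)" and g: "g differentiable (at x within S)"
    and x: "x \<in> S"
  shows "partial S i (\<lambda>y. f y + g y) x = partial S i f x + partial S i g x"
  using has_derivative_add[OF f[unfolded frechet_derivative_works] g[unfolded frechet_derivative_works]]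
  by (subst partial_eqI[OF S x]) (simp_all add: partial_def)

lemma smooth_upto_add:
  assumes S: "halfspace_open S"
  shows "smooth_upto n S f \<Longrightarrow> smooth_upto n S g \<Longrightarrow> smooth_upto n S (\<lambda>x. f x + g x)"
proof (induction n arbitrary: f g)
  case (Suc n)
  have diff: "\<And>x. x \<in> S \<Longrightarrow> f differentiable (at x within S)" "\<And>x. x \<in> S \<Longrightarrow> g differentiable (at x within S)"
    using Suc.prems by simp_all
  have "smooth_upto n S (partial S i (\<lambda>x. f x + g x))" for i
  proof -
    have "smooth_upto n S (\<lambda>x. partial S i f x + partial S i g x)"
      using Suc by simp
    then show ?thesis
      using partial_add[OF S diff] by (subst smooth_upto_cong) auto
  qed
  then show ?case
    using diff by simp
qed simp

lemma smooth_on_add: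
  "halfspace_open S \<Longrightarrow> smooth_on S f \<Longrightarrow> smooth_on S g \<Longrightarrow> smooth_on S (\<lambda>x. f x + g x)"
  using smooth_upto_add unfolding smooth_on_iff by blast

lemma partial_bilinear:
  assumes S: "halfspace_open S" and B: "bounded_bilinear B"
    and f: "f differentiable (at x within S)" and g: "g differentiable (at x within S)" and x: "x \<in> S"
  shows "partial S i (\<lambda>y. B (f y) (g y)) x = B (f x) (partial S i g x) + B (partial S i f x) (g x)"
  using bounded_bilinear.FDERIV[OF B f[unfolded frechet_derivative_works] g[unfolded frechet_derivative_works]]
  by (subst partial_eqI[OF S x]) (simp_all add: partial_def)

lemma smooth_upto_bilinear:
  assumes S: "halfspace_open S" and B: "bounded_bilinear B"
  shows "smooth_upto n S f \<Longrightarrow> smooth_upto n S g \<Longrightarrow> smooth_upto n S (\<lambda>x. B (f x) (g x))"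
proof (induction n arbitrary: f g)
  case 0
  then show ?case
    using bounded_bilinear.FDERIV[OF B] unfolding differentiable_def smooth_upto.simps by blast
next
  case (Suc n)
  have diff: "\<And>x. x \<in> S \<Longrightarrow> f differentiable (at x within S)" "\<And>x. x \<in> S \<Longrightarrow> g differentiable (at x within S)"
    using Suc.prems by simp_all
  have "smooth_upto n S (partial S i (\<lambda>x. B (f x) (g x)))" for i
  proof -
    have "smooth_upto n S (\<lambda>x. B (f x) (partial S i g x) + B (partial S i f x) (g x))"
      using Suc.prems smooth_upto_Suc_D[OF Suc.prems(1)] smooth_upto_Suc_D[OF Suc.prems(2)]
      by (intro smooth_upto_add[OF S] Suc.IH) simp_all
    then show ?thesis
      using partial_bilinear[OF S B diff] by (subst smooth_upto_cong) auto
  qed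
  moreover have "\<forall>x\<in>S. (\<lambda>x. B (f x) (g x)) differentiable (at x within S)"
    using bounded_bilinear.FDERIV[OF B] diff unfolding differentiable_def by blast
  ultimately show ?case
    by simp
qed

lemma smooth_on_bilinear:
  "halfspace_open S \<Longrightarrow> bounded_bilinear B \<Longrightarrow> smooth_on S f \<Longrightarrow> smooth_on S g \<Longrightarrow>
    smooth_on S (\<lambda>x. B (f x) (g x))"
  using smooth_upto_bilinear unfolding smooth_on_iff by blast

lemmas smooth_on_scaleR = smooth_on_bilinear[OF _ bounded_bilinear_scaleR]
lemmas smooth_on_mult = smooth_on_bilinear[OF _ bounded_bilinear_mult]

lemma partial_const:
  assumes "halfspace_open S" and "x \<in> S"
  shows "partial S i (\<lambda>y. c) x = 0"
  by (subst partial_eqI[OF assms has_derivative_const]) simp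

lemma smooth_on_const:
  assumes "halfspace_open S"
  shows "smooth_on S (\<lambda>x. c)"
proof -
  have "smooth_upto n S (\<lambda>x. c)" for n
  proof (induction n arbitrary: c)
    case (Suc n)
    have "smooth_upto n S (partial S i (\<lambda>x. c))" for i
      using Suc[of 0] by (subst smooth_upto_cong[of S _ "\<lambda>x. 0"]) (simp_all add: partial_const assms)
    then show ?case by simp
  qed simp
  then show ?thesis by (simp add: smooth_on_iff)
qed

lemma smooth_on_id:
  assumes S: "halfspace_open S"
  shows "smooth_on S (\<lambda>x. x)"
proof -
  have "smooth_upto n S (partial S i (\<lambda>x. x))" for n i
    using smooth_on_const[OF S, of "axis i 1"] partial_eqI[OF S _ has_derivative_ident]
    by (subst smooth_upto_cong[of S _ "\<lambda>x. axis i 1"]) (auto simp: smooth_on_iff)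
  then have "smooth_upto n S (\<lambda>x. x)" for n
    by (cases n) simp_all
  then show ?thesis by (simp add: smooth_on_iff)
qed

lemma smooth_on_sum:
  assumes S: "halfspace_open S" and "\<And>i. i \<in> I \<Longrightarrow> smooth_on S (f i)"
  shows "smooth_on S (\<lambda>x. \<Sum>i\<in>I. f i x)"
  using assms(2)
proof (induction I rule: infinite_finite_induct)
  case (insert i I)
  then show ?case using smooth_on_add[OF S, of "f i"] by simp
qed (simp_all add: smooth_on_const[OF S])

lemma smooth_on_component:
  "halfspace_open S \<Longrightarrow> smooth_on S f \<Longrightarrow> smooth_on S (\<lambda>x. f x $ i)"
  using smooth_on_linear bounded_linear_vec_nth by blast

lemma vec_expansion: "v = (\<Sum>i\<in>UNIV. (v $ i) *\<^sub>R axis i (1::real))"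
  using basis_expansion[of v] by (simp add: scalar_mult_eq_scaleR)

lemma smooth_on_vecI:
  fixes f :: "real ^ 'n \<Rightarrow> real ^ 'm"
  assumes S: "halfspace_open S" and "\<And>i. smooth_on S (\<lambda>x. f x $ i)"
  shows "smooth_on S f"
proof -
  have "smooth_on S (\<lambda>x. \<Sum>i\<in>UNIV. (f x $ i) *\<^sub>R axis i (1::real))"
    using assms by (intro smooth_on_sum smooth_on_scaleR smooth_on_const)
  then show ?thesis by (simp flip: vec_expansion)
qed

lemma frechet_derivative_partials:
  assumes "f differentiable (at x within S)"
  shows "frechet_derivative f (at x within S) v = (\<Sum>j\<in>UNIV. (v $ j) *\<^sub>R partial S j f x)"
proof -
  interpret linear "frechet_derivative f (at x within S)"
    using assms by (rule linear_frechet_derivative)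
  have "frechet_derivative f (at x within S) v =
      frechet_derivative f (at x within S) (\<Sum>j\<in>UNIV. (v $ j) *\<^sub>R axis j 1)"
    by (simp flip: vec_expansion)
  then show ?thesis
    by (simp add: sum scale partial_def)
qed

lemma partial_compose:
  fixes f :: "real ^ 'n \<Rightarrow> real ^ 'm"
  assumes S: "halfspace_open S" and fS: "f ` S \<subseteq> T" and x: "x \<in> S"
    and f: "f differentiable (at x within S)" and g: "g differentiable (at (f x) within T)"
  shows "partial S i (\<lambda>y. g (f y)) x = (\<Sum>j\<in>UNIV. (partial S i f x $ j) *\<^sub>R partial T j g (f x))"
proof -
  have "(g \<circ> f has_derivative frechet_derivative g (at (f x) within T) \<circ> frechet_derivative f (at x within S))
      (at x within S)"
    using f g has_derivative_subset[OF _ fS] unfolding frechet_derivative_works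
    by (intro diff_chain_within)
  then have "partial S i (g \<circ> f) x = frechet_derivative g (at (f x) within T) (partial S i f x)"
    by (subst partial_eqI[OF S x]) (assumption, simp add: partial_def)
  then show ?thesis
    by (simp add: frechet_derivative_partials[OF g] comp_def)
qed

lemma differentiable_compose_subset:
  assumes "f ` S \<subseteq> T" and "f differentiable (at x within S)" and "g differentiable (at (f x) within T)"
  shows "(\<lambda>y. g (f y)) differentiable (at x within S)"
  using differentiable_chain_within[OF assms(2) differentiable_within_subset[OF assms(3,1)]]
  by (simp add: comp_def)

text \<open>A partial derivative of the composition is a sum of products of partial derivatives of the two factors,
  to which the induction hypothesis and the product rule apply.\<close>

lemma smooth_upto_compose:
  fixes f :: "real ^ 'n \<Rightarrow> real ^ 'm" and g :: "real ^ 'm \<Rightarrow> 'b::real_normed_vector"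
  assumes S: "halfspace_open S" and fS: "f ` S \<subseteq> T"
  shows "smooth_upto n S f \<Longrightarrow> smooth_upto n T g \<Longrightarrow> smooth_upto n S (\<lambda>x. g (f x))"
proof (induction n arbitrary: g)
  case 0
  then show ?case
    using fS differentiable_compose_subset[OF fS] unfolding smooth_upto.simps by blast
next
  case (Suc n)
  have diff: "\<And>x. x \<in> S \<Longrightarrow> f differentiable (at x within S)" "\<And>x. x \<in> S \<Longrightarrow> g differentiable (at (f x) within T)"
    using Suc.prems fS by auto
  have f: "smooth_upto n S f"
    using Suc.prems smooth_upto_Suc_D by blast
  have const: "smooth_upto n S (\<lambda>x. 0 :: 'b)"
    using smooth_on_const[OF S] smooth_on_iff by blast
  have sum: "smooth_upto n S (\<lambda>x. \<Sum>j\<in>J. h j x)" if h: "\<And>j. smooth_upto n S (h j)"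
    for h :: "'m \<Rightarrow> real ^ 'n \<Rightarrow> 'b" and J
  proof (induction J rule: infinite_finite_induct)
    case (insert j J)
    then show ?case
      using smooth_upto_add[OF S h[of j]] by simp
  qed (simp_all add: const)
  have "smooth_upto n S (partial S i (\<lambda>x. g (f x)))" for i
  proof -
    have "smooth_upto n S (\<lambda>x. \<Sum>j\<in>UNIV. (partial S i f x $ j) *\<^sub>R partial T j g (f x))"
      using Suc f by (intro sum smooth_upto_bilinear[OF S bounded_bilinear_scaleR]
          smooth_upto_linear[OF S bounded_linear_vec_nth]) auto
    then show ?thesis
      using partial_compose[OF S fS _ diff] by (subst smooth_upto_cong) auto
  qed
  moreover have "\<forall>x\<in>S. (\<lambda>x. g (f x)) differentiable (at x within S)"
    using differentiable_compose_subset[OF fS] diff by blast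
  ultimately show ?case
    by simp
qed

lemma smooth_on_compose:
  fixes f :: "real ^ 'n \<Rightarrow> real ^ 'm"
  assumes "halfspace_open S" and "f ` S \<subseteq> T" and "smooth_on S f" and "smooth_on T g"
  shows "smooth_on S (\<lambda>x. g (f x))"
  using smooth_upto_compose[OF assms(1,2)] assms(3,4) unfolding smooth_on_iff by blast


section \<open>Minors and the pullback of forms\<close>

text \<open>The exterior product of a covector with a form of any degree; \<open>dx\<^sub>j\<close> is moved to its place in \<open>J\<close> as in
  \<open>ext_deriv\<close>.\<close>

definition wedge_covector :: "real ^ 'n::{finite,linorder} \<Rightarrow> 'n multivector \<Rightarrow> 'n multivector"
  where "wedge_covector \<theta> v = (\<chi> J. \<Sum>j\<in>J. (- 1) ^ card {i \<in> J. i < j} * \<theta> $ j * v $ (J - {j}))"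

definition inversion_sign :: "'n::{finite,linorder} set \<Rightarrow> ('n \<Rightarrow> 'n) \<Rightarrow> real"
  where "inversion_sign I f = (- 1) ^ card {(i, k). i \<in> I \<and> k \<in> I \<and> i < k \<and> f k < f i}"

definition bijections :: "'n::{finite,linorder} set \<Rightarrow> 'n set \<Rightarrow> ('n \<Rightarrow> 'n) set"
  where "bijections I J = {f \<in> extensional I. bij_betw f I J}"

lemma minor_eq: "minor A I J = (\<Sum>f\<in>bijections I J. inversion_sign I f * (\<Prod>i\<in>I. A $ i $ f i))"
  unfolding minor_def inversion_sign_def bijections_def by simp

text \<open>An element \<open>a \<in> I\<close> forms an inversion with \<open>k\<close> iff exactly one of \<open>a < k\<close> and \<open>f a < f k\<close> holds, so
  modulo 2 the number of such inversions is the sum of the two cardinalities.\<close>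

lemma inversion_sign_insert:
  fixes k :: "'n::{finite,linorder}"
  assumes k: "k \<notin> I" and f: "\<And>a. a \<in> I \<Longrightarrow> f a \<noteq> f k"
  shows "inversion_sign (insert k I) f =
    inversion_sign I f * (- 1) ^ card {a \<in> I. a < k} * (- 1) ^ card {a \<in> I. f a < f k}"
proof -
  let ?p = "{a \<in> I. a < k \<and> f k < f a}" and ?q = "{a \<in> I. k < a \<and> f a < f k}"
    and ?r = "{a \<in> I. a < k \<and> f a < f k}" and ?V = "{(i, k). i \<in> I \<and> k \<in> I \<and> i < k \<and> f k < f i}"
  have split: "{(i, j). i \<in> insert k I \<and> j \<in> insert k I \<and> i < j \<and> f j < f i} =
      ?V \<union> ((\<lambda>a. (a, k)) ` ?p \<union> (\<lambda>a. (k, a)) ` ?q)"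
    by auto
  have "card (?V \<union> ((\<lambda>a. (a, k)) ` ?p \<union> (\<lambda>a. (k, a)) ` ?q)) =
      card ?V + (card ((\<lambda>a. (a, k)) ` ?p) + card ((\<lambda>a. (k, a)) ` ?q))"
    using k by (subst card_Un_disjoint; auto intro!: card_Un_disjoint)+
  also have "\<dots> = card ?V + (card ?p + card ?q)"
    by (simp add: card_image inj_on_def)
  finally have c: "card {(i, j). i \<in> insert k I \<and> j \<in> insert k I \<and> i < j \<and> f j < f i} =
      card ?V + (card ?p + card ?q)"
    by (simp only: split)
  have pr: "card {a \<in> I. a < k} = card ?p + card ?r"
    using f by (subst card_Un_disjoint[symmetric]) (auto intro!: arg_cong[where f=card] simp: not_less_iff_gr_or_eq)
  have qr: "card {a \<in> I. f a < f k} = card ?q + card ?r"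
    using k by (subst card_Un_disjoint[symmetric]) (auto intro!: arg_cong[where f=card] simp: not_less_iff_gr_or_eq)
  have "(- 1 :: real) ^ card ?r * (- 1) ^ card ?r = 1"
    by (simp flip: power_add mult_2)
  then show ?thesis
    unfolding inversion_sign_def c pr qr by (simp add: power_add algebra_simps)
qed

lemma inversion_sign_cong:
  assumes "\<And>a. a \<in> I \<Longrightarrow> f a = g a"
  shows "inversion_sign I f = inversion_sign I g"
proof -
  have "{(i, k). i \<in> I \<and> k \<in> I \<and> i < k \<and> f k < f i} = {(i, k). i \<in> I \<and> k \<in> I \<and> i < k \<and> g k < g i}"
    using assms by auto
  then show ?thesis by (simp add: inversion_sign_def)
qed

lemma card_below_bij:
  fixes j :: "'n::{finite,linorder}"
  assumes "bij_betw g I (J - {j})" and "j \<in> J"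
  shows "card {i \<in> J. i < j} = card {a \<in> I. g a < j}"
proof -
  have J: "J - {j} = g ` I" and inj: "inj_on g I"
    using assms by (auto simp: bij_betw_def)
  have "{i \<in> J. i < j} = {i \<in> J - {j}. i < j}"
    by auto
  also have "\<dots> = g ` {a \<in> I. g a < j}"
    unfolding J by auto
  also have "card \<dots> = card {a \<in> I. g a < j}"
    using inj by (intro card_image) (auto simp: inj_on_def)
  finally show ?thesis .
qed

text \<open>Expansion along row \<open>k\<close>: a bijection \<open>f\<close> from \<open>insert k I\<close> to \<open>J\<close> is a value \<open>j = f k\<close> together with a
  bijection from \<open>I\<close> to \<open>J - {j}\<close>.\<close>

lemma laplace_expansion:
  fixes A :: "'n::{finite,linorder} sqmatrix"
  assumes k: "k \<notin> I"
  shows "(\<Sum>j\<in>J. (- 1) ^ card {i \<in> J. i < j} * A $ k $ j * minor A I (J - {j})) =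
    (- 1) ^ card {i \<in> I. i < k} * minor A (insert k I) J"
proof -
  have sq: "(- 1 :: real) ^ card {i \<in> I. i < k} * (- 1) ^ card {i \<in> I. i < k} = 1"
    by (simp flip: power_add mult_2)
  have "(\<Sum>j\<in>J. (- 1) ^ card {i \<in> J. i < j} * A $ k $ j * minor A I (J - {j})) =
    (\<Sum>(j, g)\<in>Sigma J (\<lambda>j. bijections I (J - {j})).
       (- 1) ^ card {i \<in> J. i < j} * A $ k $ j * (inversion_sign I g * (\<Prod>i\<in>I. A $ i $ g i)))"
    unfolding minor_eq sum_distrib_left by (subst sum.Sigma) simp_all
  also have "\<dots> = (\<Sum>f\<in>bijections (insert k I) J.
      (- 1) ^ card {i \<in> I. i < k} * (inversion_sign (insert k I) f * (\<Prod>i\<in>insert k I. A $ i $ f i)))"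
  proof (rule sum.reindex_bij_witness[where i = "\<lambda>f. (f k, restrict f I)" and j = "\<lambda>(j, g). g(k := j)"])
    fix a assume "a \<in> Sigma J (\<lambda>j. bijections I (J - {j}))"
    then obtain j g where a: "a = (j, g)" and j: "j \<in> J" and ext: "g \<in> extensional I"
      and bij: "bij_betw g I (J - {j})"
      by (auto simp: bijections_def)
    let ?f = "g(k := j)"
    have "restrict ?f I = g"
      using ext k by (auto simp: fun_eq_iff restrict_def extensional_def)
    then show "((\<lambda>f. (f k, restrict f I)) ((\<lambda>(j, g). g(k := j)) a)) = a"
      by (simp add: a)
    have "bij_betw ?f (insert k I) (insert j (J - {j}))"
      using bij k by (auto simp: bij_betw_def inj_on_def)
    then have "bij_betw ?f (insert k I) J"
      using j by (simp add: insert_absorb)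
    then show "(case a of (j, g) \<Rightarrow> g(k := j)) \<in> bijections (insert k I) J"
      using ext by (auto simp: a bijections_def extensional_def)
    have ne: "\<And>b. b \<in> I \<Longrightarrow> ?f b \<noteq> ?f k"
      using bij k by (auto simp: bij_betw_def)
    have "inversion_sign (insert k I) ?f =
        inversion_sign I ?f * (- 1) ^ card {a \<in> I. a < k} * (- 1) ^ card {a \<in> I. ?f a < ?f k}"
      using inversion_sign_insert[of k I ?f] k ne by blast
    also have "inversion_sign I ?f = inversion_sign I g"
      using k by (intro inversion_sign_cong) auto
    also have "{a \<in> I. ?f a < ?f k} = {a \<in> I. g a < j}"
      using k by auto
    also have "card \<dots> = card {i \<in> J. i < j}"
      using card_below_bij[OF bij j] by simp
    finally have sgn: "inversion_sign (insert k I) ?f =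
        inversion_sign I g * (- 1) ^ card {a \<in> I. a < k} * (- 1) ^ card {i \<in> J. i < j}" .
    have "(\<Prod>i\<in>insert k I. A $ i $ ?f i) = A $ k $ j * (\<Prod>i\<in>I. A $ i $ ?f i)"
      using k by simp
    also have "(\<Prod>i\<in>I. A $ i $ ?f i) = (\<Prod>i\<in>I. A $ i $ g i)"
      using k by (intro prod.cong) auto
    finally have pr: "(\<Prod>i\<in>insert k I. A $ i $ ?f i) = A $ k $ j * (\<Prod>i\<in>I. A $ i $ g i)" .
    show "(- 1) ^ card {i \<in> I. i < k} * (inversion_sign (insert k I) (case a of (j, g) \<Rightarrow> g(k := j)) *
        (\<Prod>i\<in>insert k I. A $ i $ (case a of (j, g) \<Rightarrow> g(k := j)) i)) =
      (case a of (j, g) \<Rightarrow> (- 1) ^ card {i \<in> J. i < j} * A $ k $ j *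
        (inversion_sign I g * (\<Prod>i\<in>I. A $ i $ g i)))"
      unfolding a prod.case sgn pr using sq by (simp add: mult.assoc mult.left_commute)
  next
    fix f assume f: "f \<in> bijections (insert k I) J"
    then have ext: "f \<in> extensional (insert k I)" and bij: "bij_betw f (insert k I) J"
      by (auto simp: bijections_def)
    have fk: "f k \<in> J"
      using bij by (auto simp: bij_betw_def)
    have "bij_betw f I (J - {f k})"
      using bij k by (auto simp: bij_betw_def inj_on_def)
    then have "bij_betw (restrict f I) I (J - {f k})"
      by (subst bij_betw_cong[where g = f]) auto
    then show "(f k, restrict f I) \<in> Sigma J (\<lambda>j. bijections I (J - {j}))"
      using fk by (auto simp: bijections_def)
    show "(\<lambda>(j, g). g(k := j)) (f k, restrict f I) = f"
      using ext by (auto simp: fun_eq_iff restrict_def extensional_def)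
  qed
  finally show ?thesis
    by (simp add: minor_eq sum_distrib_left)
qed

text \<open>The left-hand side expands a determinant in which row \<open>k\<close> occurs twice. Exchanging the columns used by
  the two copies is an involution on the terms that changes their sign.\<close>

lemma laplace_repeated_row:
  fixes A :: "'n::{finite,linorder} sqmatrix"
  assumes k: "k \<in> I"
  shows "(\<Sum>j\<in>J. (- 1) ^ card {i \<in> J. i < j} * A $ k $ j * minor A I (J - {j})) = 0"
proof -
  define I' where "I' = I - {k}"
  have I: "I = insert k I'" and kI': "k \<notin> I'"
    using k by (auto simp: I'_def)
  define t where "t = (\<lambda>(j, g). (- 1) ^ card {i \<in> J. i < j} * A $ k $ j *
      (inversion_sign I g * (\<Prod>i\<in>I. A $ i $ g i)))"
  define \<Sigma> where "\<Sigma> = Sigma J (\<lambda>j. bijections I (J - {j}))"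
  define \<iota> :: "'n \<times> ('n \<Rightarrow> 'n) \<Rightarrow> _" where "\<iota> = (\<lambda>(j, g). (g k, g(k := j)))"
  have t_eq: "t (j, g) = (- 1) ^ (if g k < j then 1 else 0) * ((inversion_sign I' g * (- 1) ^ card {a \<in> I'. a < k}) *
      ((- 1) ^ card {a \<in> I'. g a < j} * (- 1) ^ card {a \<in> I'. g a < g k}) *
      ((A $ k $ j * A $ k $ g k) * (\<Prod>i\<in>I'. A $ i $ g i)))"
    if jg: "(j, g) \<in> \<Sigma>" for j g
  proof -
    have j: "j \<in> J" and bij: "bij_betw g I (J - {j})"
      using jg by (auto simp: \<Sigma>_def bijections_def)
    have ne: "\<And>b. b \<in> I' \<Longrightarrow> g b \<noteq> g k"
      using bij kI' unfolding I by (auto simp: bij_betw_def inj_on_def)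
    have "{a \<in> I. g a < j} = (if g k < j then {k} else {}) \<union> {a \<in> I'. g a < j}"
      unfolding I by auto
    then have "card {a \<in> I. g a < j} = (if g k < j then 1 else 0) + card {a \<in> I'. g a < j}"
      using kI' by simp
    then have "card {i \<in> J. i < j} = (if g k < j then 1 else 0) + card {a \<in> I'. g a < j}"
      using card_below_bij[OF bij j] by simp
    moreover have "(\<Prod>i\<in>I. A $ i $ g i) = A $ k $ g k * (\<Prod>i\<in>I'. A $ i $ g i)"
      unfolding I using kI' by simp
    moreover have "inversion_sign I g = inversion_sign I' g * (- 1) ^ card {a \<in> I'. a < k} *
        (- 1) ^ card {a \<in> I'. g a < g k}"
      unfolding I using inversion_sign_insert[of k I' g] kI' ne by blast
    ultimately show ?thesis
      by (simp add: t_def power_add mult_ac)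
  qed
  have \<iota>: "\<iota> x \<in> \<Sigma>" "\<iota> (\<iota> x) = x" "t (\<iota> x) = - t x" if x: "x \<in> \<Sigma>" for x
  proof -
    obtain j g where xjg: "x = (j, g)"
      by (cases x)
    have j: "j \<in> J" and ext: "g \<in> extensional I" and bij: "bij_betw g I (J - {j})"
      using x by (auto simp: \<Sigma>_def bijections_def xjg)
    have img: "g ` I' = J - {j} - {g k}" and inj: "inj_on g I'" and gk: "g k \<in> J" "g k \<noteq> j"
      using bij kI' unfolding I by (auto simp: bij_betw_def inj_on_def)
    have "bij_betw g I' (J - {g k} - {j})"
      using img inj by (auto simp: bij_betw_def)
    then have "bij_betw (g(k := j)) I' (J - {g k} - {j})"
      using kI' by (subst bij_betw_cong[where g = g]) auto
    then have "bij_betw (g(k := j)) (insert k I') (insert j (J - {g k} - {j}))"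
      using kI' by (auto simp: bij_betw_def inj_on_def)
    moreover have "insert j (J - {g k} - {j}) = J - {g k}"
      using j gk by auto
    ultimately have "bij_betw (g(k := j)) I (J - {g k})"
      by (simp add: I)
    moreover have "g(k := j) \<in> extensional I"
      using ext k by (auto simp: extensional_def)
    ultimately show mem: "\<iota> x \<in> \<Sigma>"
      using gk by (auto simp: \<iota>_def \<Sigma>_def bijections_def xjg)
    show "\<iota> (\<iota> x) = x"
      by (simp add: \<iota>_def xjg)
    have "inversion_sign I' (g(k := j)) = inversion_sign I' g"
      using kI' by (intro inversion_sign_cong) auto
    moreover have "{a \<in> I'. (g(k := j)) a < b} = {a \<in> I'. g a < b}" for b
      using kI' by auto
    moreover have "(\<Prod>i\<in>I'. A $ i $ (g(k := j)) i) = (\<Prod>i\<in>I'. A $ i $ g i)"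
      using kI' by (intro prod.cong) auto
    moreover have "(- 1 :: real) ^ (if j < g k then 1 else 0) = - ((- 1) ^ (if g k < j then 1 else 0))"
      using gk by auto
    moreover have mem': "(g k, g(k := j)) \<in> \<Sigma>"
      using mem by (simp add: \<iota>_def xjg)
    ultimately have "t (g k, g(k := j)) = - t (j, g)"
      using t_eq[OF mem'] t_eq[of j g] x by (simp add: xjg mult_ac del: power_Suc)
    then show "t (\<iota> x) = - t x"
      by (simp add: \<iota>_def xjg)
  qed
  have "sum t \<Sigma> = (\<Sum>x\<in>\<Sigma>. - t x)"
    by (rule sum.reindex_bij_witness[of _ \<iota> \<iota>]) (use \<iota> in auto)
  then have "sum t \<Sigma> = 0"
    by (simp add: sum_negf)
  moreover have "(\<Sum>j\<in>J. (- 1) ^ card {i \<in> J. i < j} * A $ k $ j * minor A I (J - {j})) = sum t \<Sigma>"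
    unfolding minor_eq sum_distrib_left t_def \<Sigma>_def by (subst sum.Sigma) simp_all
  ultimately show ?thesis by simp
qed

text \<open>Pullback commutes with the exterior product. The coefficient of \<open>\<theta>\<^sub>k v\<^sub>I\<close> in the component \<open>J\<close> of the
  right-hand side is a Laplace expansion along row \<open>k\<close>, which vanishes for \<open>k \<in> I\<close>.\<close>

lemma compound_transpose_wedge_covector:
  fixes A :: "'n::{finite,linorder} sqmatrix"
  shows "transpose (compound A) *v wedge_covector \<theta> v = wedge_covector (transpose A *v \<theta>) (transpose (compound A) *v v)"
proof (rule vec_eq_iff[THEN iffD2], rule allI)
  fix J
  have T: "(transpose (compound A) *v w) $ K = (\<Sum>L\<in>UNIV. minor A L K * w $ L)" for w K
    by (simp add: matrix_vector_mult_def transpose_def compound_def)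
  have "(wedge_covector (transpose A *v \<theta>) (transpose (compound A) *v v)) $ J =
      (\<Sum>j\<in>J. (- 1) ^ card {i \<in> J. i < j} * (\<Sum>k\<in>UNIV. A $ k $ j * \<theta> $ k) *
         (\<Sum>I\<in>UNIV. minor A I (J - {j}) * v $ I))"
    by (simp add: wedge_covector_def T del: transpose_matrix_vector) (simp add: matrix_vector_mult_def transpose_def del: transpose_matrix_vector)
  also have "\<dots> = (\<Sum>j\<in>J. \<Sum>k\<in>UNIV. \<Sum>I\<in>UNIV. \<theta> $ k * v $ I *
      ((- 1) ^ card {i \<in> J. i < j} * A $ k $ j * minor A I (J - {j})))"
    by (simp add: sum_distrib_left sum_distrib_right mult_ac sum_product)
  also have "\<dots> = (\<Sum>k\<in>UNIV. \<Sum>I\<in>UNIV. \<theta> $ k * v $ I *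
      (\<Sum>j\<in>J. (- 1) ^ card {i \<in> J. i < j} * A $ k $ j * minor A I (J - {j})))"
    unfolding sum_distrib_left
    by (subst sum.swap, rule sum.cong[OF refl], subst sum.swap) (rule refl)
  also have "\<dots> = (\<Sum>k\<in>UNIV. \<Sum>I | k \<notin> I. \<theta> $ k * v $ I *
      ((- 1) ^ card {i \<in> I. i < k} * minor A (insert k I) J))"
  proof (rule sum.cong[OF refl])
    fix k :: 'n
    have "(\<Sum>j\<in>J. (- 1) ^ card {i \<in> J. i < j} * A $ k $ j * minor A I (J - {j})) =
        (if k \<notin> I then (- 1) ^ card {i \<in> I. i < k} * minor A (insert k I) J else 0)" for I
      by (simp add: laplace_expansion laplace_repeated_row)
    then show "(\<Sum>I\<in>UNIV. \<theta> $ k * v $ I *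
        (\<Sum>j\<in>J. (- 1) ^ card {i \<in> J. i < j} * A $ k $ j * minor A I (J - {j}))) =
      (\<Sum>I | k \<notin> I. \<theta> $ k * v $ I * ((- 1) ^ card {i \<in> I. i < k} * minor A (insert k I) J))"
      by (simp add: if_distrib[where f = "\<lambda>x. _ * x"] sum.If_cases cong: if_cong)
  qed
  also have "\<dots> = (\<Sum>k\<in>UNIV. \<Sum>L | k \<in> L. minor A L J * ((- 1) ^ card {i \<in> L. i < k} * \<theta> $ k * v $ (L - {k})))"
  proof (rule sum.cong[OF refl], rule sum.reindex_bij_witness[where i = "\<lambda>L. L - {k}" and j = "insert k" for k])
    fix k :: 'n and I :: "'n set" assume I: "I \<in> {I. k \<notin> I}"
    have "{i \<in> insert k I. i < k} = {i \<in> I. i < k}" and "insert k I - {k} = I"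
      using I by auto
    then show "minor A (insert k I) J * ((- 1) ^ card {i \<in> insert k I. i < k} * \<theta> $ k * v $ (insert k I - {k})) =
        \<theta> $ k * v $ I * ((- 1) ^ card {i \<in> I. i < k} * minor A (insert k I) J)"
      by simp
  qed auto
  also have "\<dots> = (\<Sum>L\<in>UNIV. \<Sum>k\<in>L. minor A L J * ((- 1) ^ card {i \<in> L. i < k} * \<theta> $ k * v $ (L - {k})))"
    by (subst sum.swap_restrict[of UNIV UNIV _ "\<lambda>k L. k \<in> L", simplified]) simp_all
  also have "\<dots> = (transpose (compound A) *v wedge_covector \<theta> v) $ J"
    by (simp add: T wedge_covector_def sum_distrib_left del: transpose_matrix_vector)
  finally show "(transpose (compound A) *v wedge_covector \<theta> v) $ J =
      (wedge_covector (transpose A *v \<theta>) (transpose (compound A) *v v)) $ J" ..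
qed


section \<open>Symmetry of second derivatives and a smooth step function\<close>

lemma has_derivative_along_line:
  fixes f :: "real ^ 'n \<Rightarrow> 'b::real_normed_vector"
  assumes seg: "\<And>s. s \<in> {0..a} \<Longrightarrow> y + s *\<^sub>R u \<in> S" and s: "s \<in> {0..a}"
    and f: "f differentiable (at (y + s *\<^sub>R u) within S)"
  shows "((\<lambda>s. f (y + s *\<^sub>R u)) has_derivative
    (\<lambda>d. d *\<^sub>R frechet_derivative f (at (y + s *\<^sub>R u) within S) u)) (at s within {0..a})"
proof -
  let ?D = "frechet_derivative f (at (y + s *\<^sub>R u) within S)"
  interpret D: linear ?D
    using f by (rule linear_frechet_derivative)
  have "((\<lambda>s. y + s *\<^sub>R u) has_derivative (\<lambda>d. d *\<^sub>R u)) (at s within {0..a})"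
    by (auto intro!: derivative_eq_intros)
  moreover have "(f has_derivative ?D) (at (y + s *\<^sub>R u) within (\<lambda>s. y + s *\<^sub>R u) ` {0..a})"
    using f seg by (intro has_derivative_subset[OF f[unfolded frechet_derivative_works]]) auto
  ultimately have "(f \<circ> (\<lambda>s. y + s *\<^sub>R u) has_derivative ?D \<circ> (\<lambda>d. d *\<^sub>R u)) (at s within {0..a})"
    by (rule diff_chain_within)
  then show ?thesis
    by (simp add: comp_def D.scale)
qed

definition plane_point :: "real ^ 'n \<Rightarrow> 'n \<Rightarrow> real \<Rightarrow> 'n \<Rightarrow> real \<Rightarrow> real \<Rightarrow> real \<Rightarrow> real ^ 'n"
  where "plane_point x i \<sigma> j \<tau> s t = x + (s * \<sigma>) *\<^sub>R axis i 1 + (t * \<tau>) *\<^sub>R axis j 1"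

text \<open>The mean value theorem, applied once in each of the two directions to the alternating sum of \<open>f\<close> over the
  corners of an axis-parallel square.\<close>

lemma second_difference_mean_value:
  fixes f :: "real ^ 'n \<Rightarrow> real" and \<sigma> \<tau> :: real
  assumes a: "0 < a" and f: "smooth_on S f"
    and box: "\<And>s t. s \<in> {0..a} \<Longrightarrow> t \<in> {0..a} \<Longrightarrow> plane_point x i \<sigma> j \<tau> s t \<in> S"
  shows "\<exists>s\<in>{0..a}. \<exists>t\<in>{0..a}.
    f (plane_point x i \<sigma> j \<tau> a a) - f (plane_point x i \<sigma> j \<tau> a 0) - f (plane_point x i \<sigma> j \<tau> 0 a) + f (plane_point x i \<sigma> j \<tau> 0 0) =
      a\<^sup>2 * \<sigma> * \<tau> * partial S j (partial S i f) (plane_point x i \<sigma> j \<tau> s t)"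
proof -
  let ?p = "plane_point x i \<sigma> j \<tau>"
  have D: "((\<lambda>s. f (?p s t)) has_derivative (\<lambda>d. d * (\<sigma> * partial S i f (?p s t)))) (at s within {0..a})"
    if st: "s \<in> {0..a}" "t \<in> {0..a}" for s t
  proof -
    have eq: "?p s t = (x + (t * \<tau>) *\<^sub>R axis j 1) + s *\<^sub>R (\<sigma> *\<^sub>R axis i 1)" for s
      by (simp add: plane_point_def algebra_simps)
    have df: "f differentiable (at ((x + (t * \<tau>) *\<^sub>R axis j 1) + s *\<^sub>R (\<sigma> *\<^sub>R axis i 1)) within S)"
      using smooth_on_differentiable[OF f box[OF st]] by (simp add: eq)
    have "((\<lambda>s. f (?p s t)) has_derivative
       (\<lambda>d. d *\<^sub>R frechet_derivative f (at (?p s t) within S) (\<sigma> *\<^sub>R axis i 1))) (at s within {0..a})"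
      unfolding eq using box[OF _ st(2)] st(1) df
      by (intro has_derivative_along_line) (simp_all add: eq)
    then show ?thesis
      using linear.scaleR[OF linear_frechet_derivative[OF df]] by (simp add: partial_def eq)
  qed
  have D': "((\<lambda>t. partial S i f (?p s t)) has_derivative (\<lambda>d. d * (\<tau> * partial S j (partial S i f) (?p s t))))
      (at t within {0..a})"
    if st: "s \<in> {0..a}" "t \<in> {0..a}" for s t
  proof -
    have eq: "?p s t = (x + (s * \<sigma>) *\<^sub>R axis i 1) + t *\<^sub>R (\<tau> *\<^sub>R axis j 1)" for t
      by (simp add: plane_point_def algebra_simps)
    have df: "partial S i f differentiable (at ((x + (s * \<sigma>) *\<^sub>R axis i 1) + t *\<^sub>R (\<tau> *\<^sub>R axis j 1)) within S)"
      using smooth_on_differentiable[OF smooth_on_partial[OF f] box[OF st]] by (simp add: eq)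
    have "((\<lambda>t. partial S i f (?p s t)) has_derivative
       (\<lambda>d. d *\<^sub>R frechet_derivative (partial S i f) (at (?p s t) within S) (\<tau> *\<^sub>R axis j 1))) (at t within {0..a})"
      unfolding eq using box[OF st(1)] st(2) df
      by (intro has_derivative_along_line) (simp_all add: eq)
    then show ?thesis
      using linear.scaleR[OF linear_frechet_derivative[OF df]] by (simp add: partial_def[of S j] eq)
  qed
  have a_in: "a \<in> {0..a}" "0 \<in> {0..a}"
    using a by auto
  have "\<exists>s\<in>{0<..<a}. (f (?p a a) - f (?p a 0)) - (f (?p 0 a) - f (?p 0 0)) =
      (\<lambda>d. d * (\<sigma> * partial S i f (?p s a)) - d * (\<sigma> * partial S i f (?p s 0))) (a - 0)"
    by (rule mvt_simple[OF a]) (intro has_derivative_diff D a_in, auto)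
  then obtain s where "s \<in> {0<..<a}" and
    s_eq: "(f (?p a a) - f (?p a 0)) - (f (?p 0 a) - f (?p 0 0)) =
      (a - 0) * (\<sigma> * partial S i f (?p s a)) - (a - 0) * (\<sigma> * partial S i f (?p s 0))"
    by blast
  then have s: "s \<in> {0..a}"
    by simp
  have "\<exists>t\<in>{0<..<a}. partial S i f (?p s a) - partial S i f (?p s 0) =
      (\<lambda>d. d * (\<tau> * partial S j (partial S i f) (?p s t))) (a - 0)"
    by (rule mvt_simple[OF a]) (intro D' s, auto)
  then obtain t where "t \<in> {0<..<a}" and
    t_eq: "partial S i f (?p s a) - partial S i f (?p s 0) = (a - 0) * (\<tau> * partial S j (partial S i f) (?p s t))"
    by blast
  then have t: "t \<in> {0..a}"
    by simp
  have "f (?p a a) - f (?p a 0) - f (?p 0 a) + f (?p 0 0) =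
      a * \<sigma> * (partial S i f (?p s a) - partial S i f (?p s 0))"
    using s_eq by (simp add: algebra_simps)
  also have "\<dots> = a\<^sup>2 * \<sigma> * \<tau> * partial S j (partial S i f) (?p s t)"
    unfolding t_eq by (simp add: power2_eq_square)
  finally show ?thesis
    using s t by blast
qed

text \<open>The alternating sum over the corners of a small square at \<open>x\<close> is \<open>a\<^sup>2\<close> times either mixed derivative at
  some nearby point, up to the same sign, and the mixed derivatives are continuous. At boundary points the
  square has to be spanned by directions that point into the half-space.\<close>

lemma partial_commute:
  fixes f :: "real ^ 'n \<Rightarrow> real"
  assumes S: "halfspace_open S" and f: "smooth_on S f" and x: "x \<in> S"
  shows "partial S i (partial S j f) x = partial S j (partial S i f) x"
proof (rule ccontr)
  assume ne: "\<not> ?thesis"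
  define \<epsilon> where "\<epsilon> = \<bar>partial S i (partial S j f) x - partial S j (partial S i f) x\<bar> / 2"
  have \<epsilon>: "\<epsilon> > 0"
    using ne by (simp add: \<epsilon>_def)
  obtain h where h: "0 \<le> h \<bullet> x" and "\<exists>e>0. ball x e \<inter> {y. 0 \<le> h \<bullet> y} \<subseteq> S"
    using S x by (metis halfspace_openE)
  then obtain r where r: "r > 0" "ball x r \<inter> {y. 0 \<le> h \<bullet> y} \<subseteq> S"
    by blast
  have "\<exists>\<delta>>0. \<forall>y\<in>S. dist y x < \<delta> \<longrightarrow> \<bar>partial S k (partial S l f) y - partial S k (partial S l f) x\<bar> < \<epsilon>" for k l
    using smooth_on_continuous_on[OF smooth_on_partial[OF smooth_on_partial[OF f, of l], of k]] x \<epsilon>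
    unfolding continuous_on_iff dist_real_def by blast
  then obtain \<delta>1 \<delta>2 where \<delta>: "\<delta>1 > 0" "\<delta>2 > 0"
    "\<And>y. y \<in> S \<Longrightarrow> dist y x < \<delta>1 \<Longrightarrow> \<bar>partial S i (partial S j f) y - partial S i (partial S j f) x\<bar> < \<epsilon>"
    "\<And>y. y \<in> S \<Longrightarrow> dist y x < \<delta>2 \<Longrightarrow> \<bar>partial S j (partial S i f) y - partial S j (partial S i f) x\<bar> < \<epsilon>"
    by metis
  \<comment> \<open>The points of the square have distance at most \<open>2 a\<close> from \<open>x\<close>.\<close>
  define a where "a = min r (min \<delta>1 \<delta>2) / 3"
  have a: "0 < a" "2 * a < r" "2 * a < \<delta>1" "2 * a < \<delta>2"
    using r \<delta> by (auto simp: a_def)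
  \<comment> \<open>The sign that makes the coordinate direction \<open>k\<close> point into the half-space.\<close>
  define sg where "sg k = (if 0 \<le> h \<bullet> axis k 1 then 1 else - 1 :: real)" for k
  have sg: "\<bar>sg k\<bar> = 1" "0 \<le> sg k * (h \<bullet> axis k 1)" for k
    by (auto simp: sg_def)
  have pt: "plane_point x k (sg k) l (sg l) s t \<in> S \<and> dist (plane_point x k (sg k) l (sg l) s t) x \<le> 2 * a"
    if st: "s \<in> {0..a}" "t \<in> {0..a}" for s t k l
  proof -
    have "dist (plane_point x k (sg k) l (sg l) s t) x = norm ((s * sg k) *\<^sub>R axis k 1 + (t * sg l) *\<^sub>R axis l (1::real))"
      by (simp add: plane_point_def dist_norm)
    also have "\<dots> \<le> \<bar>s * sg k\<bar> + \<bar>t * sg l\<bar>"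
      by (rule order_trans[OF norm_triangle_ineq]) simp
    also have "\<dots> \<le> 2 * a"
      using st sg by (simp add: abs_mult)
    finally have d: "dist (plane_point x k (sg k) l (sg l) s t) x \<le> 2 * a" .
    have "0 \<le> s * (sg k * (h \<bullet> axis k 1))" "0 \<le> t * (sg l * (h \<bullet> axis l 1))"
      using st sg by (simp_all add: mult_nonneg_nonneg)
    then have "0 \<le> h \<bullet> plane_point x k (sg k) l (sg l) s t"
      using h by (simp add: plane_point_def inner_add_right mult.assoc)
    then have "plane_point x k (sg k) l (sg l) s t \<in> S"
      using d a r by (intro subsetD[OF r(2)]) (auto simp: dist_commute)
    then show ?thesis using d by blast
  qed
  obtain s t where st: "s \<in> {0..a}" "t \<in> {0..a}"
    "f (plane_point x i (sg i) j (sg j) a a) - f (plane_point x i (sg i) j (sg j) a 0) - f (plane_point x i (sg i) j (sg j) 0 a) + f (plane_point x i (sg i) j (sg j) 0 0) =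
      a\<^sup>2 * sg i * sg j * partial S j (partial S i f) (plane_point x i (sg i) j (sg j) s t)"
    using second_difference_mean_value[OF a(1) f, of x i "sg i" j "sg j"] pt by blast
  obtain s' t' where st': "s' \<in> {0..a}" "t' \<in> {0..a}"
    "f (plane_point x j (sg j) i (sg i) a a) - f (plane_point x j (sg j) i (sg i) a 0) - f (plane_point x j (sg j) i (sg i) 0 a) + f (plane_point x j (sg j) i (sg i) 0 0) =
      a\<^sup>2 * sg j * sg i * partial S i (partial S j f) (plane_point x j (sg j) i (sg i) s' t')"
    using second_difference_mean_value[OF a(1) f, of x j "sg j" i "sg i"] pt by blast
  have sym: "plane_point x j \<tau> i \<sigma> v u = plane_point x i \<sigma> j \<tau> u v" for \<sigma> \<tau> u v
    by (simp add: plane_point_def algebra_simps)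
  have comm: "a\<^sup>2 * sg j * sg i = a\<^sup>2 * sg i * sg j"
    by simp
  have "a\<^sup>2 * sg i * sg j * partial S j (partial S i f) (plane_point x i (sg i) j (sg j) s t) =
      a\<^sup>2 * sg i * sg j * partial S i (partial S j f) (plane_point x j (sg j) i (sg i) s' t')"
    using st(3) st'(3) unfolding sym[of "sg j" "sg i"] comm by linarith
  moreover have "a\<^sup>2 * sg i * sg j \<noteq> 0"
    using a sg by (metis abs_zero mult_eq_0_iff power_not_zero zero_neq_one less_irrefl)
  ultimately have "partial S j (partial S i f) (plane_point x i (sg i) j (sg j) s t) =
      partial S i (partial S j f) (plane_point x j (sg j) i (sg i) s' t')"
    by simp
  moreover have "\<bar>partial S j (partial S i f) (plane_point x i (sg i) j (sg j) s t) - partial S j (partial S i f) x\<bar> < \<epsilon>"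
    using pt[OF st(1,2), of i j] a by (intro \<delta>) auto
  moreover have "\<bar>partial S i (partial S j f) (plane_point x j (sg j) i (sg i) s' t') - partial S i (partial S j f) x\<bar> < \<epsilon>"
    using pt[OF st'(1,2), of j i] a by (intro \<delta>) auto
  ultimately show False
    unfolding \<epsilon>_def by (auto simp: abs_if split: if_splits)
qed

text \<open>The functions \<open>exp (- 1 / t) / t\<^sup>k\<close>, continued by \<open>0\<close>. All \<open>k\<close> are considered at once since their
  derivatives are linear combinations of functions of the same kind.\<close>

definition flat_bump :: "nat \<Rightarrow> real \<Rightarrow> real"
  where "flat_bump k t = (if t \<le> 0 then 0 else exp (- inverse t) * inverse t ^ k)"

lemma flat_bump_DERIV: "(flat_bump k has_real_derivative flat_bump (k + 2) t - real k * flat_bump (k + 1) t) (at t)"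
proof -
  consider "t > 0" | "t = 0" | "t < 0" by linarith
  then show ?thesis
  proof cases
    case 1
    have "((\<lambda>t. exp (- inverse t) * inverse t ^ k) has_real_derivative
        exp (- inverse t) * (inverse t * inverse t) * inverse t ^ k +
        exp (- inverse t) * (real k * (- (inverse t * inverse t)) * inverse t ^ (k - 1))) (at t)"
      using 1 by (auto intro!: derivative_eq_intros)
    moreover have "exp (- inverse t) * (inverse t * inverse t) * inverse t ^ k +
        exp (- inverse t) * (real k * (- (inverse t * inverse t)) * inverse t ^ (k - 1)) =
        flat_bump (k + 2) t - real k * flat_bump (k + 1) t"
      using 1 by (cases k) (simp_all add: flat_bump_def algebra_simps)
    ultimately have "((\<lambda>t. exp (- inverse t) * inverse t ^ k) has_real_derivative
        flat_bump (k + 2) t - real k * flat_bump (k + 1) t) (at t)"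
      by simp
    then show ?thesis
      by (rule has_field_derivative_transform_within_open[of _ _ _ "{0<..}"]) (use 1 in \<open>auto simp: flat_bump_def\<close>)
  next
    case 2
    have "((\<lambda>h::real. exp (- inverse h) * inverse h ^ Suc k) \<longlongrightarrow> 0) (at_right 0)"
      by real_asymp
    then have r: "((\<lambda>h. flat_bump k h / h) \<longlongrightarrow> 0) (at_right 0)"
      by (rule Lim_transform_eventually)
         (auto simp: eventually_at_right_field flat_bump_def field_simps intro!: exI[of _ 1])
    have l: "((\<lambda>h. flat_bump k h / h) \<longlongrightarrow> 0) (at_left 0)"
      by (rule Lim_transform_eventually[OF tendsto_const])
         (auto simp: eventually_at_left_field flat_bump_def intro!: exI[of _ "-1"])
    have "((\<lambda>h. flat_bump k h / h) \<longlongrightarrow> 0) (at 0)"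
      using l r by (rule filterlim_split_at)
    then show ?thesis
      using 2 by (simp add: DERIV_def flat_bump_def)
  next
    case 3
    then have "((\<lambda>t. 0) has_real_derivative flat_bump (k + 2) t - real k * flat_bump (k + 1) t) (at t)"
      by (simp add: flat_bump_def)
    then show ?thesis
      by (rule has_field_derivative_transform_within_open[of _ _ _ "{..<0}"]) (use 3 in \<open>auto simp: flat_bump_def\<close>)
  qed
qed

lemma smooth_on_flat_bump:
  assumes S: "halfspace_open S" and f: "smooth_on S f"
  shows "smooth_on S (\<lambda>x. flat_bump k (f x))"
proof -
  have D: "((\<lambda>x. flat_bump k (f x)) has_derivative
      (\<lambda>v. (flat_bump (k + 2) (f x) - real k * flat_bump (k + 1) (f x)) * frechet_derivative f (at x within S) v)) (at x within S)"
    if "x \<in> S" for x k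
    using has_derivative_compose[OF smooth_on_differentiable[OF f that, unfolded frechet_derivative_works]
        flat_bump_DERIV[of k "f x", unfolded has_field_derivative_def]] .
  have "smooth_upto n S (\<lambda>x. flat_bump k (f x))" for n k
  proof (induction n arbitrary: k)
    case (Suc n)
    have eq: "partial S i (\<lambda>x. flat_bump k (f x)) x =
        partial S i f x *\<^sub>R (flat_bump (k + 2) (f x) + (- real k) *\<^sub>R flat_bump (k + 1) (f x))" if "x \<in> S" for x i
      by (subst partial_eqI[OF S that D[OF that]]) (simp add: partial_def)
    have "smooth_upto n S (\<lambda>x. partial S i f x *\<^sub>R (flat_bump (k + 2) (f x) + (- real k) *\<^sub>R flat_bump (k + 1) (f x)))" for i
    proof (rule smooth_upto_bilinear[OF S bounded_bilinear_scaleR])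
      show "smooth_upto n S (partial S i f)"
        using smooth_on_partial[OF f] by (simp add: smooth_on_iff)
      show "smooth_upto n S (\<lambda>x. flat_bump (k + 2) (f x) + (- real k) *\<^sub>R flat_bump (k + 1) (f x))"
        by (rule smooth_upto_add[OF S Suc smooth_upto_linear[OF S bounded_linear_scaleR_right Suc]])
    qed
    moreover have "smooth_upto n S (partial S i (\<lambda>x. flat_bump k (f x))) \<longleftrightarrow>
        smooth_upto n S (\<lambda>x. partial S i f x *\<^sub>R (flat_bump (k + 2) (f x) + (- real k) *\<^sub>R flat_bump (k + 1) (f x)))" for i
      by (rule smooth_upto_cong) (rule eq)
    ultimately have "smooth_upto n S (partial S i (\<lambda>x. flat_bump k (f x)))" for i
      by blast
    moreover have "\<forall>x\<in>S. (\<lambda>x. flat_bump k (f x)) differentiable (at x within S)"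
      using D differentiableI by blast
    ultimately show ?case by simp
  next
    case 0
    show ?case
      unfolding smooth_upto.simps using D differentiableI by blast
  qed
  then show ?thesis by (simp add: smooth_on_iff)
qed

text \<open>For \<open>t \<le> 0\<close> the inner function vanishes, which leaves the normalising constant; for \<open>t \<ge> 1\<close> the
  argument of the outer function is not positive.\<close>

definition step_down :: "real \<Rightarrow> real"
  where "step_down t = flat_bump 0 (exp (- 1) - flat_bump 0 t) / flat_bump 0 (exp (- 1))"

lemma step_down_0: "t \<le> 0 \<Longrightarrow> step_down t = 1"
  by (simp add: step_down_def flat_bump_def)

lemma step_down_1: "1 \<le> t \<Longrightarrow> step_down t = 0"
  using inverse_le_1_iff[of t] by (simp add: step_down_def flat_bump_def)

lemma smooth_on_step_down:
  assumes S: "halfspace_open S" and f: "smooth_on S f"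
  shows "smooth_on S (\<lambda>x. step_down (f x))"
proof -
  have "smooth_on S (\<lambda>x. (1 / flat_bump 0 (exp (- 1))) *\<^sub>R flat_bump 0 (exp (- 1) + (- 1) *\<^sub>R flat_bump 0 (f x)))"
    by (rule smooth_on_linear[OF S bounded_linear_scaleR_right smooth_on_flat_bump[OF S smooth_on_add[OF S
            smooth_on_const[OF S] smooth_on_linear[OF S bounded_linear_scaleR_right smooth_on_flat_bump[OF S f]]]]])
  then show ?thesis by (simp add: step_down_def)
qed


section \<open>The exterior derivative in coordinates\<close>

text \<open>The coordinate expression of \<open>ext_deriv\<close> on an arbitrary domain \<open>S\<close>. It is applied to the images of charts
  as well as to smaller domains such as overlaps.\<close>

definition coord_ext_deriv :: "((real, 'n::{finite,linorder}) vec) set \<Rightarrow> ((real, 'n) vec \<Rightarrow> 'n multivector) \<Rightarrow> (real, 'n) vec \<Rightarrow> 'n multivector"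
  where "coord_ext_deriv S f y =
    (\<chi> J. \<Sum>j\<in>J. (- 1) ^ card {i \<in> J. i < j} * partial S j (\<lambda>z. f z $ (J - {j})) y)"

definition grad :: "(real ^ 'n) set \<Rightarrow> (real ^ 'n \<Rightarrow> real) \<Rightarrow> real ^ 'n \<Rightarrow> real ^ 'n"
  where "grad S g y = (\<chi> j. partial S j g y)"

definition jacobian_matrix :: "(real ^ 'n) set \<Rightarrow> (real ^ 'n \<Rightarrow> real ^ 'n) \<Rightarrow> real ^ 'n \<Rightarrow> 'n sqmatrix"
  where "jacobian_matrix S \<tau> y = (\<chi> k. grad S (\<lambda>z. \<tau> z $ k) y)"

lemma coord_ext_deriv_cong:
  assumes "\<And>y. y \<in> S \<Longrightarrow> f y = g y" and "y \<in> S"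
  shows "coord_ext_deriv S f y = coord_ext_deriv S g y"
proof -
  have "partial S j (\<lambda>z. f z $ I) y = partial S j (\<lambda>z. g z $ I) y" for j I
    using assms by (intro partial_cong) auto
  then show ?thesis by (simp add: coord_ext_deriv_def)
qed

lemma coord_ext_deriv_openin:
  "openin (top_of_set S) T \<Longrightarrow> y \<in> T \<Longrightarrow> coord_ext_deriv T f y = coord_ext_deriv S f y"
  by (simp add: coord_ext_deriv_def partial_openin)

lemma smooth_on_coord_ext_deriv:
  assumes S: "halfspace_open S" and f: "smooth_on S f"
  shows "smooth_on S (coord_ext_deriv S f)"
proof (rule smooth_on_vecI[OF S])
  fix J
  have "smooth_on S (\<lambda>y. \<Sum>j\<in>J. (- 1) ^ card {i \<in> J. i < j} * partial S j (\<lambda>z. f z $ (J - {j})) y)"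
    by (rule smooth_on_sum[OF S], rule smooth_on_linear[OF S bounded_linear_mult_right],
        rule smooth_on_partial, rule smooth_on_component[OF S f])
  then show "smooth_on S (\<lambda>y. coord_ext_deriv S f y $ J)"
    by (simp add: coord_ext_deriv_def)
qed

lemma partial_sum:
  assumes S: "halfspace_open S" and x: "x \<in> S" and h: "\<And>i. i \<in> I \<Longrightarrow> smooth_on S (h i)"
  shows "partial S j (\<lambda>y. \<Sum>i\<in>I. h i y) x = (\<Sum>i\<in>I. partial S j (h i) x)"
  using h
proof (induction I rule: infinite_finite_induct)
  case (insert i I)
  have "partial S j (\<lambda>y. h i y + (\<Sum>i\<in>I. h i y)) x = partial S j (h i) x + partial S j (\<lambda>y. \<Sum>i\<in>I. h i y) x"
    using insert.prems by (intro partial_add[OF S _ _ x] smooth_on_differentiable[OF _ x] smooth_on_sum[OF S]) auto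
  then show ?case
    using insert by simp
qed (simp_all add: partial_const[OF S x])

lemma partial_scale:
  assumes S: "halfspace_open S" and x: "x \<in> S" and h: "smooth_on S h"
  shows "partial S j (\<lambda>y. a *\<^sub>R h y) x = a *\<^sub>R partial S j h x"
  by (rule partial_linear[OF S bounded_linear_scaleR_right smooth_on_differentiable[OF h x] x])

lemma partial_component:
  assumes S: "halfspace_open S" and x: "x \<in> S" and h: "smooth_on S h"
  shows "partial S j (\<lambda>y. h y $ i) x = partial S j h x $ i"
  by (rule partial_linear[OF S bounded_linear_vec_nth smooth_on_differentiable[OF h x] x])

lemma coord_ext_deriv_add:
  assumes S: "halfspace_open S" and f: "smooth_on S f" and g: "smooth_on S g" and y: "y \<in> S"
  shows "coord_ext_deriv S (\<lambda>y. f y + g y) y = coord_ext_deriv S f y + coord_ext_deriv S g y"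
proof -
  have "partial S j (\<lambda>z. f z $ I + g z $ I) y = partial S j (\<lambda>z. f z $ I) y + partial S j (\<lambda>z. g z $ I) y" for j I
    by (intro partial_add[OF S _ _ y] smooth_on_differentiable[OF _ y] smooth_on_component[OF S] f g)
  then show ?thesis
    by (simp add: coord_ext_deriv_def vec_eq_iff algebra_simps sum.distrib)
qed

lemma coord_ext_deriv_scaleR:
  assumes S: "halfspace_open S" and f: "smooth_on S f" and y: "y \<in> S"
  shows "coord_ext_deriv S (\<lambda>y. a *\<^sub>R f y) y = a *\<^sub>R coord_ext_deriv S f y"
  using partial_scale[OF S y smooth_on_component[OF S f]]
  by (simp add: coord_ext_deriv_def vec_eq_iff sum_distrib_left mult_ac)

lemma coord_ext_deriv_const:
  assumes "halfspace_open S" and "y \<in> S"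
  shows "coord_ext_deriv S (\<lambda>y. c) y = 0"
  by (simp add: coord_ext_deriv_def vec_eq_iff partial_const[OF assms])

lemma coord_ext_deriv_sum:
  assumes S: "halfspace_open S" and y: "y \<in> S" and f: "\<And>i. i \<in> I \<Longrightarrow> smooth_on S (f i)"
  shows "coord_ext_deriv S (\<lambda>y. \<Sum>i\<in>I. f i y) y = (\<Sum>i\<in>I. coord_ext_deriv S (f i) y)"
  using f
proof (induction I rule: infinite_finite_induct)
  case (insert i I)
  have "coord_ext_deriv S (\<lambda>y. f i y + (\<Sum>i\<in>I. f i y)) y = coord_ext_deriv S (f i) y + coord_ext_deriv S (\<lambda>y. \<Sum>i\<in>I. f i y) y"
    using insert.prems by (intro coord_ext_deriv_add[OF S _ _ y] smooth_on_sum[OF S]) auto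
  then show ?case
    using insert by simp
qed (simp_all add: coord_ext_deriv_const[OF S y])

lemma coord_ext_deriv_leibniz:
  assumes S: "halfspace_open S" and g: "smooth_on S g" and f: "smooth_on S f" and y: "y \<in> S"
  shows "coord_ext_deriv S (\<lambda>y. g y *\<^sub>R f y) y = wedge_covector (grad S g y) (f y) + g y *\<^sub>R coord_ext_deriv S f y"
proof -
  have "partial S j (\<lambda>z. g z * f z $ I) y = g y * partial S j (\<lambda>z. f z $ I) y + partial S j g y * f y $ I" for j I
    by (intro partial_bilinear[OF S bounded_bilinear_mult] smooth_on_differentiable[OF _ y]
        smooth_on_component[OF S] f g y)
  then show ?thesis
    by (simp add: coord_ext_deriv_def wedge_covector_def grad_def vec_eq_iff algebra_simps sum.distrib sum_distrib_left)
qed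

text \<open>Of two distinct elements, removing the smaller one changes the number of elements below the larger one by
  one, while removing the larger one does not affect the smaller one.\<close>

lemma removal_sign_swap:
  fixes i j :: "'n::{finite,linorder}"
  assumes "i \<in> J" "j \<in> J" "i \<noteq> j"
  shows "(- 1 :: real) ^ card {a \<in> J. a < j} * (- 1) ^ card {a \<in> J - {j}. a < i} =
    - ((- 1) ^ card {a \<in> J. a < i} * (- 1) ^ card {a \<in> J - {i}. a < j})"
proof -
  have *: "(- 1 :: real) ^ card {a \<in> J. a < j} * (- 1) ^ card {a \<in> J - {j}. a < i} =
    - ((- 1) ^ card {a \<in> J. a < i} * (- 1) ^ card {a \<in> J - {i}. a < j})"
    if ij: "i < j" "i \<in> J" for i j :: 'n
  proof -
    have "{a \<in> J. a < j} = insert i {a \<in> J - {i}. a < j}" and "{a \<in> J - {j}. a < i} = {a \<in> J. a < i}"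
      using ij by auto
    then show ?thesis by simp
  qed
  show ?thesis
    using *[of i j] *[of j i] assms by (cases "i < j") (auto simp: mult.commute)
qed

text \<open>The terms of the double sum belong to ordered pairs of distinct elements of \<open>J\<close>; reversing a pair
  changes the sign and, by symmetry of second derivatives, nothing else.\<close>

lemma coord_ext_deriv_twice:
  assumes S: "halfspace_open S" and f: "smooth_on S f" and y: "y \<in> S"
  shows "coord_ext_deriv S (coord_ext_deriv S f) y = 0"
proof (rule vec_eq_iff[THEN iffD2], rule allI)
  fix J
  define t where "t = (\<lambda>(j, i). (- 1) ^ card {a \<in> J. a < j} * (- 1) ^ card {a \<in> J - {j}. a < i} *
      partial S j (partial S i (\<lambda>z. f z $ (J - {j} - {i}))) y)"
  define \<Sigma> where "\<Sigma> = Sigma J (\<lambda>j. J - {j})"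
  have sm: "smooth_on S (partial S i (\<lambda>z. f z $ I))" for i I
    by (intro smooth_on_partial smooth_on_component[OF S f])
  have inner: "partial S j (\<lambda>z. coord_ext_deriv S f z $ (J - {j})) y =
     (\<Sum>i\<in>J - {j}. (- 1) ^ card {a \<in> J - {j}. a < i} * partial S j (partial S i (\<lambda>z. f z $ (J - {j} - {i}))) y)" for j
  proof -
    have "partial S j (\<lambda>z. \<Sum>i\<in>J - {j}. ((- 1) ^ card {a \<in> J - {j}. a < i}) *\<^sub>R partial S i (\<lambda>z. f z $ (J - {j} - {i})) z) y =
      (\<Sum>i\<in>J - {j}. partial S j (\<lambda>z. ((- 1) ^ card {a \<in> J - {j}. a < i}) *\<^sub>R partial S i (\<lambda>z. f z $ (J - {j} - {i})) z) y)"
      by (rule partial_sum[OF S y]) (rule smooth_on_linear[OF S bounded_linear_scaleR_right sm])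
    then show ?thesis
      using partial_scale[OF S y sm] by (simp add: coord_ext_deriv_def)
  qed
  have "coord_ext_deriv S (coord_ext_deriv S f) y $ J = (\<Sum>j\<in>J. (- 1) ^ card {a \<in> J. a < j} * partial S j (\<lambda>z. coord_ext_deriv S f z $ (J - {j})) y)"
    by (subst coord_ext_deriv_def) simp
  also have "\<dots> = sum t \<Sigma>"
    unfolding inner sum_distrib_left t_def \<Sigma>_def by (subst sum.Sigma) (simp_all add: mult.assoc)
  finally have eq: "coord_ext_deriv S (coord_ext_deriv S f) y $ J = sum t \<Sigma>" .
  have "t x = - t (prod.swap x)" if x: "x \<in> \<Sigma>" for x
  proof -
    obtain j i where [simp]: "x = (j, i)" and ij: "i \<in> J" "j \<in> J" "i \<noteq> j"
      using x by (auto simp: \<Sigma>_def)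
    have "J - {j} - {i} = J - {i} - {j}"
      by auto
    then show ?thesis
      using removal_sign_swap[OF ij] partial_commute[OF S smooth_on_component[OF S f] y, of j i "J - {i} - {j}"]
      by (simp add: t_def)
  qed
  then have "sum t \<Sigma> = (\<Sum>x\<in>\<Sigma>. - t x)"
    by (intro sum.reindex_bij_witness[of _ prod.swap prod.swap]) (auto simp: \<Sigma>_def)
  then have "sum t \<Sigma> = 0"
    by (simp add: sum_negf)
  then show "coord_ext_deriv S (coord_ext_deriv S f) y $ J = 0 $ J"
    by (simp add: eq)
qed

lemma smooth_on_wedge_covector:
  assumes S: "halfspace_open S" and u: "smooth_on S u" and f: "smooth_on S f"
  shows "smooth_on S (\<lambda>y. wedge_covector (u y) (f y))"
proof (rule smooth_on_vecI[OF S])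
  fix J
  have "smooth_on S (\<lambda>y. \<Sum>j\<in>J. ((- 1) ^ card {i \<in> J. i < j} * u y $ j) * f y $ (J - {j}))"
    by (rule smooth_on_sum[OF S], rule smooth_on_mult[OF S], rule smooth_on_linear[OF S bounded_linear_mult_right])
       (rule smooth_on_component[OF S u] smooth_on_component[OF S f])+
  then show "smooth_on S (\<lambda>y. wedge_covector (u y) (f y) $ J)"
    by (simp add: wedge_covector_def)
qed

lemma smooth_on_grad:
  assumes S: "halfspace_open S" and g: "smooth_on S g"
  shows "smooth_on S (grad S g)"
  by (rule smooth_on_vecI[OF S]) (simp add: grad_def smooth_on_partial[OF g])

text \<open>For closed \<open>f\<close> the Leibniz rule gives \<open>dg \<and> f = d (g f)\<close>, so the claim is an instance of \<open>d \<circ> d = 0\<close>.\<close>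

lemma coord_ext_deriv_wedge_covector_grad:
  assumes S: "halfspace_open S" and g: "smooth_on S g" and f: "smooth_on S f"
    and closed: "\<And>y. y \<in> S \<Longrightarrow> coord_ext_deriv S f y = 0" and y: "y \<in> S"
  shows "coord_ext_deriv S (\<lambda>y. wedge_covector (grad S g y) (f y)) y = 0"
proof -
  have "coord_ext_deriv S (\<lambda>y. wedge_covector (grad S g y) (f y)) y = coord_ext_deriv S (coord_ext_deriv S (\<lambda>y. g y *\<^sub>R f y)) y"
    using coord_ext_deriv_leibniz[OF S g f] closed y by (intro coord_ext_deriv_cong) auto
  also have "\<dots> = 0"
    by (rule coord_ext_deriv_twice[OF S smooth_on_scaleR[OF S g f] y])
  finally show ?thesis .
qed

lemma minor_empty: "minor A {} J = (if J = {} then 1 else 0)"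
proof -
  have "bijections {} J = (if J = {} then {\<lambda>x. undefined} else {})"
    by (auto simp: bijections_def bij_betw_def extensional_def)
  then show ?thesis
    by (simp add: minor_eq inversion_sign_def)
qed

lemma compound_row_insert:
  assumes k: "k \<notin> I"
  shows "compound A $ insert k I = (- 1) ^ card {i \<in> I. i < k} *\<^sub>R wedge_covector (A $ k) (compound A $ I)"
proof -
  have "(- 1 :: real) ^ card {i \<in> I. i < k} * (- 1) ^ card {i \<in> I. i < k} = 1"
    by (simp flip: power_add mult_2)
  then show ?thesis
    using laplace_expansion[OF k, where A = A]
    by (simp add: vec_eq_iff compound_def wedge_covector_def mult.assoc[symmetric])
qed

text \<open>Row \<open>I\<close> of the compound matrix of the Jacobian consists of the components of \<open>d\<tau>\<^bsub>i\<^sub>1\<^esub> \<and> \<dots> \<and> d\<tau>\<^bsub>i\<^sub>p\<^esub>\<close>, a product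
  of closed forms, and the factors can be split off one at a time.\<close>

lemma compound_row_smooth_closed:
  fixes \<tau> :: "(real, 'n::{finite,linorder}) vec \<Rightarrow> (real, 'n) vec"
  assumes S: "halfspace_open S" and \<tau>: "smooth_on S \<tau>"
  shows "smooth_on S (\<lambda>y. compound (jacobian_matrix S \<tau> y) $ I) \<and>
    (\<forall>y\<in>S. coord_ext_deriv S (\<lambda>y. compound (jacobian_matrix S \<tau> y) $ I) y = 0)"
proof (induction I rule: infinite_finite_induct)
  case empty
  have "(\<lambda>y. compound (jacobian_matrix S \<tau> y) $ {}) = (\<lambda>y. axis {} 1)"
    by (simp add: fun_eq_iff vec_eq_iff compound_def minor_empty axis_def)
  then show ?case
    by (simp add: smooth_on_const[OF S] coord_ext_deriv_const[OF S])
next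
  case (insert k I)
  have eq: "(\<lambda>y. compound (jacobian_matrix S \<tau> y) $ insert k I) =
      (\<lambda>y. (- 1) ^ card {i \<in> I. i < k} *\<^sub>R wedge_covector (grad S (\<lambda>z. \<tau> z $ k) y) (compound (jacobian_matrix S \<tau> y) $ I))"
    using insert by (simp add: compound_row_insert jacobian_matrix_def)
  have \<tau>k: "smooth_on S (\<lambda>z. \<tau> z $ k)"
    by (rule smooth_on_component[OF S \<tau>])
  have sm: "smooth_on S (\<lambda>y. wedge_covector (grad S (\<lambda>z. \<tau> z $ k) y) (compound (jacobian_matrix S \<tau> y) $ I))"
    using insert by (intro smooth_on_wedge_covector[OF S smooth_on_grad[OF S \<tau>k]]) simp
  have cl: "coord_ext_deriv S (\<lambda>y. wedge_covector (grad S (\<lambda>z. \<tau> z $ k) y) (compound (jacobian_matrix S \<tau> y) $ I)) y = 0" if "y \<in> S" for y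
    using insert by (intro coord_ext_deriv_wedge_covector_grad[OF S \<tau>k _ _ that]) auto
  show ?case
    unfolding eq using smooth_on_linear[OF S bounded_linear_scaleR_right sm] coord_ext_deriv_scaleR[OF S sm] cl by simp
qed auto

lemma grad_compose:
  fixes \<tau> :: "real ^ 'n \<Rightarrow> real ^ 'n"
  assumes S: "halfspace_open S" and \<tau>: "smooth_on S \<tau>" "\<tau> ` S \<subseteq> T" and g: "smooth_on T g" and y: "y \<in> S"
  shows "grad S (\<lambda>z. g (\<tau> z)) y = transpose (jacobian_matrix S \<tau> y) *v grad T g (\<tau> y)"
proof -
  have "partial S i (\<lambda>z. g (\<tau> z)) y = (\<Sum>j\<in>UNIV. (partial S i \<tau> y $ j) *\<^sub>R partial T j g (\<tau> y))" for i
    using \<tau> g y by (intro partial_compose[OF S]) (auto intro: smooth_on_differentiable)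
  then show ?thesis
    using partial_component[OF S y \<tau>(1)]
    by (simp add: vec_eq_iff grad_def jacobian_matrix_def matrix_vector_mult_def transpose_def del: transpose_matrix_vector)
qed

lemma pullback_sum:
  "transpose (compound A) *v v = (\<Sum>I\<in>UNIV. v $ I *\<^sub>R compound A $ I)"
  by (simp add: vec_eq_iff matrix_vector_mult_def transpose_def compound_def mult.commute del: transpose_matrix_vector)

lemma smooth_on_pullback:
  fixes \<tau> :: "(real, 'n::{finite,linorder}) vec \<Rightarrow> (real, 'n) vec"
  assumes S: "halfspace_open S" and \<tau>: "smooth_on S \<tau>" and f: "smooth_on S f"
  shows "smooth_on S (\<lambda>y. transpose (compound (jacobian_matrix S \<tau> y)) *v f y)"
  unfolding pullback_sum
  by (rule smooth_on_sum[OF S], rule smooth_on_scaleR[OF S smooth_on_component[OF S f]])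
     (use compound_row_smooth_closed[OF S \<tau>] in blast)

text \<open>Naturality of the exterior derivative. Write \<open>f = \<Sum>I. f\<^sub>I dx\<^sub>I\<close>. Since the pullback of \<open>dx\<^sub>I\<close> is closed, the
  Leibniz rule shows that \<open>d\<close> of the pullback of \<open>f\<^sub>I dx\<^sub>I\<close> is the pullback of \<open>df\<^sub>I\<close> wedged with the pullback of
  \<open>dx\<^sub>I\<close>, hence the pullback of \<open>df\<^sub>I \<and> dx\<^sub>I\<close>.\<close>

lemma coord_ext_deriv_pullback:
  fixes \<tau> :: "(real, 'n::{finite,linorder}) vec \<Rightarrow> (real, 'n) vec"
  assumes S: "halfspace_open S" and T: "halfspace_open T" and \<tau>: "smooth_on S \<tau>" "\<tau> ` S \<subseteq> T"
    and f: "smooth_on T f" and y: "y \<in> S"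
  shows "coord_ext_deriv S (\<lambda>y. transpose (compound (jacobian_matrix S \<tau> y)) *v f (\<tau> y)) y =
    transpose (compound (jacobian_matrix S \<tau> y)) *v coord_ext_deriv T f (\<tau> y)"
proof -
  let ?A = "jacobian_matrix S \<tau>"
  let ?P = "transpose (compound (?A y))"
  have fI: "smooth_on T (\<lambda>z. f z $ I)" for I
    by (rule smooth_on_component[OF T f])
  have f\<tau>: "smooth_on S (\<lambda>z. f (\<tau> z) $ I)" for I
    using smooth_on_compose[OF S \<tau>(2,1) fI] .
  have row: "smooth_on S (\<lambda>y. compound (?A y) $ I)" "coord_ext_deriv S (\<lambda>y. compound (?A y) $ I) y = 0" for I
    using compound_row_smooth_closed[OF S \<tau>(1)] y by blast+
  have \<tau>y: "\<tau> y \<in> T"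
    using \<tau> y by blast
  have rows: "compound (?A y) $ I = ?P *v axis I 1" for I
    by (simp add: vec_eq_iff pullback_sum axis_def if_distrib[of "\<lambda>x. x * _"] cong: if_cong del: transpose_matrix_vector)
  have "coord_ext_deriv S (\<lambda>y. transpose (compound (?A y)) *v f (\<tau> y)) y =
      (\<Sum>I\<in>UNIV. coord_ext_deriv S (\<lambda>y. f (\<tau> y) $ I *\<^sub>R compound (?A y) $ I) y)"
    unfolding pullback_sum by (rule coord_ext_deriv_sum[OF S y]) (rule smooth_on_scaleR[OF S f\<tau> row(1)])
  also have "\<dots> = (\<Sum>I\<in>UNIV. wedge_covector (grad S (\<lambda>z. f (\<tau> z) $ I) y) (compound (?A y) $ I))"
    using coord_ext_deriv_leibniz[OF S f\<tau> row(1) y] row(2) by simp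
  also have "\<dots> = (\<Sum>I\<in>UNIV. ?P *v wedge_covector (grad T (\<lambda>z. f z $ I) (\<tau> y)) (axis I 1))"
    unfolding compound_transpose_wedge_covector grad_compose[OF S \<tau> fI y, symmetric] rows ..
  also have "\<dots> = ?P *v (\<Sum>I\<in>UNIV. wedge_covector (grad T (\<lambda>z. f z $ I) (\<tau> y)) (axis I 1))"
    by (rule linear_sum[OF matrix_vector_mul_linear, symmetric])
  also have "(\<Sum>I\<in>UNIV. wedge_covector (grad T (\<lambda>z. f z $ I) (\<tau> y)) (axis I 1)) =
      (\<Sum>I\<in>UNIV. coord_ext_deriv T (\<lambda>z. f z $ I *\<^sub>R axis I 1) (\<tau> y))"
    using coord_ext_deriv_leibniz[OF T fI smooth_on_const[OF T] \<tau>y] by (simp add: coord_ext_deriv_const[OF T \<tau>y])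
  also have "\<dots> = coord_ext_deriv T (\<lambda>z. \<Sum>I\<in>UNIV. f z $ I *\<^sub>R axis I 1) (\<tau> y)"
    by (rule coord_ext_deriv_sum[OF T \<tau>y, symmetric]) (rule smooth_on_scaleR[OF T fI smooth_on_const[OF T]])
  finally show ?thesis
    by (simp flip: vec_expansion)
qed


section \<open>Differential forms on a manifold with boundary\<close>

definition local_form :: "('a, 'n::finite) form \<Rightarrow> ('a, 'n) chart \<Rightarrow> real ^ 'n \<Rightarrow> 'n multivector"
  where "local_form \<alpha> c = (\<lambda>y. \<alpha> c (cinv c y))"

definition transition :: "('a, 'n::finite) chart \<Rightarrow> ('a, 'n) chart \<Rightarrow> real ^ 'n \<Rightarrow> real ^ 'n"
  where "transition c c' = cmap c' \<circ> cinv c"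

definition smooth_function :: "('a, 'n::finite) manifold \<Rightarrow> ('a \<Rightarrow> real) \<Rightarrow> bool"
  where "smooth_function M \<rho> \<longleftrightarrow> (\<forall>c\<in>atlas M. smooth_on (cimage c) (\<lambda>y. \<rho> (cinv c y)))"

locale smooth_manifold_space =
  fixes M :: "('a, 'n::{finite,linorder}) manifold"
  assumes smooth_manifold: "smooth_manifold M"
begin

lemma Hausdorff: "Hausdorff_space (mtop M)"
  and second_countable: "second_countable (mtop M)"
  and charts_cover: "(\<Union>c\<in>atlas M. cdom c) = topspace (mtop M)"
  using smooth_manifold unfolding smooth_manifold_def by blast+

lemma chart_at:
  assumes "x \<in> topspace (mtop M)"
  obtains c where "c \<in> atlas M" "x \<in> cdom c"
  using assms charts_cover by blast

lemma openin_cdom: "c \<in> atlas M \<Longrightarrow> openin (mtop M) (cdom c)"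
  and halfspace_open_cimage: "c \<in> atlas M \<Longrightarrow> halfspace_open (cimage c)"
  and chart_homeomorphic: "c \<in> atlas M \<Longrightarrow>
    homeomorphic_map (subtopology (mtop M) (cdom c)) (top_of_set (cimage c)) (cmap c)"
  using smooth_manifold unfolding smooth_manifold_def halfspace_open_def by blast+

lemma cdom_subset: "c \<in> atlas M \<Longrightarrow> cdom c \<subseteq> topspace (mtop M)"
  using openin_cdom openin_subset by blast

lemma inj_on_cmap: "c \<in> atlas M \<Longrightarrow> inj_on (cmap c) (cdom c)"
  using homeomorphic_imp_injective_map[OF chart_homeomorphic, of c] cdom_subset[of c]
  by (simp add: Int_absorb1)

lemma cinv_cmap [simp]: "c \<in> atlas M \<Longrightarrow> x \<in> cdom c \<Longrightarrow> cinv c (cmap c x) = x"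
  by (simp add: cinv_def inj_on_cmap)

lemma cmap_cinv [simp]: "y \<in> cimage c \<Longrightarrow> cmap c (cinv c y) = y"
  by (simp add: cinv_def cimage_def f_inv_into_f)

lemma cinv_in_cdom [simp]: "y \<in> cimage c \<Longrightarrow> cinv c y \<in> cdom c"
  by (simp add: cinv_def cimage_def inv_into_into)

lemma cmap_in_cimage [simp]: "x \<in> cdom c \<Longrightarrow> cmap c x \<in> cimage c"
  by (simp add: cimage_def)

lemma continuous_map_cmap: "c \<in> atlas M \<Longrightarrow> continuous_map (subtopology (mtop M) (cdom c)) euclidean (cmap c)"
  using homeomorphic_imp_continuous_map[OF chart_homeomorphic] continuous_map_into_fulltopology by blast

lemma openin_cmap_image:
  assumes c: "c \<in> atlas M" and W: "openin (mtop M) W" "W \<subseteq> cdom c"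
  shows "openin (top_of_set (cimage c)) (cmap c ` W)"
proof -
  have "openin (subtopology (mtop M) (cdom c)) W"
    using W by (metis Int_absorb2 openin_subtopology)
  then show ?thesis
    using homeomorphic_imp_open_map[OF chart_homeomorphic[OF c]] by (simp add: open_map_def)
qed

lemma openin_cmap_vimage:
  assumes c: "c \<in> atlas M" and V: "openin (top_of_set (cimage c)) V"
  shows "openin (mtop M) {x \<in> cdom c. cmap c x \<in> V}"
proof -
  have "openin (subtopology (mtop M) (cdom c)) {x \<in> topspace (subtopology (mtop M) (cdom c)). cmap c x \<in> V}"
    using homeomorphic_imp_continuous_map[OF chart_homeomorphic[OF c]] V openin_continuous_map_preimage by blast
  moreover have "topspace (subtopology (mtop M) (cdom c)) = cdom c"
    using cdom_subset[OF c] by auto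
  ultimately show ?thesis
    using openin_cdom[OF c] openin_trans_full by fastforce
qed

lemma compact_cmap_image:
  assumes c: "c \<in> atlas M" and K: "compactin (mtop M) K" "K \<subseteq> cdom c"
  shows "compact (cmap c ` K)"
proof -
  have "compactin (subtopology (mtop M) (cdom c)) K"
    using K by (simp add: compactin_subtopology)
  then have "compactin euclidean (cmap c ` K)"
    using image_compactin continuous_map_cmap[OF c] by blast
  then show ?thesis by simp
qed

lemma compactin_cinv_image:
  assumes c: "c \<in> atlas M" and K: "compact K" "K \<subseteq> cimage c"
  shows "compactin (mtop M) (cinv c ` K)"
proof -
  obtain g where g: "homeomorphic_maps (subtopology (mtop M) (cdom c)) (top_of_set (cimage c)) (cmap c) g"
    using chart_homeomorphic[OF c] homeomorphic_map_maps by blast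
  have geq: "g y = cinv c y" if "y \<in> cimage c" for y
  proof -
    have "g (cmap c z) = z" if "z \<in> cdom c" for z
      using g that cdom_subset[OF c] unfolding homeomorphic_maps_def by auto
    from this[OF cinv_in_cdom[OF that]] show ?thesis using that by simp
  qed
  have "compactin (top_of_set (cimage c)) K"
    using K by (simp add: compactin_subtopology)
  then have "compactin (subtopology (mtop M) (cdom c)) (g ` K)"
    using g image_compactin unfolding homeomorphic_maps_def by blast
  moreover have "g ` K = cinv c ` K"
    using geq K by (intro image_cong) auto
  ultimately show ?thesis
    by (simp add: compactin_subtopology)
qed

lemma openin_overlap: "c \<in> atlas M \<Longrightarrow> c' \<in> atlas M \<Longrightarrow> openin (top_of_set (cimage c)) (overlap c c')"
  unfolding overlap_def using openin_cmap_image[OF _ openin_Int[OF openin_cdom openin_cdom] Int_lower1] .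

lemma halfspace_open_overlap: "c \<in> atlas M \<Longrightarrow> c' \<in> atlas M \<Longrightarrow> halfspace_open (overlap c c')"
  using halfspace_open_openin halfspace_open_cimage openin_overlap by blast

lemma overlap_iff: "c \<in> atlas M \<Longrightarrow> y \<in> overlap c c' \<longleftrightarrow> y \<in> cimage c \<and> cinv c y \<in> cdom c'"
  by (auto simp: overlap_def image_iff intro!: bexI[of _ "cinv c y"])

lemma smooth_on_transition: "c \<in> atlas M \<Longrightarrow> c' \<in> atlas M \<Longrightarrow> smooth_on (overlap c c') (transition c c')"
  using smooth_manifold unfolding smooth_manifold_def transition_def by blast

lemma transition_image: "c \<in> atlas M \<Longrightarrow> c' \<in> atlas M \<Longrightarrow> transition c c' ` overlap c c' \<subseteq> overlap c' c"
  by (auto simp: transition_def overlap_iff)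

lemma coord_jacobian_eq:
  assumes "c \<in> atlas M" "c' \<in> atlas M" "x \<in> cdom c \<inter> cdom c'"
  shows "coord_jacobian c c' x = jacobian_matrix (overlap c c') (transition c c') (cmap c x)"
proof -
  have x: "cmap c x \<in> overlap c c'"
    using assms by (simp add: overlap_iff)
  show ?thesis
    using partial_component[OF halfspace_open_overlap x smooth_on_transition] assms
    by (simp add: coord_jacobian_def jacobian_def matrix_def jacobian_matrix_def grad_def vec_eq_iff partial_def
        transition_def)
qed


lemma smooth_formsD:
  assumes "\<alpha> \<in> smooth_forms M p"
  shows "\<And>c x. \<not> (c \<in> atlas M \<and> x \<in> cdom c) \<Longrightarrow> \<alpha> c x = 0"
    and "\<And>c x. \<alpha> c x \<in> multivectors p"
    and "\<And>c. c \<in> atlas M \<Longrightarrow> smooth_on (cimage c) (local_form \<alpha> c)"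
    and "\<And>c c' x. c \<in> atlas M \<Longrightarrow> c' \<in> atlas M \<Longrightarrow> x \<in> cdom c \<Longrightarrow> x \<in> cdom c' \<Longrightarrow>
       \<alpha> c x = transpose (compound (coord_jacobian c c' x)) *v \<alpha> c' x"
  using assms unfolding smooth_forms_def local_form_def by blast+

lemma smooth_formsI:
  assumes "\<And>c x. \<not> (c \<in> atlas M \<and> x \<in> cdom c) \<Longrightarrow> \<alpha> c x = 0"
    and "\<And>c x. \<alpha> c x \<in> multivectors p"
    and "\<And>c. c \<in> atlas M \<Longrightarrow> smooth_on (cimage c) (local_form \<alpha> c)"
    and "\<And>c c' x. c \<in> atlas M \<Longrightarrow> c' \<in> atlas M \<Longrightarrow> x \<in> cdom c \<Longrightarrow> x \<in> cdom c' \<Longrightarrow>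
       \<alpha> c x = transpose (compound (coord_jacobian c c' x)) *v \<alpha> c' x"
  shows "\<alpha> \<in> smooth_forms M p"
  unfolding smooth_forms_def using assms unfolding local_form_def by blast

lemma multivectors_subspace: "subspace (multivectors p)"
  by (auto simp: subspace_def multivectors_def)

lemma smooth_forms_scaled:
  assumes \<rho>: "smooth_function M \<rho>" and \<alpha>: "\<alpha> \<in> smooth_forms M p"
  shows "(\<lambda>c x. \<rho> x *\<^sub>R \<alpha> c x) \<in> smooth_forms M p"
proof (rule smooth_formsI)
  fix c assume c: "c \<in> atlas M"
  then show "smooth_on (cimage c) (local_form (\<lambda>c x. \<rho> x *\<^sub>R \<alpha> c x) c)"
    using smooth_on_scaleR[OF halfspace_open_cimage[OF c] _ smooth_formsD(3)[OF \<alpha> c]] \<rho>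
    by (simp add: smooth_function_def local_form_def)
next
  show "\<And>c x. \<rho> x *\<^sub>R \<alpha> c x \<in> multivectors p"
    using smooth_formsD(2)[OF \<alpha>] multivectors_subspace subspace_scale by blast
next
  fix c c' x assume "c \<in> atlas M" "c' \<in> atlas M" "x \<in> cdom c" "x \<in> cdom c'"
  then show "\<rho> x *\<^sub>R \<alpha> c x = transpose (compound (coord_jacobian c c' x)) *v (\<rho> x *\<^sub>R \<alpha> c' x)"
    using smooth_formsD(4)[OF \<alpha>] linear_scale[OF matrix_vector_mul_linear] by metis
qed (use smooth_formsD(1)[OF \<alpha>] in auto)

lemma smooth_forms_add:
  assumes \<alpha>: "\<alpha> \<in> smooth_forms M p" and \<beta>: "\<beta> \<in> smooth_forms M p"
  shows "\<alpha> + \<beta> \<in> smooth_forms M p"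
proof (rule smooth_formsI)
  fix c assume c: "c \<in> atlas M"
  then show "smooth_on (cimage c) (local_form (\<alpha> + \<beta>) c)"
    using smooth_on_add[OF halfspace_open_cimage[OF c] smooth_formsD(3)[OF \<alpha> c] smooth_formsD(3)[OF \<beta> c]]
    by (simp add: local_form_def)
next
  show "\<And>c x. (\<alpha> + \<beta>) c x \<in> multivectors p"
    using smooth_formsD(2)[OF \<alpha>] smooth_formsD(2)[OF \<beta>] multivectors_subspace subspace_add by fastforce
next
  fix c c' x assume *: "c \<in> atlas M" "c' \<in> atlas M" "x \<in> cdom c" "x \<in> cdom c'"
  show "(\<alpha> + \<beta>) c x = transpose (compound (coord_jacobian c c' x)) *v (\<alpha> + \<beta>) c' x"
    using smooth_formsD(4)[OF \<alpha> *] smooth_formsD(4)[OF \<beta> *]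
    by (simp only: plus_fun_apply linear_add[OF matrix_vector_mul_linear])
next
  fix c x assume "\<not> (c \<in> atlas M \<and> x \<in> cdom c)"
  then show "(\<alpha> + \<beta>) c x = 0"
    using smooth_formsD(1)[OF \<alpha>] smooth_formsD(1)[OF \<beta>] by simp
qed

lemma smooth_function_const: "smooth_function M (\<lambda>x. a)"
  by (simp add: smooth_function_def smooth_on_const halfspace_open_cimage)

lemma zero_smooth_form: "0 \<in> smooth_forms M p"
proof (rule smooth_formsI)
  fix c assume "c \<in> atlas M"
  then show "smooth_on (cimage c) (local_form 0 c)"
    by (simp add: local_form_def smooth_on_const halfspace_open_cimage)
qed (simp_all add: subspace_0[OF multivectors_subspace])

lemma subspace_smooth_forms: "subspace (smooth_forms M p)"
  using smooth_forms_add zero_smooth_form smooth_forms_scaled[OF smooth_function_const]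
  by (auto simp: subspace_def scaleR_fun_def)

lemma ext_deriv_in_chart:
  assumes "c \<in> atlas M" and "x \<in> cdom c"
  shows "ext_deriv M \<alpha> c x = coord_ext_deriv (cimage c) (local_form \<alpha> c) (cmap c x)"
  using assms by (simp add: ext_deriv_def coord_ext_deriv_def local_form_def)

lemma ext_deriv_outside: "\<not> (c \<in> atlas M \<and> x \<in> cdom c) \<Longrightarrow> ext_deriv M \<alpha> c x = 0"
  by (auto simp: ext_deriv_def)

lemma ext_deriv_add:
  assumes "\<alpha> \<in> smooth_forms M p" and "\<beta> \<in> smooth_forms M p"
  shows "ext_deriv M (\<alpha> + \<beta>) = ext_deriv M \<alpha> + ext_deriv M \<beta>"
proof (intro ext)
  fix c x
  show "ext_deriv M (\<alpha> + \<beta>) c x = (ext_deriv M \<alpha> + ext_deriv M \<beta>) c x"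
  proof (cases "c \<in> atlas M \<and> x \<in> cdom c")
    case True
    then show ?thesis
      using coord_ext_deriv_add[OF halfspace_open_cimage smooth_formsD(3)[OF assms(1)] smooth_formsD(3)[OF assms(2)], of c "cmap c x"]
      by (simp add: ext_deriv_in_chart) (simp add: local_form_def)
  qed (simp add: ext_deriv_outside)
qed

lemma ext_deriv_scaleR:
  assumes "\<alpha> \<in> smooth_forms M p"
  shows "ext_deriv M (a *\<^sub>R \<alpha>) = a *\<^sub>R ext_deriv M \<alpha>"
proof (intro ext)
  fix c x
  show "ext_deriv M (a *\<^sub>R \<alpha>) c x = (a *\<^sub>R ext_deriv M \<alpha>) c x"
  proof (cases "c \<in> atlas M \<and> x \<in> cdom c")
    case True
    then show ?thesis
      using coord_ext_deriv_scaleR[OF halfspace_open_cimage smooth_formsD(3)[OF assms], of c "cmap c x" a]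
      by (simp add: ext_deriv_in_chart) (simp add: local_form_def)
  qed (simp add: ext_deriv_outside)
qed

lemma local_form_ext_deriv:
  "c \<in> atlas M \<Longrightarrow> y \<in> cimage c \<Longrightarrow> local_form (ext_deriv M \<alpha>) c y = coord_ext_deriv (cimage c) (local_form \<alpha> c) y"
  by (simp add: local_form_def[of "ext_deriv M \<alpha>"] ext_deriv_in_chart)

text \<open>The transformation law of \<open>ext_deriv M \<alpha>\<close> is naturality with respect to the change of coordinates, and
  closedness is \<open>d \<circ> d = 0\<close> in each chart.\<close>

lemma ext_deriv_smooth_closed:
  assumes \<alpha>: "\<alpha> \<in> smooth_forms M q"
  shows "ext_deriv M \<alpha> \<in> closed_forms M (Suc q)"
proof -
  have "ext_deriv M \<alpha> \<in> smooth_forms M (Suc q)"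
  proof (rule smooth_formsI)
    fix c x
    show "ext_deriv M \<alpha> c x \<in> multivectors (Suc q)"
      unfolding multivectors_def
    proof (intro CollectI allI impI)
      fix J :: "'n set" assume J: "card J \<noteq> Suc q"
      show "ext_deriv M \<alpha> c x $ J = 0"
      proof (cases "c \<in> atlas M \<and> x \<in> cdom c")
        case True
        then have S: "halfspace_open (cimage c)" "cmap c x \<in> cimage c"
          by (simp_all add: halfspace_open_cimage)
        have "partial (cimage c) j (\<lambda>y. \<alpha> c (cinv c y) $ (J - {j})) (cmap c x) = 0" if j: "j \<in> J" for j
        proof -
          have "card (J - {j}) \<noteq> q"
            using J j by (metis card_Suc_Diff1 finite)
          then have "(\<lambda>y. \<alpha> c (cinv c y) $ (J - {j})) = (\<lambda>y. 0)"
            using smooth_formsD(2)[OF \<alpha>] by (auto simp: multivectors_def)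
          then show ?thesis
            using partial_const[OF S] by simp
        qed
        then show ?thesis
          using True by (simp add: ext_deriv_def)
      qed (simp add: ext_deriv_outside)
    qed
  next
    fix c assume c: "c \<in> atlas M"
    show "smooth_on (cimage c) (local_form (ext_deriv M \<alpha>) c)"
      using smooth_on_coord_ext_deriv[OF halfspace_open_cimage[OF c] smooth_formsD(3)[OF \<alpha> c]] local_form_ext_deriv[OF c]
        smooth_on_cong by blast
  next
    fix c c' x assume *: "c \<in> atlas M" "c' \<in> atlas M" "x \<in> cdom c" "x \<in> cdom c'"
    let ?O = "overlap c c'" and ?O' = "overlap c' c" and ?\<tau> = "transition c c'" and ?y = "cmap c x"
    have y: "?y \<in> ?O" and \<tau>y: "?\<tau> ?y = cmap c' x" "cmap c' x \<in> ?O'"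
      using * by (simp_all add: overlap_iff transition_def)
    have f': "smooth_on ?O' (local_form \<alpha> c')"
      using smooth_on_openin[OF smooth_formsD(3)[OF \<alpha>]] openin_overlap * by blast
    have eq: "local_form \<alpha> c z = transpose (compound (jacobian_matrix ?O ?\<tau> z)) *v local_form \<alpha> c' (?\<tau> z)"
      if z: "z \<in> ?O" for z
    proof -
      have z': "z \<in> cimage c" "cinv c z \<in> cdom c" "cinv c z \<in> cdom c'"
        using z * by (auto simp: overlap_iff)
      then show ?thesis
        using smooth_formsD(4)[OF \<alpha> *(1,2) z'(2,3)] coord_jacobian_eq[OF *(1,2), of "cinv c z"] *
        by (simp add: local_form_def transition_def)
    qed
    have "ext_deriv M \<alpha> c x = coord_ext_deriv ?O (local_form \<alpha> c) ?y"
      using * y by (simp add: ext_deriv_in_chart coord_ext_deriv_openin[OF openin_overlap])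
    also have "\<dots> = coord_ext_deriv ?O (\<lambda>z. transpose (compound (jacobian_matrix ?O ?\<tau> z)) *v local_form \<alpha> c' (?\<tau> z)) ?y"
      using eq y by (rule coord_ext_deriv_cong)
    also have "\<dots> = transpose (compound (jacobian_matrix ?O ?\<tau> ?y)) *v coord_ext_deriv ?O' (local_form \<alpha> c') (?\<tau> ?y)"
      using * y f' by (intro coord_ext_deriv_pullback halfspace_open_overlap smooth_on_transition transition_image)
    also have "coord_ext_deriv ?O' (local_form \<alpha> c') (?\<tau> ?y) = ext_deriv M \<alpha> c' x"
      using * \<tau>y by (simp add: ext_deriv_in_chart coord_ext_deriv_openin[OF openin_overlap])
    finally show "ext_deriv M \<alpha> c x = transpose (compound (coord_jacobian c c' x)) *v ext_deriv M \<alpha> c' x"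
      using * by (simp add: coord_jacobian_eq)
  qed (rule ext_deriv_outside)
  moreover have "ext_deriv M (ext_deriv M \<alpha>) c x = 0" for c x
  proof (cases "c \<in> atlas M \<and> x \<in> cdom c")
    case True
    then have "ext_deriv M (ext_deriv M \<alpha>) c x = coord_ext_deriv (cimage c) (coord_ext_deriv (cimage c) (local_form \<alpha> c)) (cmap c x)"
      using coord_ext_deriv_cong[OF local_form_ext_deriv] by (simp add: ext_deriv_in_chart)
    also have "\<dots> = 0"
      using True coord_ext_deriv_twice[OF halfspace_open_cimage smooth_formsD(3)[OF \<alpha>]] by simp
    finally show ?thesis .
  qed (rule ext_deriv_outside)
  ultimately show ?thesis
    by (simp add: closed_forms_def zero_form_def fun_eq_iff)
qed

lemma ext_deriv_local:
  assumes U: "openin (mtop M) U" and x: "x \<in> U" and eq: "\<And>y. y \<in> U \<Longrightarrow> \<alpha> c y = \<beta> c y"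
  shows "ext_deriv M \<alpha> c x = ext_deriv M \<beta> c x"
proof (cases "c \<in> atlas M \<and> x \<in> cdom c")
  case True
  let ?W = "cmap c ` (U \<inter> cdom c)"
  have W: "openin (top_of_set (cimage c)) ?W" "cmap c x \<in> ?W"
    using True U x openin_cdom by (auto intro!: openin_cmap_image)
  have "coord_ext_deriv ?W (local_form \<alpha> c) (cmap c x) = coord_ext_deriv ?W (local_form \<beta> c) (cmap c x)"
    using True eq W(2) by (intro coord_ext_deriv_cong) (auto simp: local_form_def)
  then show ?thesis
    using True coord_ext_deriv_openin[OF W] by (simp add: ext_deriv_in_chart)
qed (simp add: ext_deriv_outside)

end


section \<open>Cutoff functions, test forms and cohomology\<close>

context smooth_manifold_space
begin

lemma chart_ball:
  assumes c: "c \<in> atlas M" and x: "x \<in> cdom c"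
  obtains r h where "0 < r" and "cball (cmap c x) r \<inter> {y. 0 \<le> h \<bullet> y} \<subseteq> cimage c" and "cimage c \<subseteq> {y. 0 \<le> h \<bullet> y}"
proof -
  obtain h where h: "\<And>y. y \<in> cimage c \<Longrightarrow> 0 \<le> h \<bullet> y"
    and "\<exists>e>0. ball (cmap c x) e \<inter> {y. 0 \<le> h \<bullet> y} \<subseteq> cimage c"
    using halfspace_openE[OF halfspace_open_cimage[OF c]] cmap_in_cimage[OF x] by metis
  then obtain e where e: "e > 0" "ball (cmap c x) e \<inter> {y. 0 \<le> h \<bullet> y} \<subseteq> cimage c"
    by blast
  have cb: "cball (cmap c x) (e / 2) \<subseteq> ball (cmap c x) e"
    using e by (simp add: subset_iff)
  show ?thesis
  proof (rule that)
    show "0 < e / 2"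
      using e by simp
    show "cball (cmap c x) (e / 2) \<inter> {y. 0 \<le> h \<bullet> y} \<subseteq> cimage c"
      using cb e by blast
    show "cimage c \<subseteq> {y. 0 \<le> h \<bullet> y}"
      using h by blast
  qed
qed

text \<open>Convexity is what termwise differentiation of series needs; the compact set serves to bound derivatives.
  In the chart, \<open>W\<close> is the part of a small ball in the half-space.\<close>

lemma chart_compact_neighbourhood:
  assumes c: "c \<in> atlas M" and x: "x \<in> cdom c"
  obtains W K where "openin (mtop M) W" "x \<in> W" "W \<subseteq> K" "compactin (mtop M) K" "K \<subseteq> cdom c"
    "convex (cmap c ` W)"
proof -
  obtain r h where r: "0 < r" "cball (cmap c x) r \<inter> {y. 0 \<le> h \<bullet> y} \<subseteq> cimage c" "cimage c \<subseteq> {y. 0 \<le> h \<bullet> y}"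
    using chart_ball[OF assms] .
  define B where "B = cball (cmap c x) r \<inter> {y. 0 \<le> h \<bullet> y}"
  define V where "V = cimage c \<inter> ball (cmap c x) r"
  have VB: "V \<subseteq> B"
    using r(3) by (auto simp: V_def B_def)
  have V_eq: "V = {y. 0 \<le> h \<bullet> y} \<inter> ball (cmap c x) r"
    using r ball_subset_cball by (auto simp: V_def)
  define W where "W = {z \<in> cdom c. cmap c z \<in> V}"
  have im: "cmap c ` W = V"
    by (auto simp: W_def V_def cimage_def)
  show ?thesis
  proof (rule that[of W "cinv c ` B"])
    show "openin (mtop M) W"
      unfolding W_def by (intro openin_cmap_vimage[OF c]) (auto simp: V_def)
    show "x \<in> W"
      using x r by (simp add: W_def V_def)
    show "W \<subseteq> cinv c ` B"
      using VB c by (force simp: W_def)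
    have "compact B"
      unfolding B_def by (intro compact_Int_closed compact_cball closed_halfspace_ge)
    then show "compactin (mtop M) (cinv c ` B)"
      using r(2) by (intro compactin_cinv_image[OF c]) (simp_all add: B_def)
    show "cinv c ` B \<subseteq> cdom c"
      using r(2) by (auto simp: B_def)
    show "convex (cmap c ` W)"
      unfolding im V_eq by (intro convex_Int convex_ball convex_halfspace_ge)
  qed
qed

lemma locally_compact: "locally_compact_space (mtop M)"
  unfolding locally_compact_space_def by (metis chart_at chart_compact_neighbourhood)

lemma regular: "regular_space (mtop M)"
  using locally_compact_Hausdorff_imp_regular_space locally_compact Hausdorff by blast

lemma smooth_on_bump:
  assumes S: "halfspace_open S"
  shows "smooth_on S (\<lambda>y. step_down (a * ((y - y0) \<bullet> (y - y0)) - 1))"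
proof -
  have d: "smooth_on S (\<lambda>y. y + - y0)"
    by (rule smooth_on_add[OF S smooth_on_id[OF S] smooth_on_const[OF S]])
  have "smooth_on S (\<lambda>y. a * ((y + - y0) \<bullet> (y + - y0)) + - 1)"
    by (rule smooth_on_add[OF S smooth_on_linear[OF S bounded_linear_mult_right
            smooth_on_bilinear[OF S bounded_bilinear_inner d d]] smooth_on_const[OF S]])
  from smooth_on_step_down[OF S this] show ?thesis by simp
qed

text \<open>A radial bump in a chart, extended by \<open>0\<close>. The extension is smooth because its support is compact, hence
  closed in the Hausdorff space \<open>M\<close>: each point lies in the domain of that chart or has a neighbourhood on
  which the function vanishes.\<close>

lemma local_cutoff:
  assumes x: "x \<in> topspace (mtop M)"
  obtains \<rho> N L where "smooth_function M \<rho>" "openin (mtop M) N" "x \<in> N" "compactin (mtop M) L"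
    "\<And>z. z \<in> N \<Longrightarrow> \<rho> z = 1" "\<And>z. z \<notin> L \<Longrightarrow> \<rho> z = 0"
proof -
  obtain c where c: "c \<in> atlas M" "x \<in> cdom c"
    using x by (rule chart_at)
  let ?y0 = "cmap c x"
  obtain r h where r: "0 < r" "cball ?y0 r \<inter> {y. 0 \<le> h \<bullet> y} \<subseteq> cimage c" "cimage c \<subseteq> {y. 0 \<le> h \<bullet> y}"
    using chart_ball[OF c] .
  \<comment> \<open>Equal to \<open>1\<close> within distance \<open>r / 2\<close> of \<open>?y0\<close>, and to \<open>0\<close> from distance \<open>r\<close> on.\<close>
  define b where "b y = step_down (2 / r\<^sup>2 * ((y - ?y0) \<bullet> (y - ?y0)) - 1)" for y
  have b0: "b y = 0" if "y \<notin> cball ?y0 r" for y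
  proof -
    have "r\<^sup>2 \<le> (norm (y - ?y0))\<^sup>2"
      using that r by (intro power_mono) (auto simp: dist_norm norm_minus_commute)
    then have "1 \<le> 2 / r\<^sup>2 * ((y - ?y0) \<bullet> (y - ?y0)) - 1"
      using r by (simp add: dot_square_norm field_simps)
    then show ?thesis unfolding b_def by (rule step_down_1)
  qed
  have b1: "b y = 1" if "y \<in> ball ?y0 (r / 2)" for y
  proof -
    have "(norm (y - ?y0))\<^sup>2 \<le> (r / 2)\<^sup>2"
      using that r by (intro power_mono) (auto simp: dist_norm norm_minus_commute)
    then have "4 * (norm (y - ?y0))\<^sup>2 \<le> r\<^sup>2"
      by (simp add: power_divide)
    then have "2 * (norm (y - ?y0))\<^sup>2 \<le> r\<^sup>2"
      using zero_le_power2[of "norm (y - ?y0)"] by linarith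
    then have "2 / r\<^sup>2 * ((y - ?y0) \<bullet> (y - ?y0)) - 1 \<le> 0"
      using r by (simp add: dot_square_norm field_simps)
    then show ?thesis unfolding b_def by (rule step_down_0)
  qed
  define B where "B = cball ?y0 r \<inter> {y. 0 \<le> h \<bullet> y}"
  define L where "L = cinv c ` B"
  define N where "N = {z \<in> cdom c. cmap c z \<in> cimage c \<inter> ball ?y0 (r / 2)}"
  define \<rho> where "\<rho> z = (if z \<in> cdom c then b (cmap c z) else 0)" for z
  have L: "compactin (mtop M) L" "L \<subseteq> cdom c"
    using r(2) compact_Int_closed[OF compact_cball closed_halfspace_ge, of ?y0 r 0 h]
    unfolding L_def B_def by (auto intro!: compactin_cinv_image[OF c(1)])
  have \<rho>0: "\<rho> z = 0" if "z \<notin> L" for z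
  proof (cases "z \<in> cdom c")
    case True
    then have "cmap c z \<notin> B"
      using that c by (force simp: L_def)
    then have "cmap c z \<notin> cball ?y0 r"
      using subsetD[OF r(3) cmap_in_cimage[OF True]] by (auto simp: B_def)
    then show ?thesis by (simp add: \<rho>_def b0)
  qed (simp add: \<rho>_def)
  have "smooth_on (cimage c') (\<lambda>y. \<rho> (cinv c' y))" if c': "c' \<in> atlas M" for c'
  proof (rule smooth_on_local)
    fix y assume y: "y \<in> cimage c'"
    let ?V = "cmap c' ` (cdom c' \<inter> (topspace (mtop M) - L))"
    have "openin (mtop M) (topspace (mtop M) - L)"
      using compactin_imp_closedin[OF Hausdorff L(1)] by blast
    then have V: "openin (top_of_set (cimage c')) ?V"
      using c' openin_cdom by (intro openin_cmap_image) auto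
    show "\<exists>T. openin (top_of_set (cimage c')) T \<and> y \<in> T \<and> smooth_on T (\<lambda>y. \<rho> (cinv c' y))"
    proof (cases "cinv c' y \<in> cdom c")
      case True
      have O: "halfspace_open (overlap c' c)"
        by (rule halfspace_open_overlap[OF c' c(1)])
      have "smooth_on (overlap c c') b"
        unfolding b_def[abs_def] by (rule smooth_on_bump[OF halfspace_open_overlap[OF c(1) c']])
      then have "smooth_on (overlap c' c) (\<lambda>z. b (transition c' c z))"
        by (rule smooth_on_compose[OF O transition_image[OF c' c(1)] smooth_on_transition[OF c' c(1)]])
      then have "smooth_on (overlap c' c) (\<lambda>y. \<rho> (cinv c' y))"
        by (rule smooth_on_cong[THEN iffD1, rotated]) (use c' in \<open>simp add: \<rho>_def overlap_iff transition_def\<close>)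
      then show ?thesis
        using openin_overlap[OF c' c(1)] y True c' by (auto simp: overlap_iff)
    next
      case False
      have "y \<in> ?V"
        using y c' False L(2) cdom_subset[OF c'] cinv_in_cdom[OF y]
        by (intro image_eqI[of _ _ "cinv c' y"]) auto
      moreover have "smooth_on ?V (\<lambda>y. \<rho> (cinv c' y)) \<longleftrightarrow> smooth_on ?V (\<lambda>y. 0 :: real)"
        using c' by (intro smooth_on_cong) (auto simp: \<rho>0)
      moreover have "smooth_on ?V (\<lambda>y. 0 :: real)"
        using smooth_on_const halfspace_open_openin[OF halfspace_open_cimage[OF c'] V] by blast
      ultimately show ?thesis
        using V by blast
    qed
  qed
  then have "smooth_function M \<rho>"
    by (simp add: smooth_function_def)
  moreover have "openin (mtop M) N"
    unfolding N_def by (intro openin_cmap_vimage[OF c(1)]) auto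
  moreover have "x \<in> N"
    using c r by (simp add: N_def)
  moreover have "\<rho> z = 1" if "z \<in> N" for z
    using that b1 by (simp add: N_def \<rho>_def)
  ultimately show ?thesis
    using that L(1) \<rho>0 by blast
qed

text \<open>By compactness finitely many local cutoff functions suffice, and two of them are combined by
  \<open>1 - (1 - \<rho>\<^sub>1) (1 - \<rho>\<^sub>2)\<close>.\<close>

lemma cutoff:
  assumes K: "compactin (mtop M) K"
  obtains \<rho> N L where "smooth_function M \<rho>" "openin (mtop M) N" "K \<subseteq> N" "compactin (mtop M) L"
    "\<forall>z\<in>N. \<rho> z = 1" "\<forall>z. z \<notin> L \<longrightarrow> \<rho> z = 0"
proof -
  define cut where "cut N \<longleftrightarrow> openin (mtop M) N \<and> (\<exists>\<rho> L. smooth_function M \<rho> \<and> compactin (mtop M) L \<and>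
    (\<forall>z\<in>N. \<rho> z = 1) \<and> (\<forall>z. z \<notin> L \<longrightarrow> \<rho> z = 0))" for N
  have cut_empty: "cut {}"
    unfolding cut_def using smooth_function_const[of 0] by (auto intro!: exI[of _ "\<lambda>z. 0"] exI[of _ "{}"])
  have cut_Un: "cut (N1 \<union> N2)" if "cut N1" "cut N2" for N1 N2
  proof -
    obtain \<rho>1 L1 where 1: "openin (mtop M) N1" "smooth_function M \<rho>1" "compactin (mtop M) L1"
      "\<And>z. z \<in> N1 \<Longrightarrow> \<rho>1 z = 1" "\<And>z. z \<notin> L1 \<Longrightarrow> \<rho>1 z = 0"
      using \<open>cut N1\<close> unfolding cut_def by metis
    obtain \<rho>2 L2 where 2: "openin (mtop M) N2" "smooth_function M \<rho>2" "compactin (mtop M) L2"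
      "\<And>z. z \<in> N2 \<Longrightarrow> \<rho>2 z = 1" "\<And>z. z \<notin> L2 \<Longrightarrow> \<rho>2 z = 0"
      using \<open>cut N2\<close> unfolding cut_def by metis
    have "smooth_function M (\<lambda>z. (\<rho>1 z + \<rho>2 z) + (- 1) * (\<rho>1 z * \<rho>2 z))"
      unfolding smooth_function_def
    proof
      fix c assume c: "c \<in> atlas M"
      note S = halfspace_open_cimage[OF c]
      have sm: "smooth_on (cimage c) (\<lambda>y. \<rho>1 (cinv c y))" "smooth_on (cimage c) (\<lambda>y. \<rho>2 (cinv c y))"
        using 1(2) 2(2) c by (auto simp: smooth_function_def)
      show "smooth_on (cimage c) (\<lambda>y. (\<rho>1 (cinv c y) + \<rho>2 (cinv c y)) + (- 1) * (\<rho>1 (cinv c y) * \<rho>2 (cinv c y)))"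
        by (rule smooth_on_add[OF S smooth_on_add[OF S sm] smooth_on_linear[OF S bounded_linear_mult_right smooth_on_mult[OF S sm]]])
    qed
    then show ?thesis
      unfolding cut_def using 1 2 compactin_Un[OF 1(3) 2(3)] openin_Un[OF 1(1) 2(1)]
      by (intro conjI exI[of _ "\<lambda>z. (\<rho>1 z + \<rho>2 z) + (- 1) * (\<rho>1 z * \<rho>2 z)"] exI[of _ "L1 \<union> L2"]) auto
  qed
  have cut_Union: "cut (\<Union>\<F>)" if "finite \<F>" "\<F> \<subseteq> Collect cut" for \<F>
    using that by (induction \<F> rule: finite_induct) (auto simp: cut_empty intro: cut_Un)
  have "\<exists>N. cut N \<and> x \<in> N" if "x \<in> K" for x
  proof -
    have "x \<in> topspace (mtop M)"
      using that compactin_subset_topspace[OF K] by blast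
    then show ?thesis
      using local_cutoff[of x] unfolding cut_def by metis
  qed
  then have "K \<subseteq> \<Union>(Collect cut)" "\<And>N. N \<in> Collect cut \<Longrightarrow> openin (mtop M) N"
    by (auto simp: cut_def)
  then obtain \<F> where "finite \<F>" "\<F> \<subseteq> Collect cut" "K \<subseteq> \<Union>\<F>"
    using compactinD[OF K] by metis
  then have "cut (\<Union>\<F>)" "K \<subseteq> \<Union>\<F>"
    using cut_Union by blast+
  then show ?thesis
    using that unfolding cut_def by metis
qed


lemma form_lincomb_eq: "form_lincomb a \<alpha> b \<beta> = a *\<^sub>R \<alpha> + b *\<^sub>R \<beta>"
  by (simp add: form_lincomb_def fun_eq_iff)

lemma zero_form_eq: "zero_form = 0"
  by (simp add: zero_form_def fun_eq_iff)

lemma test_formsD: "\<alpha> \<in> test_forms M p \<Longrightarrow> \<alpha> \<in> smooth_forms M p"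
  by (simp add: test_forms_def)

lemma form_nonzero_subset:
  assumes "\<alpha> \<in> smooth_forms M p"
  shows "{x. \<exists>c. \<alpha> c x \<noteq> 0} \<subseteq> topspace (mtop M)"
  using smooth_formsD(1)[OF assms] cdom_subset by blast

lemma test_formsI:
  assumes \<alpha>: "\<alpha> \<in> smooth_forms M p" and L: "compactin (mtop M) L"
    and sub: "\<And>c x. \<alpha> c x \<noteq> 0 \<Longrightarrow> x \<in> L"
  shows "\<alpha> \<in> test_forms M p"
proof -
  have "closedin (mtop M) L"
    using compactin_imp_closedin Hausdorff L by blast
  then have "form_support M \<alpha> \<subseteq> L"
    unfolding form_support_def using sub by (intro closure_of_minimal) auto
  moreover have "closedin (mtop M) (form_support M \<alpha>)"
    by (simp add: form_support_def)
  ultimately have "compactin (mtop M) (form_support M \<alpha>)"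
    using L closed_compactin by blast
  then show ?thesis
    using \<alpha> by (simp add: test_forms_def)
qed

lemma test_form_support:
  assumes \<alpha>: "\<alpha> \<in> test_forms M p"
  shows "compactin (mtop M) (form_support M \<alpha>)" and "\<alpha> c x \<noteq> 0 \<Longrightarrow> x \<in> form_support M \<alpha>"
proof -
  show "compactin (mtop M) (form_support M \<alpha>)"
    using \<alpha> by (simp add: test_forms_def)
  show "x \<in> form_support M \<alpha>" if "\<alpha> c x \<noteq> 0"
    using closure_of_subset[OF form_nonzero_subset[OF test_formsD[OF \<alpha>]]] that
    unfolding form_support_def by blast
qed

lemma subspace_test_forms: "subspace (test_forms M p)"
  unfolding subspace_def
proof (intro conjI ballI allI)
  show "0 \<in> test_forms M p"
    by (rule test_formsI[OF zero_smooth_form, of "{}"]) auto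
next
  fix \<alpha> \<beta> assume *: "\<alpha> \<in> test_forms M p" "\<beta> \<in> test_forms M p"
  show "\<alpha> + \<beta> \<in> test_forms M p"
  proof (rule test_formsI)
    show "\<alpha> + \<beta> \<in> smooth_forms M p"
      using * test_formsD smooth_forms_add by blast
    show "compactin (mtop M) (form_support M \<alpha> \<union> form_support M \<beta>)"
      using * test_form_support(1) compactin_Un by blast
    fix c x assume "(\<alpha> + \<beta>) c x \<noteq> 0"
    then have "\<alpha> c x \<noteq> 0 \<or> \<beta> c x \<noteq> 0"
      by auto
    then show "x \<in> form_support M \<alpha> \<union> form_support M \<beta>"
      using * test_form_support(2) by blast
  qed
next
  fix a \<alpha> assume \<alpha>: "\<alpha> \<in> test_forms M p"
  show "a *\<^sub>R \<alpha> \<in> test_forms M p"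
  proof (rule test_formsI)
    show "a *\<^sub>R \<alpha> \<in> smooth_forms M p"
      using \<alpha> test_formsD subspace_smooth_forms subspace_scale by blast
    show "compactin (mtop M) (form_support M \<alpha>)"
      using \<alpha> by (rule test_form_support)
    fix c x assume "(a *\<^sub>R \<alpha>) c x \<noteq> 0"
    then have "\<alpha> c x \<noteq> 0"
      by auto
    then show "x \<in> form_support M \<alpha>"
      using \<alpha> test_form_support(2) by blast
  qed
qed

lemma closed_formsD: "\<alpha> \<in> closed_forms M p \<Longrightarrow> \<alpha> \<in> smooth_forms M p"
  "\<alpha> \<in> closed_forms M p \<Longrightarrow> ext_deriv M \<alpha> = 0"
  by (simp_all add: closed_forms_def zero_form_eq)

lemma subspace_closed_forms: "subspace (closed_forms M p)"
proof -
  have "ext_deriv M 0 = 0"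
    using ext_deriv_scaleR[OF zero_smooth_form, of 0] by simp
  then show ?thesis
    using subspace_smooth_forms[of p] ext_deriv_add ext_deriv_scaleR
    by (auto simp: subspace_def closed_forms_def zero_form_eq)
qed

lemma subspace_exact_forms: "subspace (exact_forms M p)"
proof (cases p)
  case 0
  then show ?thesis
    by (simp add: exact_forms_def zero_form_eq)
next
  case (Suc q)
  have d0: "ext_deriv M 0 = 0"
    using ext_deriv_scaleR[OF zero_smooth_form, of 0] by simp
  have "exact_forms M p = ext_deriv M ` smooth_forms M q"
    using Suc zero_smooth_form[of q] d0 by (auto simp: exact_forms_def zero_form_eq image_iff)
  then show ?thesis
    using subspace_smooth_forms[of q] d0 unfolding subspace_def
    by (auto simp: ext_deriv_add[symmetric] ext_deriv_scaleR[symmetric] image_iff)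
qed

lemma cohomologous_iff:
  "(\<alpha>, \<beta>) \<in> cohomologous M p \<longleftrightarrow> \<alpha> \<in> closed_forms M p \<and> \<beta> \<in> closed_forms M p \<and> \<alpha> - \<beta> \<in> exact_forms M p"
  by (simp add: cohomologous_def form_lincomb_eq)

lemma equiv_cohomologous: "equiv (closed_forms M p) (cohomologous M p)"
proof (rule equivI)
  show "cohomologous M p \<subseteq> closed_forms M p \<times> closed_forms M p"
    by (auto simp: cohomologous_iff)
  show "refl_on (closed_forms M p) (cohomologous M p)"
    using subspace_0[OF subspace_exact_forms] by (auto simp: refl_on_def cohomologous_iff)
  show "sym (cohomologous M p)"
    using subspace_neg[OF subspace_exact_forms] by (auto simp: sym_def cohomologous_iff) (metis minus_diff_eq)
  show "trans (cohomologous M p)"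
  proof (rule transI)
    fix \<alpha> \<beta> \<gamma> assume "(\<alpha>, \<beta>) \<in> cohomologous M p" "(\<beta>, \<gamma>) \<in> cohomologous M p"
    moreover have "\<alpha> - \<gamma> = (\<alpha> - \<beta>) + (\<beta> - \<gamma>)"
      by simp
    ultimately show "(\<alpha>, \<gamma>) \<in> cohomologous M p"
      using subspace_add[OF subspace_exact_forms] unfolding cohomologous_iff by metis
  qed
qed

lemma in_cohomology_class:
  assumes \<xi>: "\<xi> \<in> cohomology M p" and \<omega>: "\<omega> \<in> \<xi>"
  shows "\<alpha> \<in> \<xi> \<longleftrightarrow> \<omega> \<in> closed_forms M p \<and> \<alpha> \<in> closed_forms M p \<and> \<alpha> - \<omega> \<in> exact_forms M p"
proof -
  have "\<alpha> \<in> \<xi> \<longleftrightarrow> (\<alpha>, \<omega>) \<in> cohomologous M p"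
    using \<xi> \<omega> unfolding cohomology_def
    by (meson equiv_cohomologous in_quotient_imp_closed quotient_eq_iff symD equivE)
  then show ?thesis by (auto simp: cohomologous_iff)
qed

lemma cohomology_class_zero_iff:
  assumes "\<alpha> \<in> closed_forms M p"
  shows "cohomology_class M p \<alpha> = cohomology_class M p zero_form \<longleftrightarrow> \<alpha> \<in> exact_forms M p"
  using eq_equiv_class_iff[OF equiv_cohomologous assms subspace_0[OF subspace_closed_forms]] assms
    subspace_0[OF subspace_closed_forms]
  by (simp add: cohomology_class_def zero_form_eq cohomologous_iff)

end


section \<open>Convergent series of forms\<close>

text \<open>Termwise differentiation, with uniform convergence of the derivatives from the Weierstrass M-test.\<close>

lemma partial_series:
  fixes f :: "nat \<Rightarrow> real ^ 'n \<Rightarrow> 'b::banach"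
  assumes S: "halfspace_open S" and cvx: "convex S" and x: "x \<in> S"
    and f: "\<And>k y. y \<in> S \<Longrightarrow> f k differentiable (at y within S)"
    and B: "\<And>k y. y \<in> S \<Longrightarrow> norm (f k y) \<le> B k" "summable B"
    and B': "\<And>j k y. y \<in> S \<Longrightarrow> norm (partial S j (f k) y) \<le> B' j k" "\<And>j. summable (B' j)"
  shows "(\<lambda>y. \<Sum>k. f k y) differentiable (at x within S)"
    and "partial S j (\<lambda>y. \<Sum>k. f k y) x = (\<Sum>k. partial S j (f k) x)"
proof -
  define f' where "f' k y v = (\<Sum>j\<in>UNIV. (v $ j) *\<^sub>R partial S j (f k) y)" for k y v
  define g' where "g' y v = (\<Sum>j\<in>UNIV. (v $ j) *\<^sub>R (\<Sum>k. partial S j (f k) y))" for y v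
  have summ: "summable (\<lambda>k. f k y)" if "y \<in> S" for y
    using B that by (intro summable_comparison_test'[OF B(2), of 0]) auto
  have D: "(f k has_derivative f' k y) (at y within S)" if "y \<in> S" for k y
    using f[OF that, of k, unfolded frechet_derivative_works]
    by (rule has_derivative_eq_rhs) (simp add: fun_eq_iff f'_def frechet_derivative_partials[OF f[OF that]])
  have "\<exists>g. \<forall>y\<in>S. (\<lambda>k. f k y) sums g y \<and> (g has_derivative g' y) (at y within S)"
  proof (rule has_derivative_series[OF cvx D _ x summable_sums[OF summ[OF x]]])
    fix e :: real assume e: "e > 0"
    let ?N = "real CARD('n)"
    have "\<forall>\<^sub>F n in sequentially. \<forall>j\<in>UNIV. \<forall>y\<in>S.
        norm ((\<Sum>k<n. partial S j (f k) y) - (\<Sum>k. partial S j (f k) y)) < e / ?N"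
    proof (rule eventually_ball_finite[OF finite], rule ballI)
      fix j
      have "uniform_limit S (\<lambda>n y. \<Sum>k<n. partial S j (f k) y) (\<lambda>y. \<Sum>k. partial S j (f k) y) sequentially"
        using B' by (intro Weierstrass_m_test) auto
      from uniform_limitD[OF this, of "e / ?N"] e
      show "\<forall>\<^sub>F n in sequentially. \<forall>y\<in>S.
          norm ((\<Sum>k<n. partial S j (f k) y) - (\<Sum>k. partial S j (f k) y)) < e / ?N"
        by (simp add: dist_norm)
    qed
    then show "\<forall>\<^sub>F n in sequentially. \<forall>y\<in>S. \<forall>v. norm ((\<Sum>k<n. f' k y v) - g' y v) \<le> e * norm v"
    proof eventually_elim
      case (elim n)
      show ?case
      proof (intro ballI allI)
        fix y v assume y: "y \<in> S"
        have "(\<Sum>k<n. f' k y v) - g' y v =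
            (\<Sum>j\<in>UNIV. (v $ j) *\<^sub>R ((\<Sum>k<n. partial S j (f k) y) - (\<Sum>k. partial S j (f k) y)))"
          unfolding f'_def g'_def
          by (subst sum.swap) (simp add: scaleR_sum_right sum_subtractf[symmetric] scaleR_diff_right)
        also have "norm \<dots> \<le> (\<Sum>j\<in>(UNIV :: 'n set). norm v * (e / ?N))"
        proof (rule sum_norm_le)
          fix j
          have "\<bar>v $ j\<bar> * norm ((\<Sum>k<n. partial S j (f k) y) - (\<Sum>k. partial S j (f k) y)) \<le> norm v * (e / ?N)"
            by (rule mult_mono[OF component_le_norm_cart less_imp_le]) (use elim y in auto)
          then show "norm ((v $ j) *\<^sub>R ((\<Sum>k<n. partial S j (f k) y) - (\<Sum>k. partial S j (f k) y))) \<le> norm v * (e / ?N)"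
            by simp
        qed
        also have "\<dots> = e * norm v"
          by simp
        finally show "norm ((\<Sum>k<n. f' k y v) - g' y v) \<le> e * norm v" .
      qed
    qed
  qed
  then obtain g where g: "\<And>y. y \<in> S \<Longrightarrow> (\<lambda>k. f k y) sums g y" "\<And>y. y \<in> S \<Longrightarrow> (g has_derivative g' y) (at y within S)"
    by blast
  have "g y = (\<Sum>k. f k y)" if "y \<in> S" for y
    using g(1)[OF that] by (rule sums_unique)
  then have F: "((\<lambda>y. \<Sum>k. f k y) has_derivative g' x) (at x within S)"
    using g(2)[OF x] x by (metis (no_types, lifting) has_derivative_transform)
  then show "(\<lambda>y. \<Sum>k. f k y) differentiable (at x within S)"
    by (rule differentiableI)
  have "g' x (axis j 1) = (\<Sum>i\<in>UNIV. if i = j then (\<Sum>k. partial S i (f k) x) else 0)"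
    unfolding g'_def by (intro sum.cong) (auto simp: axis_def)
  then show "partial S j (\<lambda>y. \<Sum>k. f k y) x = (\<Sum>k. partial S j (f k) x)"
    using partial_eqI[OF S x F] by simp
qed

lemma smooth_series:
  fixes f :: "nat \<Rightarrow> real ^ 'n \<Rightarrow> 'b::banach"
  assumes S: "halfspace_open S" and cvx: "convex S" and f: "\<And>k. smooth_on S (f k)"
    and B: "\<And>is k y. y \<in> S \<Longrightarrow> norm (partials S is (f k) y) \<le> B is k" "\<And>is. summable (B is)"
  shows "smooth_on S (\<lambda>y. \<Sum>k. f k y)"
    and "x \<in> S \<Longrightarrow> (\<lambda>k. partials S is (f k) x) sums partials S is (\<lambda>y. \<Sum>k. f k y) x"
proof -
  have diff: "partials S is (f k) differentiable (at y within S)" if "y \<in> S" for "is" k y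
    using f that by (simp add: smooth_on_def)
  have B': "norm (partial S j (partials S is (f k)) y) \<le> B (j # is) k" if "y \<in> S" for j "is" k y
    using B(1)[OF that, of "j # is"] by simp
  note series = partial_series[OF S cvx _ diff B B' B(2)]
  have eq: "partials S is (\<lambda>y. \<Sum>k. f k y) y = (\<Sum>k. partials S is (f k) y)" if "y \<in> S" for "is" y
    using that
  proof (induction "is" arbitrary: y)
    case (Cons j "is")
    have "partial S j (partials S is (\<lambda>y. \<Sum>k. f k y)) y = partial S j (\<lambda>y. \<Sum>k. partials S is (f k) y) y"
      using Cons by (intro partial_cong) auto
    then show ?case
      using series(2)[OF Cons.prems, of j "is"] by simp
  qed simp
  show "smooth_on S (\<lambda>y. \<Sum>k. f k y)"
    unfolding smooth_on_def
  proof (intro allI ballI)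
    fix "is" y assume y: "y \<in> S"
    show "partials S is (\<lambda>y. \<Sum>k. f k y) differentiable (at y within S)"
      using series(1)[OF y] eq y by (subst differentiable_cong_within) auto
  qed
  show "(\<lambda>k. partials S is (f k) x) sums partials S is (\<lambda>y. \<Sum>k. f k y) x" if "x \<in> S"
    unfolding eq[OF that] using B that
    by (intro summable_sums summable_comparison_test'[OF B(2)[of "is"], of 0]) auto
qed

text \<open>A diagonal choice: the weight number \<open>k\<close> takes the first \<open>k\<close> sequences into account, so that for each
  sequence all but finitely many terms are bounded by a geometric series.\<close>

lemma summing_weights:
  fixes A :: "'i \<Rightarrow> nat \<Rightarrow> real"
  assumes I: "countable I" and A: "\<And>i k. i \<in> I \<Longrightarrow> 0 \<le> A i k"
  obtains w where "\<And>k. 0 < w k" "summable w" "\<And>i. i \<in> I \<Longrightarrow> summable (\<lambda>k. w k * A i k)"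
proof -
  define J where "J k = {i \<in> I. to_nat_on I i \<le> k}" for k
  have fin: "finite (J k)" for k
  proof -
    have "inj_on (to_nat_on I) (J k)" "to_nat_on I ` J k \<subseteq> {..k}"
      using inj_on_to_nat_on[OF I] by (auto simp: J_def inj_on_def)
    then show ?thesis
      using finite_subset finite_imageD finite_atMost by metis
  qed
  \<comment> \<open>\<open>J k\<close> is finite, and each \<open>i\<close> belongs to \<open>J k\<close> for all large \<open>k\<close>.\<close>
  define w where "w k = (1 / 2) ^ k / (1 + (\<Sum>i\<in>J k. A i k))" for k
  have nonneg: "0 \<le> (\<Sum>i\<in>J k. A i k)" for k
    using A by (intro sum_nonneg) (auto simp: J_def)
  have pos: "0 < w k" for k
    using nonneg[of k] by (simp add: w_def)
  have geo: "summable (\<lambda>k. (1 / 2 :: real) ^ k)"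
    by (simp add: summable_geometric)
  have "w k \<le> (1 / 2) ^ k" for k
    using nonneg[of k] by (simp add: w_def divide_le_eq mult_left_le)
  then have "summable w"
    using pos by (intro summable_comparison_test'[OF geo, of 0]) (simp add: less_imp_le)
  moreover have "summable (\<lambda>k. w k * A i k)" if i: "i \<in> I" for i
  proof (rule summable_comparison_test'[OF geo, of "to_nat_on I i"])
    fix k assume "to_nat_on I i \<le> k"
    then have "i \<in> J k"
      using i by (simp add: J_def)
    then have "A i k \<le> (\<Sum>i\<in>J k. A i k)"
      using A fin by (intro member_le_sum) (auto simp: J_def)
    then have "A i k / (1 + (\<Sum>i\<in>J k. A i k)) \<le> 1"
      using nonneg[of k] by simp
    then have "(1 / 2) ^ k * (A i k / (1 + (\<Sum>i\<in>J k. A i k))) \<le> (1 / 2 :: real) ^ k * 1"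
      by (intro mult_left_mono) auto
    then show "norm (w k * A i k) \<le> (1 / 2) ^ k"
      using nonneg[of k] A[OF i, of k] by (simp add: w_def abs_of_pos)
  qed
  ultimately show ?thesis
    using that pos by blast
qed

lemma jacobian_matrix_openin:
  "openin (top_of_set S) T \<Longrightarrow> y \<in> T \<Longrightarrow> jacobian_matrix T \<tau> y = jacobian_matrix S \<tau> y"
  by (simp add: jacobian_matrix_def grad_def partial_openin vec_eq_iff)

lemma partials_scaleR:
  assumes S: "halfspace_open S" and f: "smooth_on S f" and x: "x \<in> S"
  shows "partials S is (\<lambda>y. a *\<^sub>R f y) x = a *\<^sub>R partials S is f x"
  using x
proof (induction "is" arbitrary: x)
  case (Cons i "is")
  have "partial S i (partials S is (\<lambda>y. a *\<^sub>R f y)) x = partial S i (\<lambda>y. a *\<^sub>R partials S is f y) x"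
    using Cons by (intro partial_cong) auto
  then show ?case
    using partial_scale[OF S Cons.prems smooth_on_partials[OF f]] by simp
qed simp

context smooth_manifold_space
begin

lemma countable_convex_cover:
  "\<exists>\<V> ch K. countable \<V> \<and> \<Union>\<V> = topspace (mtop M) \<and>
    (\<forall>W\<in>\<V>. openin (mtop M) W \<and> ch W \<in> atlas M \<and> W \<subseteq> K W \<and> compactin (mtop M) (K W) \<and>
       K W \<subseteq> cdom (ch W) \<and> convex (cmap (ch W) ` W))"
proof -
  define good where "good W c K \<longleftrightarrow> openin (mtop M) W \<and> c \<in> atlas M \<and> W \<subseteq> K \<and> compactin (mtop M) K \<and>
    K \<subseteq> cdom c \<and> convex (cmap c ` W)" for W and c :: "('a, 'n) chart" and K
  define \<W> where "\<W> = {W. \<exists>c K. good W c K}"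
  have "\<exists>W\<in>\<W>. x \<in> W" if x: "x \<in> topspace (mtop M)" for x
  proof -
    obtain c where c: "c \<in> atlas M" "x \<in> cdom c"
      using x by (rule chart_at)
    obtain W K where "openin (mtop M) W" "x \<in> W" "W \<subseteq> K" "compactin (mtop M) K" "K \<subseteq> cdom c"
      "convex (cmap c ` W)"
      using chart_compact_neighbourhood[OF c] .
    then have "good W c K" "x \<in> W"
      using c by (auto simp: good_def)
    then show ?thesis
      unfolding \<W>_def by blast
  qed
  moreover have op: "openin (mtop M) W" if "W \<in> \<W>" for W
    using that by (auto simp: \<W>_def good_def)
  ultimately have "\<Union>\<W> = topspace (mtop M)"
    using openin_subset by blast
  then obtain \<V> where \<V>: "countable \<V>" "\<V> \<subseteq> \<W>" "\<Union>\<V> = topspace (mtop M)"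
    using second_countable_imp_Lindelof_space[OF second_countable] op unfolding Lindelof_space_def by meson
  have "\<forall>W\<in>\<V>. \<exists>cK. good W (fst cK) (snd cK)"
    using \<V>(2) by (auto simp: \<W>_def)
  then obtain cK where "\<forall>W\<in>\<V>. good W (fst (cK W)) (snd (cK W))"
    using bchoice[of \<V> "\<lambda>W cK. good W (fst cK) (snd cK)"] by blast
  then show ?thesis
    using \<V>(1,3) unfolding good_def
    by (intro exI[of _ \<V>] exI[of _ "\<lambda>W. fst (cK W)"] exI[of _ "\<lambda>W. snd (cK W)"] conjI)
qed

text \<open>The atlas may be uncountable, so weights cannot be adapted to all charts. They are adapted to countably many
  convex pieces of charts that cover \<open>M\<close>, and there the series may be differentiated termwise. In every
  other chart the sum and its exterior derivative are determined by the transformation law, which involves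
  only smooth functions and passes to the limit pointwise.\<close>

lemma smooth_form_series:
  assumes \<beta>: "\<And>k. \<beta> k \<in> smooth_forms M q"
  obtains w \<gamma> where "\<forall>k. 0 < w k" "summable w" "\<gamma> \<in> smooth_forms M q"
    "\<forall>c x. (\<lambda>k. w k *\<^sub>R ext_deriv M (\<beta> k) c x) sums ext_deriv M \<gamma> c x"
proof -
  obtain \<V> ch K where \<V>K: "countable \<V> \<and> \<Union>\<V> = topspace (mtop M) \<and>
    (\<forall>W\<in>\<V>. openin (mtop M) W \<and> ch W \<in> atlas M \<and> W \<subseteq> K W \<and> compactin (mtop M) (K W) \<and>
       K W \<subseteq> cdom (ch W) \<and> convex (cmap (ch W) ` W))"
    using countable_convex_cover by (elim exE) (rule that)
  then have \<V>: "countable \<V>" "\<Union>\<V> = topspace (mtop M)"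
    by simp_all
  have good: "openin (mtop M) W \<and> ch W \<in> atlas M \<and> W \<subseteq> K W \<and> compactin (mtop M) (K W) \<and>
       K W \<subseteq> cdom (ch W) \<and> convex (cmap (ch W) ` W)" if "W \<in> \<V>" for W
    using \<V>K that by simp
  have bound: "\<exists>A\<ge>0. \<forall>x\<in>K W. norm (partials (cimage (ch W)) is (local_form (\<beta> k) (ch W)) (cmap (ch W) x)) \<le> A"
    if W: "W \<in> \<V>" for W "is" k
  proof -
    have c: "ch W \<in> atlas M"
      using good[OF W] by blast
    have "continuous_on (cimage (ch W)) (partials (cimage (ch W)) is (local_form (\<beta> k) (ch W)))"
      by (rule smooth_on_continuous_on[OF smooth_on_partials[OF smooth_formsD(3)[OF \<beta> c]]])
    moreover have "compact (cmap (ch W) ` K W)" "cmap (ch W) ` K W \<subseteq> cimage (ch W)"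
      using compact_cmap_image[OF c] good[OF W] by (auto simp: cimage_def)
    ultimately have "bounded (partials (cimage (ch W)) is (local_form (\<beta> k) (ch W)) ` cmap (ch W) ` K W)"
      by (intro compact_imp_bounded compact_continuous_image) (rule continuous_on_subset)
    then obtain A where "\<forall>v\<in>partials (cimage (ch W)) is (local_form (\<beta> k) (ch W)) ` cmap (ch W) ` K W. norm v \<le> A"
      unfolding bounded_iff by blast
    then show ?thesis
      by (intro exI[of _ "max A 0"]) (simp add: le_max_iff_disj)
  qed
  define A where "A W is k = (SOME A. A \<ge> 0 \<and>
    (\<forall>x\<in>K W. norm (partials (cimage (ch W)) is (local_form (\<beta> k) (ch W)) (cmap (ch W) x)) \<le> A))" for W "is" k
  have A: "0 \<le> A W is k"
    "x \<in> K W \<Longrightarrow> norm (partials (cimage (ch W)) is (local_form (\<beta> k) (ch W)) (cmap (ch W) x)) \<le> A W is k"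
    if "W \<in> \<V>" for W "is" k x
    using someI_ex[OF bound[OF that, of "is" k], folded A_def] by simp_all
  have cnt: "countable (\<V> \<times> (UNIV :: 'n list set))"
    using \<V>(1) by (intro countable_SIGMA) auto
  obtain w where w: "\<And>k. 0 < w k" "summable w"
    and "\<And>i. i \<in> \<V> \<times> (UNIV :: 'n list set) \<Longrightarrow> summable (\<lambda>k. w k * (\<lambda>(W, is). A W is) i k)"
    by (rule summing_weights[OF cnt, of "\<lambda>(W, is). A W is"]) (use A(1) in auto)
  then have wA: "\<And>W is. W \<in> \<V> \<Longrightarrow> summable (\<lambda>k. w k * A W is k)"
    by fastforce
  define F where "F W y = (\<Sum>k. w k *\<^sub>R local_form (\<beta> k) (ch W) y)" for W y
  have F: "smooth_on (cmap (ch W) ` W) (F W)"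
    "\<And>is y. y \<in> cmap (ch W) ` W \<Longrightarrow>
      (\<lambda>k. w k *\<^sub>R partials (cmap (ch W) ` W) is (local_form (\<beta> k) (ch W)) y) sums partials (cmap (ch W) ` W) is (F W) y"
    "halfspace_open (cmap (ch W) ` W)" "openin (top_of_set (cimage (ch W))) (cmap (ch W) ` W)"
    if W: "W \<in> \<V>" for W
  proof -
    let ?V = "cmap (ch W) ` W"
    have c: "ch W \<in> atlas M" and sub: "W \<subseteq> cdom (ch W)"
      using good[OF W] by auto
    show V: "openin (top_of_set (cimage (ch W))) ?V"
      using good[OF W] sub by (intro openin_cmap_image) auto
    show hV: "halfspace_open ?V"
      using halfspace_open_openin[OF halfspace_open_cimage[OF c] V] .
    have sm: "smooth_on ?V (local_form (\<beta> k) (ch W))" for k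
      by (rule smooth_on_openin[OF smooth_formsD(3)[OF \<beta> c] V])
    have sm': "smooth_on ?V (\<lambda>y. w k *\<^sub>R local_form (\<beta> k) (ch W) y)" for k
      by (rule smooth_on_linear[OF hV bounded_linear_scaleR_right sm])
    have bound: "norm (partials ?V is (\<lambda>y. w k *\<^sub>R local_form (\<beta> k) (ch W) y) y) \<le> w k * A W is k"
      if y: "y \<in> ?V" for "is" k y
    proof -
      obtain x where "x \<in> W" "y = cmap (ch W) x"
        using y by blast
      then have "norm (partials (cimage (ch W)) is (local_form (\<beta> k) (ch W)) y) \<le> A W is k"
        using A(2)[OF W] good[OF W] by blast
      then show ?thesis
        using w(1)[of k] by (simp add: partials_scaleR[OF hV sm y] partials_openin[OF V y])
    qed
    have cvx: "convex ?V"
      using good[OF W] by blast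
    show "smooth_on ?V (F W)"
      unfolding F_def by (rule smooth_series(1)[OF hV cvx sm' bound wA[OF W]])
    show "(\<lambda>k. w k *\<^sub>R partials ?V is (local_form (\<beta> k) (ch W)) y) sums partials ?V is (F W) y"
      if y: "y \<in> ?V" for "is" y
    proof -
      have "(\<lambda>k. partials ?V is (\<lambda>y. w k *\<^sub>R local_form (\<beta> k) (ch W) y) y) sums
          partials ?V is (\<lambda>y. \<Sum>k. w k *\<^sub>R local_form (\<beta> k) (ch W) y) y"
        by (rule smooth_series(2)[OF hV cvx sm' bound wA[OF W]]; (assumption | rule y))
      then show ?thesis
        by (simp add: partials_scaleR[OF hV sm y] F_def[abs_def])
    qed
  qed
  define \<gamma> where "\<gamma> c x = (\<Sum>k. w k *\<^sub>R \<beta> k c x)" for c x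
  have cover: "\<exists>W\<in>\<V>. x \<in> W" if "c \<in> atlas M" "x \<in> cdom c" for c x
    using that cdom_subset \<V>(2) by blast
  have sums_chart: "(\<lambda>k. w k *\<^sub>R \<beta> k (ch W) x) sums F W (cmap (ch W) x)" if "W \<in> \<V>" "x \<in> W" for W x
    using F(2)[OF that(1), of "cmap (ch W) x" "[]"] that good[OF that(1)] by (auto simp: local_form_def)
  have sums_transfer: "(\<lambda>k. transpose B *v (w k *\<^sub>R v k)) sums (transpose B *v u)"
    if "(\<lambda>k. w k *\<^sub>R v k) sums u" for B :: "'n set sqmatrix" and v u
    using bounded_linear.sums[OF matrix_vector_mul_bounded_linear that] .
  have scale_tr: "transpose B *v (a *\<^sub>R v) = a *\<^sub>R (transpose B *v v)" for B :: "'n set sqmatrix" and a v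
    by (rule linear_scale[OF matrix_vector_mul_linear])
  have pull: "w k *\<^sub>R \<beta> k c x = transpose (compound (coord_jacobian c (ch W) x)) *v (w k *\<^sub>R \<beta> k (ch W) x)"
    if "c \<in> atlas M" "x \<in> cdom c" "W \<in> \<V>" "x \<in> W" for k c x W
  proof -
    have "ch W \<in> atlas M" "x \<in> cdom (ch W)"
      using that good by blast+
    then have "\<beta> k c x = transpose (compound (coord_jacobian c (ch W) x)) *v \<beta> k (ch W) x"
      using smooth_formsD(4)[OF \<beta> that(1) _ that(2)] by blast
    then show ?thesis
      by (simp only: scale_tr)
  qed
  have sums\<gamma>: "(\<lambda>k. w k *\<^sub>R \<beta> k c x) sums \<gamma> c x" for c x
  proof (cases "c \<in> atlas M \<and> x \<in> cdom c")
    case True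
    then obtain W where W: "W \<in> \<V>" "x \<in> W"
      using cover by blast
    have "(\<lambda>k. transpose (compound (coord_jacobian c (ch W) x)) *v (w k *\<^sub>R \<beta> k (ch W) x)) sums
        (transpose (compound (coord_jacobian c (ch W) x)) *v F W (cmap (ch W) x))"
      by (rule sums_transfer[OF sums_chart[OF W]])
    then have "summable (\<lambda>k. w k *\<^sub>R \<beta> k c x)"
      unfolding pull[OF conjunct1[OF True] conjunct2[OF True] W, symmetric] by (rule sums_summable)
    then show ?thesis
      unfolding \<gamma>_def by (rule summable_sums)
  next
    case False
    then have "\<beta> k c x = 0" for k
      by (rule smooth_formsD(1)[OF \<beta>])
    then show ?thesis
      by (simp add: \<gamma>_def)
  qed
  have \<gamma>F: "\<gamma> (ch W) x = F W (cmap (ch W) x)" if "W \<in> \<V>" "x \<in> W" for W x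
    using sums_unique2[OF sums\<gamma> sums_chart[OF that]] .
  have \<gamma>pull: "\<gamma> c x = transpose (compound (coord_jacobian c c' x)) *v \<gamma> c' x"
    if xc: "c \<in> atlas M" "c' \<in> atlas M" "x \<in> cdom c" "x \<in> cdom c'" for c c' x
  proof -
    have "w k *\<^sub>R \<beta> k c x = transpose (compound (coord_jacobian c c' x)) *v (w k *\<^sub>R \<beta> k c' x)" for k
      using smooth_formsD(4)[OF \<beta> xc, of k] by (simp only: scale_tr)
    then have "(\<lambda>k. w k *\<^sub>R \<beta> k c x) sums (transpose (compound (coord_jacobian c c' x)) *v \<gamma> c' x)"
      using sums_transfer[OF sums\<gamma>, of "compound (coord_jacobian c c' x)" c' x] by (simp only:)
    then show ?thesis
      by (rule sums_unique2[OF sums\<gamma>])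
  qed
  have \<gamma>: "\<gamma> \<in> smooth_forms M q"
  proof (rule smooth_formsI)
    show "\<gamma> c x = 0" if "\<not> (c \<in> atlas M \<and> x \<in> cdom c)" for c x
      using smooth_formsD(1)[OF \<beta> that] by (simp add: \<gamma>_def)
    show "\<gamma> c x \<in> multivectors q" for c x
    proof -
      have sumsJ: "(\<lambda>k. (w k *\<^sub>R \<beta> k c x) $ J) sums (\<gamma> c x $ J)" for J
        by (rule bounded_linear.sums[OF bounded_linear_vec_nth sums\<gamma>])
      have zeroJ: "(\<lambda>k. (w k *\<^sub>R \<beta> k c x) $ J) = (\<lambda>k. 0)" if "card J \<noteq> q" for J
        using smooth_formsD(2)[OF \<beta>, of _ c x] that by (simp add: multivectors_def fun_eq_iff)
      have "(\<lambda>k. 0) sums (\<gamma> c x $ J)" if "card J \<noteq> q" for J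
        using sumsJ[of J] unfolding zeroJ[OF that] .
      then have "\<gamma> c x $ J = 0" if "card J \<noteq> q" for J
        using sums_unique2[OF _ sums_zero] that by blast
      then show ?thesis
        by (simp add: multivectors_def)
    qed
    show "smooth_on (cimage c) (local_form \<gamma> c)" if c: "c \<in> atlas M" for c
    proof (rule smooth_on_local)
      fix y assume y: "y \<in> cimage c"
      then obtain W where W: "W \<in> \<V>" "cinv c y \<in> W"
        using cover[OF c] cinv_in_cdom by blast
      have c': "ch W \<in> atlas M" "W \<subseteq> cdom (ch W)" "openin (mtop M) W"
        using good[OF W(1)] by auto
      let ?T = "cmap c ` (W \<inter> cdom c)" and ?O = "overlap c (ch W)" and ?\<tau> = "transition c (ch W)"
      have T: "openin (top_of_set (cimage c)) ?T"
        using c' openin_cdom[OF c] by (intro openin_cmap_image[OF c]) auto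
      have TO: "?T \<subseteq> ?O"
        using c' by (auto simp: overlap_def)
      have TO': "openin (top_of_set ?O) ?T"
        using T TO openin_imp_subset[OF openin_overlap[OF c c'(1)]] openin_subset_trans by blast
      have hT: "halfspace_open ?T"
        using halfspace_open_openin[OF halfspace_open_cimage[OF c] T] .
      have \<tau>: "smooth_on ?T ?\<tau>"
        by (rule smooth_on_openin[OF smooth_on_transition[OF c c'(1)] TO'])
      have "?\<tau> ` ?T \<subseteq> cmap (ch W) ` W"
        using c by (auto simp: transition_def)
      then have "smooth_on ?T (\<lambda>z. F W (?\<tau> z))"
        using smooth_on_compose[OF hT _ \<tau> F(1)[OF W(1)]] by blast
      then have "smooth_on ?T (\<lambda>z. transpose (compound (jacobian_matrix ?T ?\<tau> z)) *v F W (?\<tau> z))"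
        by (rule smooth_on_pullback[OF hT \<tau>])
      moreover have "transpose (compound (jacobian_matrix ?T ?\<tau> z)) *v F W (?\<tau> z) = local_form \<gamma> c z"
        if z: "z \<in> ?T" for z
      proof -
        obtain x where x: "x \<in> W" "x \<in> cdom c" "z = cmap c x"
          using z by blast
        then have "x \<in> cdom (ch W)"
          using c' by blast
        then have "local_form \<gamma> c z = transpose (compound (jacobian_matrix ?O ?\<tau> z)) *v F W (?\<tau> z)"
          using \<gamma>pull[OF c c'(1) x(2)] \<gamma>F[OF W(1) x(1)] coord_jacobian_eq[OF c c'(1), of x] x c
          by (simp add: local_form_def transition_def)
        then show ?thesis
          using jacobian_matrix_openin[OF TO' z] by simp
      qed
      ultimately have "smooth_on ?T (local_form \<gamma> c)"
        using smooth_on_cong[of ?T "\<lambda>z. transpose (compound (jacobian_matrix ?T ?\<tau> z)) *v F W (?\<tau> z)"] by blast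
      moreover have "y \<in> ?T"
        using W(2) y by (intro image_eqI[of _ _ "cinv c y"]) auto
      ultimately show "\<exists>T. openin (top_of_set (cimage c)) T \<and> y \<in> T \<and> smooth_on T (local_form \<gamma> c)"
        using T by blast
    qed
  qed (rule \<gamma>pull)
  have d: "ext_deriv M \<gamma> \<in> smooth_forms M (Suc q)" "ext_deriv M (\<beta> k) \<in> smooth_forms M (Suc q)" for k
    using ext_deriv_smooth_closed[OF \<gamma>] ext_deriv_smooth_closed[OF \<beta>] closed_formsD by blast+
  have d_chart: "(\<lambda>k. w k *\<^sub>R ext_deriv M (\<beta> k) (ch W) x) sums ext_deriv M \<gamma> (ch W) x"
    if W: "W \<in> \<V>" and x: "x \<in> W" for W x
  proof -
    let ?V = "cmap (ch W) ` W" and ?y = "cmap (ch W) x"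
    have c: "ch W \<in> atlas M" "x \<in> cdom (ch W)" and sub: "W \<subseteq> cdom (ch W)"
      using good[OF W] x by auto
    have y: "?y \<in> ?V"
      using x by blast
    have in_chart: "ext_deriv M \<alpha> (ch W) x = (\<chi> J. \<Sum>j\<in>J. (- 1) ^ card {i \<in> J. i < j} * partial ?V j f ?y $ (J - {j}))"
      if f: "smooth_on ?V f" and eq: "\<And>z. z \<in> ?V \<Longrightarrow> local_form \<alpha> (ch W) z = f z" for \<alpha> f
    proof -
      have "ext_deriv M \<alpha> (ch W) x = coord_ext_deriv ?V (local_form \<alpha> (ch W)) ?y"
        using c y by (simp add: ext_deriv_in_chart coord_ext_deriv_openin[OF F(4)[OF W]])
      also have "\<dots> = coord_ext_deriv ?V f ?y"
        using eq y by (rule coord_ext_deriv_cong)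
      finally show ?thesis
        by (simp add: coord_ext_deriv_def partial_component[OF F(3)[OF W] y f])
    qed
    have g: "ext_deriv M \<gamma> (ch W) x = (\<chi> J. \<Sum>j\<in>J. (- 1) ^ card {i \<in> J. i < j} * partial ?V j (F W) ?y $ (J - {j}))"
      using sub by (intro in_chart F(1)[OF W]) (auto simp: local_form_def \<gamma>F[OF W] c)
    have b: "ext_deriv M (\<beta> k) (ch W) x =
        (\<chi> J. \<Sum>j\<in>J. (- 1) ^ card {i \<in> J. i < j} * partial ?V j (local_form (\<beta> k) (ch W)) ?y $ (J - {j}))" for k
      by (intro in_chart smooth_on_openin[OF smooth_formsD(3)[OF \<beta> c(1)] F(4)[OF W]]) simp
    have comp: "(\<lambda>k. (w k *\<^sub>R ext_deriv M (\<beta> k) (ch W) x) $ J) sums (ext_deriv M \<gamma> (ch W) x $ J)" for J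
    proof -
      have "(\<lambda>k. w k * (partial ?V j (local_form (\<beta> k) (ch W)) ?y $ I)) sums (partial ?V j (F W) ?y $ I)" for j I
        using bounded_linear.sums[OF bounded_linear_vec_nth F(2)[OF W y, of "[j]"], of I] by simp
      then have "(\<lambda>k. \<Sum>j\<in>J. (- 1) ^ card {i \<in> J. i < j} * (w k * (partial ?V j (local_form (\<beta> k) (ch W)) ?y $ (J - {j}))))
          sums (\<Sum>j\<in>J. (- 1) ^ card {i \<in> J. i < j} * (partial ?V j (F W) ?y $ (J - {j})))"
        by (intro sums_sum sums_mult)
      then show ?thesis
        by (simp add: g b sum_distrib_left mult_ac)
    qed
    then show ?thesis
      unfolding sums_def by (intro vec_tendstoI) (simp add: sums_def)
  qed
  have "(\<lambda>k. w k *\<^sub>R ext_deriv M (\<beta> k) c x) sums ext_deriv M \<gamma> c x" for c x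
  proof (cases "c \<in> atlas M \<and> x \<in> cdom c")
    case True
    then obtain W where W: "W \<in> \<V>" "x \<in> W"
      using cover by blast
    have c': "ch W \<in> atlas M" "x \<in> cdom (ch W)"
      using good[OF W(1)] W by auto
    have "ext_deriv M \<alpha> c x = transpose (compound (coord_jacobian c (ch W) x)) *v ext_deriv M \<alpha> (ch W) x"
      if "ext_deriv M \<alpha> \<in> smooth_forms M (Suc q)" for \<alpha>
      using smooth_formsD(4)[OF that] True c' by blast
    then have "ext_deriv M \<gamma> c x = transpose (compound (coord_jacobian c (ch W) x)) *v ext_deriv M \<gamma> (ch W) x"
      and "ext_deriv M (\<beta> k) c x = transpose (compound (coord_jacobian c (ch W) x)) *v ext_deriv M (\<beta> k) (ch W) x" for k
      using d by blast+
    then have "ext_deriv M \<gamma> c x = transpose (compound (coord_jacobian c (ch W) x)) *v ext_deriv M \<gamma> (ch W) x"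
      "w k *\<^sub>R ext_deriv M (\<beta> k) c x = transpose (compound (coord_jacobian c (ch W) x)) *v (w k *\<^sub>R ext_deriv M (\<beta> k) (ch W) x)"
      for k
      by (simp_all only: scale_tr)
    then show ?thesis
      using sums_transfer[OF d_chart[OF W]] by (simp only:)
  qed (simp add: ext_deriv_outside)
  then show ?thesis
    using that w \<gamma> by blast
qed

end


section \<open>Structure currents\<close>

text \<open>Normalisation maps the compact base \<open>L\<^sup>-\<^sup>1(1) \<inter> C\<close> onto the set of unit vectors.\<close>

lemma compact_unit_vectors:
  assumes "compact_convex_cone C"
  shows "compact (unit_vectors C)"
proof -
  obtain L :: "_ \<Rightarrow> real" where cone: "convex_cone C" and L: "bounded_linear L" "\<And>v. v \<in> C \<Longrightarrow> v \<noteq> 0 \<Longrightarrow> 0 < L v"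
    and cpt: "compact (L -` {1} \<inter> C)"
    using assms unfolding compact_convex_cone_def by blast
  interpret L: bounded_linear L by fact
  have scale: "a *\<^sub>R v \<in> C" if "0 \<le> a" "v \<in> C" for a v
    using cone that unfolding convex_cone_def conic_def by blast
  have "unit_vectors C = (\<lambda>v. inverse (norm v) *\<^sub>R v) ` (L -` {1} \<inter> C)"
  proof (intro equalityI subsetI)
    fix v assume "v \<in> unit_vectors C"
    then have v: "v \<in> C" "norm v = 1" "v \<noteq> 0"
      by (auto simp: unit_vectors_def)
    then have "0 < L v"
      using L by blast
    then show "v \<in> (\<lambda>v. inverse (norm v) *\<^sub>R v) ` (L -` {1} \<inter> C)"
      using v scale[of "inverse (L v)" v] by (intro image_eqI[of _ _ "inverse (L v) *\<^sub>R v"]) (auto simp: L.scaleR)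
  next
    fix v assume "v \<in> (\<lambda>v. inverse (norm v) *\<^sub>R v) ` (L -` {1} \<inter> C)"
    then obtain u where u: "u \<in> C" "L u = 1" "v = inverse (norm u) *\<^sub>R u"
      by auto
    then have "u \<noteq> 0"
      using L.zero by auto
    then show "v \<in> unit_vectors C"
      using u scale[of "inverse (norm u)" u] by (simp add: unit_vectors_def)
  qed
  moreover have "continuous_on (L -` {1} \<inter> C) (\<lambda>v. inverse (norm v) *\<^sub>R v)"
    using L.zero by (intro continuous_intros) auto
  ultimately show ?thesis
    using cpt compact_continuous_image by metis
qed

locale cone_structure_space = smooth_manifold_space M
  for M :: "('a, 'n::{finite,linorder}) manifold" +
  fixes p :: nat and X Z :: "'a set" and C :: "('a, 'n) cone_field"
  assumes cone_structure: "cone_structure M p X Z C"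
    and compact_X: "compactin (mtop M) X" and compact_Z: "compactin (mtop M) Z" and ZX: "Z \<subseteq> X"
begin

lemma compact_convex_cone_C: "c \<in> atlas M \<Longrightarrow> x \<in> cdom c \<Longrightarrow> x \<in> X - Z \<Longrightarrow> compact_convex_cone (C c x)"
  using cone_structure unfolding cone_structure_def by blast

lemma C_transition: "c \<in> atlas M \<Longrightarrow> c' \<in> atlas M \<Longrightarrow> x \<in> cdom c \<Longrightarrow> x \<in> cdom c' \<Longrightarrow> x \<in> X - Z \<Longrightarrow>
    C c' x = (\<lambda>v. compound (coord_jacobian c c' x) *v v) ` C c x"
  using cone_structure unfolding cone_structure_def by blast

lemma unit_vector_in_C:
  assumes "c \<in> atlas M" "x \<in> cdom c" "x \<in> X - Z" "v \<in> C c x" "v \<noteq> 0"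
  shows "inverse (norm v) *\<^sub>R v \<in> unit_vectors (C c x)"
  using compact_convex_cone_C[OF assms(1-3)] assms(4,5)
  by (simp add: compact_convex_cone_def convex_cone_def conic_def unit_vectors_def)

text \<open>The pairing of a form with a vector does not depend on the chart, so positivity need only be checked in
  one.\<close>

lemma pos_transfer:
  assumes \<alpha>: "\<alpha> \<in> smooth_forms M p" and x: "x \<in> X - Z" and c: "c \<in> atlas M" "x \<in> cdom c"
    and pos: "\<And>v. v \<in> C c x \<Longrightarrow> v \<noteq> 0 \<Longrightarrow> 0 < \<alpha> c x \<bullet> v"
    and c': "c' \<in> atlas M" "x \<in> cdom c'" and v': "v' \<in> C c' x" "v' \<noteq> 0"
  shows "0 < \<alpha> c' x \<bullet> v'"
proof -
  let ?B = "compound (coord_jacobian c c' x)"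
  obtain v where v: "v \<in> C c x" "v' = ?B *v v"
    using C_transition[OF c(1) c'(1) c(2) c'(2) x] v' by blast
  have "v \<noteq> 0"
    using v v' by auto
  have "\<alpha> c x \<bullet> v = (transpose ?B *v \<alpha> c' x) \<bullet> v"
    using smooth_formsD(4)[OF \<alpha> c(1) c'(1) c(2) c'(2)] by simp
  also have "\<dots> = \<alpha> c' x \<bullet> v'"
    unfolding transpose_matrix_vector dot_lmul_matrix v(2) ..
  finally show ?thesis
    using pos[OF v(1) \<open>v \<noteq> 0\<close>] by simp
qed

text \<open>The unit vectors of the cone at \<open>x\<close> form a compact set, on which \<open>\<alpha>\<close> has a positive lower bound, and by
  continuity of the cones and of \<open>\<alpha>\<close> half of it remains a lower bound nearby.\<close>

lemma local_lower_bound: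
  assumes \<alpha>: "\<alpha> \<in> smooth_forms M p" and x: "x \<in> X - Z"
    and pos: "\<And>c v. c \<in> atlas M \<Longrightarrow> x \<in> cdom c \<Longrightarrow> v \<in> C c x \<Longrightarrow> v \<noteq> 0 \<Longrightarrow> 0 < \<alpha> c x \<bullet> v"
  shows "\<exists>c \<delta> W K. c \<in> atlas M \<and> 0 < \<delta> \<and> openin (mtop M) W \<and> x \<in> W \<and> W \<subseteq> K \<and> compactin (mtop M) K \<and> K \<subseteq> cdom c \<and>
    (\<forall>y\<in>W \<inter> (X - Z). \<forall>v\<in>unit_vectors (C c y). \<delta> \<le> \<alpha> c y \<bullet> v)"
proof -
  have "\<forall>x\<in>X - Z. \<exists>c\<in>atlas M. x \<in> cdom c \<and>
       (\<forall>\<epsilon>>0. \<exists>W. openin (mtop M) W \<and> x \<in> W \<and>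
          (\<forall>y\<in>W \<inter> cdom c \<inter> (X - Z).
             (\<forall>v\<in>unit_vectors (C c y). \<exists>w\<in>unit_vectors (C c x). dist v w < \<epsilon>) \<and>
             (\<forall>w\<in>unit_vectors (C c x). \<exists>v\<in>unit_vectors (C c y). dist v w < \<epsilon>)))"
    using cone_structure unfolding cone_structure_def by (elim conjE)
  from bspec[OF this x] obtain c where c: "c \<in> atlas M" "x \<in> cdom c"
    and cont0: "\<forall>\<epsilon>>0. \<exists>W. openin (mtop M) W \<and> x \<in> W \<and>
          (\<forall>y\<in>W \<inter> cdom c \<inter> (X - Z).
             (\<forall>v\<in>unit_vectors (C c y). \<exists>w\<in>unit_vectors (C c x). dist v w < \<epsilon>) \<and>
             (\<forall>w\<in>unit_vectors (C c x). \<exists>v\<in>unit_vectors (C c y). dist v w < \<epsilon>))"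
    by (elim bexE conjE) (rule that)
  have "\<exists>m>0. \<forall>w\<in>unit_vectors (C c x). m \<le> \<alpha> c x \<bullet> w"
  proof (cases "unit_vectors (C c x) = {}")
    case False
    have "continuous_on (unit_vectors (C c x)) (\<lambda>w. \<alpha> c x \<bullet> w)"
      by (intro continuous_intros)
    then obtain w where w: "w \<in> unit_vectors (C c x)" "\<forall>v\<in>unit_vectors (C c x). \<alpha> c x \<bullet> w \<le> \<alpha> c x \<bullet> v"
      using continuous_attains_inf[OF compact_unit_vectors[OF compact_convex_cone_C[OF c x]] False] by blast
    then have "w \<in> C c x" "w \<noteq> 0"
      by (auto simp: unit_vectors_def)
    then have "0 < \<alpha> c x \<bullet> w"
      using pos[OF c] by blast
    then show ?thesis
      using w by blast
  qed (auto intro: exI[of _ 1])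
  then obtain m where m: "m > 0" "\<And>w. w \<in> unit_vectors (C c x) \<Longrightarrow> m \<le> \<alpha> c x \<bullet> w"
    by blast
  define N where "N = norm (\<alpha> c x) + 1"
  have N: "0 < N" "norm (\<alpha> c x) \<le> N"
    by (auto simp: N_def add_nonneg_pos)
  have "0 < m / (4 * N)"
    using m N by simp
  \<comment> \<open>With this accuracy the change of the vector costs at most \<open>m / 4\<close>; another \<open>m / 4\<close> is left for the change of \<open>\<alpha>\<close>.\<close>
  from cont0[rule_format, OF this] obtain W1 where "openin (mtop M) W1" "x \<in> W1"
    and "\<forall>y\<in>W1 \<inter> cdom c \<inter> (X - Z).
             (\<forall>v\<in>unit_vectors (C c y). \<exists>w\<in>unit_vectors (C c x). dist v w < m / (4 * N)) \<and>
             (\<forall>w\<in>unit_vectors (C c x). \<exists>v\<in>unit_vectors (C c y). dist v w < m / (4 * N))"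
    by (elim exE conjE) (rule that)
  then have W1: "openin (mtop M) W1" "x \<in> W1"
    "\<And>y v. y \<in> W1 \<Longrightarrow> y \<in> cdom c \<Longrightarrow> y \<in> X - Z \<Longrightarrow> v \<in> unit_vectors (C c y) \<Longrightarrow>
       \<exists>w\<in>unit_vectors (C c x). dist v w < m / (4 * N)"
    by simp_all
  define V where "V = cimage c \<inter> local_form \<alpha> c -` ball (\<alpha> c x) (m / 4)"
  define W2 where "W2 = {y \<in> cdom c. cmap c y \<in> V}"
  have "openin (top_of_set (cimage c)) V"
    unfolding V_def
    by (rule continuous_openin_preimage_gen[OF smooth_on_continuous_on[OF smooth_formsD(3)[OF \<alpha> c(1)]] open_ball])
  then have W2: "openin (mtop M) W2"
    unfolding W2_def by (rule openin_cmap_vimage[OF c(1)])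
  have "x \<in> W2"
    using c m by (simp add: W2_def V_def local_form_def)
  obtain W3 K where W3: "openin (mtop M) W3" "x \<in> W3" "W3 \<subseteq> K" "compactin (mtop M) K" "K \<subseteq> cdom c"
    using chart_compact_neighbourhood[OF c] .
  define W where "W = W1 \<inter> W2 \<inter> W3"
  have "m / 2 \<le> \<alpha> c y \<bullet> v" if y: "y \<in> W" "y \<in> X - Z" and v: "v \<in> unit_vectors (C c y)" for y v
  proof -
    have yc: "y \<in> cdom c" and near: "norm (\<alpha> c y - \<alpha> c x) < m / 4"
      using y c(1) by (auto simp: W_def W2_def V_def local_form_def dist_norm norm_minus_commute)
    obtain w where w: "w \<in> unit_vectors (C c x)" "norm (v - w) < m / (4 * N)"
      using W1(3)[OF _ yc y(2) v] y(1) by (auto simp: W_def dist_norm)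
    have "\<bar>\<alpha> c x \<bullet> (v - w)\<bar> \<le> norm (\<alpha> c x) * norm (v - w)"
      by (rule Cauchy_Schwarz_ineq2)
    also have "\<dots> \<le> N * (m / (4 * N))"
      using N w by (intro mult_mono) auto
    also have "\<dots> = m / 4"
      using N by simp
    finally have 1: "- (m / 4) \<le> \<alpha> c x \<bullet> (v - w)"
      by linarith
    have "\<bar>(\<alpha> c y - \<alpha> c x) \<bullet> v\<bar> \<le> norm (\<alpha> c y - \<alpha> c x) * norm v"
      by (rule Cauchy_Schwarz_ineq2)
    then have 2: "- (m / 4) \<le> (\<alpha> c y - \<alpha> c x) \<bullet> v"
      using near v by (simp add: unit_vectors_def)
    have "\<alpha> c y \<bullet> v = \<alpha> c x \<bullet> w + \<alpha> c x \<bullet> (v - w) + (\<alpha> c y - \<alpha> c x) \<bullet> v"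
      by (simp add: inner_diff_right inner_diff_left)
    then show ?thesis
      using 1 2 m(2)[OF w(1)] by linarith
  qed
  moreover have "openin (mtop M) W" "x \<in> W" "W \<subseteq> K"
    using W1 W2 W3 \<open>x \<in> W2\<close> by (auto simp: W_def)
  ultimately show ?thesis
    using c(1) W3(4,5) m(1) by (intro exI[of _ c] exI[of _ "m / 2"] exI[of _ W] exI[of _ K]) auto
qed

text \<open>The cone \<open>\<O>\<^sub>U\<close> is open with respect to uniform convergence on finitely many compact sets. These
  come from covering the compact set \<open>X - U\<close> by neighbourhoods with a uniform lower bound; it is disjoint
  from \<open>Z\<close>, where nothing is required of the cones.\<close>

lemma O_cone_open:
  assumes U: "openin (mtop M) U" "Z \<subseteq> U" and e: "e \<in> O_cone M p X C U"
  obtains F \<delta> where "finite F" "0 < \<delta>" "\<forall>c K. (c, K) \<in> F \<longrightarrow> c \<in> atlas M \<and> compactin (mtop M) K \<and> K \<subseteq> cdom c"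
    "\<forall>\<eta>\<in>test_forms M p. (\<forall>(c, K)\<in>F. \<forall>x\<in>K. norm (\<eta> c x) < \<delta>) \<longrightarrow> e + \<eta> \<in> O_cone M p X C U"
proof -
  have e': "e \<in> test_forms M p" "e \<in> smooth_forms M p" and pos: "pos_on M C (X - U) e"
    using e test_formsD by (auto simp: O_cone_def)
  define good where "good W c K \<delta> \<longleftrightarrow> c \<in> atlas M \<and> (0::real) < \<delta> \<and> openin (mtop M) W \<and> W \<subseteq> K \<and>
    compactin (mtop M) K \<and> K \<subseteq> cdom c \<and>
    (\<forall>y\<in>W \<inter> (X - Z). \<forall>v\<in>unit_vectors (C c y). \<delta> \<le> e c y \<bullet> v)" for W c K \<delta>
  define \<W> where "\<W> = {W. \<exists>c K \<delta>. good W c K \<delta>}"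
  have "\<exists>W\<in>\<W>. x \<in> W" if x: "x \<in> X - U" for x
  proof -
    have xXZ: "x \<in> X - Z"
      using x U(2) by blast
    have pos_x: "0 < e c x \<bullet> v" if "c \<in> atlas M" "x \<in> cdom c" "v \<in> C c x" "v \<noteq> 0" for c v
      using pos x that unfolding pos_on_def by blast
    have "\<exists>c \<delta> W K. c \<in> atlas M \<and> 0 < \<delta> \<and> openin (mtop M) W \<and> x \<in> W \<and> W \<subseteq> K \<and>
        compactin (mtop M) K \<and> K \<subseteq> cdom c \<and> (\<forall>y\<in>W \<inter> (X - Z). \<forall>v\<in>unit_vectors (C c y). \<delta> \<le> e c y \<bullet> v)"
      by (rule local_lower_bound[OF e'(2) xXZ]) (rule pos_x)
    then obtain c \<delta> W K where "c \<in> atlas M \<and> 0 < \<delta> \<and> openin (mtop M) W \<and> x \<in> W \<and> W \<subseteq> K \<and>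
        compactin (mtop M) K \<and> K \<subseteq> cdom c \<and> (\<forall>y\<in>W \<inter> (X - Z). \<forall>v\<in>unit_vectors (C c y). \<delta> \<le> e c y \<bullet> v)"
      by (elim exE) (rule that)
    then have "good W c K \<delta>" "x \<in> W"
      by (simp_all add: good_def)
    then show ?thesis
      unfolding \<W>_def by blast
  qed
  then have cov: "X - U \<subseteq> \<Union>\<W>"
    by blast
  have XU: "compactin (mtop M) (X - U)"
  proof -
    have "closedin (mtop M) (topspace (mtop M) - U)"
      by (rule closedin_diff[OF closedin_topspace U(1)])
    then have "compactin (mtop M) (X \<inter> (topspace (mtop M) - U))"
      by (rule compact_Int_closedin[OF compact_X])
    moreover have "X \<inter> (topspace (mtop M) - U) = X - U"
      using compactin_subset_topspace[OF compact_X] by blast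
    ultimately show ?thesis by simp
  qed
  have W_open: "openin (mtop M) W" if "W \<in> \<W>" for W
    using that unfolding \<W>_def good_def by blast
  from compactinD[OF XU W_open cov]
  have "\<exists>\<F>. finite \<F> \<and> \<F> \<subseteq> \<W> \<and> X - U \<subseteq> \<Union>\<F>"
    by simp
  then obtain \<F> where \<F>: "finite \<F>" "\<F> \<subseteq> \<W>" "X - U \<subseteq> \<Union>\<F>"
    by (elim exE conjE) (rule that)
  have "\<forall>W\<in>\<F>. \<exists>cK\<delta>. good W (fst cK\<delta>) (fst (snd cK\<delta>)) (snd (snd cK\<delta>))"
  proof
    fix W assume "W \<in> \<F>"
    then obtain c K \<delta> where "good W c K \<delta>"
      using \<F>(2) unfolding \<W>_def by blast
    then show "\<exists>cK\<delta>. good W (fst cK\<delta>) (fst (snd cK\<delta>)) (snd (snd cK\<delta>))"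
      by (intro exI[of _ "(c, K, \<delta>)"]) simp
  qed
  then obtain h where h: "\<And>W. W \<in> \<F> \<Longrightarrow> good W (fst (h W)) (fst (snd (h W))) (snd (snd (h W)))"
    using bchoice[of \<F> "\<lambda>W cK\<delta>. good W (fst cK\<delta>) (fst (snd cK\<delta>)) (snd (snd cK\<delta>))"] by blast
  define F where "F = (\<lambda>W. (fst (h W), fst (snd (h W)))) ` \<F>"
  define \<delta> where "\<delta> = Min (insert 1 ((\<lambda>W. snd (snd (h W))) ` \<F>))"
  have \<delta>: "0 < \<delta>" "\<And>W. W \<in> \<F> \<Longrightarrow> \<delta> \<le> snd (snd (h W))"
    using \<F>(1) h by (auto simp: \<delta>_def good_def)
  have O: "e + \<eta> \<in> O_cone M p X C U"
    if \<eta>: "\<eta> \<in> test_forms M p" and small: "\<forall>(c, K)\<in>F. \<forall>x\<in>K. norm (\<eta> c x) < \<delta>" for \<eta>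
  proof -
    have sum: "e + \<eta> \<in> test_forms M p"
      by (rule subspace_add[OF subspace_test_forms e'(1) \<eta>])
    have "0 < (e + \<eta>) c' x \<bullet> v'"
      if c': "c' \<in> atlas M" "x \<in> cdom c'" and x: "x \<in> X - U" and v': "v' \<in> C c' x" "v' \<noteq> 0" for c' x v'
    proof -
      obtain W where W: "W \<in> \<F>" "x \<in> W"
        using \<F>(3) x by blast
      define c K d where "c = fst (h W)" and "K = fst (snd (h W))" and "d = snd (snd (h W))"
      have g: "c \<in> atlas M" "x \<in> cdom c" "x \<in> K" and xXZ: "x \<in> X - Z"
        and low: "\<And>v. v \<in> unit_vectors (C c x) \<Longrightarrow> d \<le> e c x \<bullet> v"
      proof -
        have g: "good W c K d"
          using h[OF W(1)] by (simp add: c_def K_def d_def)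
        show "x \<in> X - Z"
          using x U(2) by blast
        then show "\<And>v. v \<in> unit_vectors (C c x) \<Longrightarrow> d \<le> e c x \<bullet> v"
          using g W(2) unfolding good_def by blast
        show "c \<in> atlas M" "x \<in> cdom c" "x \<in> K"
          using g W(2) unfolding good_def by blast+
      qed
      have "(c, K) \<in> F"
        using W(1) by (auto simp: F_def c_def K_def)
      then have "norm (\<eta> c x) < \<delta>"
        using small g(3) by fast
      then have nd: "norm (\<eta> c x) < d"
        using \<delta>(2)[OF W(1)] by (simp add: d_def)
      have "0 < (e + \<eta>) c x \<bullet> v" if v: "v \<in> C c x" "v \<noteq> 0" for v
      proof -
        let ?u = "inverse (norm v) *\<^sub>R v"
        have u: "?u \<in> unit_vectors (C c x)"
          by (rule unit_vector_in_C[OF g(1,2) xXZ v])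
        have "\<bar>\<eta> c x \<bullet> ?u\<bar> \<le> norm (\<eta> c x) * norm ?u"
          by (rule Cauchy_Schwarz_ineq2)
        then have "- norm (\<eta> c x) \<le> \<eta> c x \<bullet> ?u"
          using v(2) by simp
        then have "0 < (e + \<eta>) c x \<bullet> ?u"
          unfolding plus_fun_apply inner_add_left using low[OF u] nd by linarith
        then show ?thesis
          using v(2) by (simp add: zero_less_mult_iff)
      qed
      then show ?thesis
        by (rule pos_transfer[OF test_formsD[OF sum] xXZ g(1,2) _ c' v'])
    qed
    then show ?thesis
      using sum by (auto simp: O_cone_def pos_on_def)
  qed
  show ?thesis
  proof (rule that[of F \<delta>])
    show "finite F"
      using \<F>(1) by (simp add: F_def)
    show "0 < \<delta>"
      by (rule \<delta>(1))
    show "\<forall>c K. (c, K) \<in> F \<longrightarrow> c \<in> atlas M \<and> compactin (mtop M) K \<and> K \<subseteq> cdom c"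
    proof (intro allI impI)
      fix c K assume cK: "(c, K) \<in> F"
      obtain W where "W \<in> \<F>" "c = fst (h W)" "K = fst (snd (h W))"
        using cK by (auto simp: F_def)
      then show "c \<in> atlas M \<and> compactin (mtop M) K \<and> K \<subseteq> cdom c"
        using h[of W] by (simp add: good_def)
    qed
    show "\<forall>\<eta>\<in>test_forms M p. (\<forall>(c, K)\<in>F. \<forall>x\<in>K. norm (\<eta> c x) < \<delta>) \<longrightarrow> e + \<eta> \<in> O_cone M p X C U"
      by (rule ballI, rule impI, rule O)
  qed
qed

lemma form_bounded_on_compact:
  assumes \<alpha>: "\<alpha> \<in> smooth_forms M p" and c: "c \<in> atlas M" and K: "compactin (mtop M) K" "K \<subseteq> cdom c"
  shows "\<exists>b\<ge>0. \<forall>x\<in>K. norm (\<alpha> c x) \<le> b"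
proof -
  have "cmap c ` K \<subseteq> cimage c"
    using K by (auto simp: cimage_def)
  then have "continuous_on (cmap c ` K) (local_form \<alpha> c)"
    by (rule continuous_on_subset[OF smooth_on_continuous_on[OF smooth_formsD(3)[OF \<alpha> c]]])
  then have "bounded (local_form \<alpha> c ` cmap c ` K)"
    using compact_cmap_image[OF c K] by (intro compact_imp_bounded compact_continuous_image)
  then obtain b where B: "\<forall>v\<in>local_form \<alpha> c ` cmap c ` K. norm v \<le> b"
    unfolding bounded_iff by (elim exE) (rule that)
  have b: "norm (local_form \<alpha> c (cmap c x)) \<le> b" if "x \<in> K" for x
    by (rule bspec[OF B imageI[OF imageI[OF that]]])
  have "norm (\<alpha> c x) \<le> b" if "x \<in> K" for x
    using b[OF that] subsetD[OF K(2) that] c by (simp add: local_form_def)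
  then show ?thesis
    by (intro exI[of _ "max b 0"]) (simp add: le_max_iff_disj)
qed

text \<open>A test form is bounded on the compact sets that control \<open>\<O>\<^sub>U\<close>, so a small multiple of it can be added.\<close>

lemma O_cone_core:
  assumes U: "openin (mtop M) U" "Z \<subseteq> U" and e: "e \<in> O_cone M p X C U" and \<eta>: "\<eta> \<in> test_forms M p"
  shows "\<exists>t>0. e + t *\<^sub>R \<eta> \<in> O_cone M p X C U"
proof -
  obtain F \<delta> where F0: "finite F" "0 < \<delta>" "\<forall>c K. (c, K) \<in> F \<longrightarrow> c \<in> atlas M \<and> compactin (mtop M) K \<and> K \<subseteq> cdom c"
    and O0: "\<forall>\<eta>\<in>test_forms M p. (\<forall>(c, K)\<in>F. \<forall>x\<in>K. norm (\<eta> c x) < \<delta>) \<longrightarrow> e + \<eta> \<in> O_cone M p X C U"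
    by (rule O_cone_open[OF U e])
  note F = F0(1,2) F0(3)[THEN spec, THEN spec, THEN mp] and O = O0[THEN bspec, THEN mp]
  have "\<forall>i\<in>F. \<exists>b\<ge>0. \<forall>x\<in>snd i. norm (\<eta> (fst i) x) \<le> b"
    using form_bounded_on_compact[OF test_formsD[OF \<eta>]] F(3) by auto
  then obtain b where b: "\<And>i. i \<in> F \<Longrightarrow> 0 \<le> b i \<and> (\<forall>x\<in>snd i. norm (\<eta> (fst i) x) \<le> b i)"
    using bchoice[of F "\<lambda>i b. 0 \<le> b \<and> (\<forall>x\<in>snd i. norm (\<eta> (fst i) x) \<le> b)"] by blast
  define B where "B = (\<Sum>i\<in>F. b i) + 1"
  have Bpos: "0 < B"
    using b by (auto simp: B_def intro!: add_nonneg_pos sum_nonneg)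
  define t where "t = \<delta> / (2 * B)"
  have t: "0 < t"
    using F(2) Bpos by (simp add: t_def)
  have "norm ((t *\<^sub>R \<eta>) c x) < \<delta>" if "(c, K) \<in> F" "x \<in> K" for c K x
  proof -
    have "norm (\<eta> c x) \<le> b (c, K)"
      using b[OF that(1)] that(2) by auto
    also have "\<dots> \<le> (\<Sum>i\<in>F. b i)"
      using that(1) b F(1) by (intro member_le_sum) auto
    finally have "norm (\<eta> c x) \<le> B"
      by (simp add: B_def)
    then have "t * norm (\<eta> c x) \<le> t * B"
      using t by (intro mult_left_mono) auto
    also have "\<dots> < \<delta>"
      using F(2) Bpos by (simp add: t_def)
    finally show ?thesis
      using t by simp
  qed
  then have "\<forall>(c, K)\<in>F. \<forall>x\<in>K. norm ((t *\<^sub>R \<eta>) c x) < \<delta>"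
    by blast
  then have "e + t *\<^sub>R \<eta> \<in> O_cone M p X C U"
    by (rule O[OF subspace_scale[OF subspace_test_forms \<eta>]])
  then show ?thesis
    using t by blast
qed

lemma O_cone_add: "\<alpha> \<in> O_cone M p X C U \<Longrightarrow> \<beta> \<in> O_cone M p X C U \<Longrightarrow> \<alpha> + \<beta> \<in> O_cone M p X C U"
  using subspace_add[OF subspace_test_forms] by (auto simp: O_cone_def pos_on_def inner_add_left intro: add_pos_pos)

lemma O_cone_scale: "0 < a \<Longrightarrow> \<alpha> \<in> O_cone M p X C U \<Longrightarrow> a *\<^sub>R \<alpha> \<in> O_cone M p X C U"
  using subspace_scale[OF subspace_test_forms] by (auto simp: O_cone_def pos_on_def)

lemma A_cone_iff:
  "\<alpha> \<in> A_cone M p X Z C U \<longleftrightarrow> \<alpha> \<in> test_forms M p \<and> \<alpha> \<in> closed_forms M p \<and> \<alpha> \<in> exact_forms M p \<and>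
    vanishes_on Z \<alpha> \<and> nonneg_on M C (X \<inter> mtop M closure_of U - Z) \<alpha>"
  using cohomology_class_zero_iff[of \<alpha> p] test_formsD[of \<alpha> p]
  by (auto simp: A_cone_def closed_forms_def)

lemma A_cone_add: "\<alpha> \<in> A_cone M p X Z C U \<Longrightarrow> \<beta> \<in> A_cone M p X Z C U \<Longrightarrow> \<alpha> + \<beta> \<in> A_cone M p X Z C U"
  using subspace_add[OF subspace_test_forms] subspace_add[OF subspace_closed_forms] subspace_add[OF subspace_exact_forms]
  by (auto simp: A_cone_iff vanishes_on_def nonneg_on_def inner_add_left)

lemma A_cone_scale: "0 < a \<Longrightarrow> \<alpha> \<in> A_cone M p X Z C U \<Longrightarrow> a *\<^sub>R \<alpha> \<in> A_cone M p X Z C U"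
  using subspace_scale[OF subspace_test_forms] subspace_scale[OF subspace_closed_forms] subspace_scale[OF subspace_exact_forms]
  by (auto simp: A_cone_iff vanishes_on_def nonneg_on_def)

lemma A_cone_zero: "0 \<in> A_cone M p X Z C U"
  using subspace_0[OF subspace_test_forms] subspace_0[OF subspace_closed_forms] subspace_0[OF subspace_exact_forms]
  by (auto simp: A_cone_iff vanishes_on_def nonneg_on_def)

text \<open>If \<open>\<eta>\<close> is so small on the controlling compact sets that \<open>e \<plusminus> (1 / s) \<eta> \<in> \<O>\<^sub>U\<close>, positivity of \<open>T\<close> gives
  \<open>\<bar>T \<eta>\<bar> < s T e\<close>. So \<open>T\<close> is continuous, even with respect to uniform convergence on these sets.\<close>

lemma positive_functional_current:
  assumes U: "openin (mtop M) U" "Z \<subseteq> U" and e: "e \<in> O_cone M p X C U"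
    and lin: "\<And>a b \<alpha> \<beta>. \<alpha> \<in> test_forms M p \<Longrightarrow> \<beta> \<in> test_forms M p \<Longrightarrow> T (a *\<^sub>R \<alpha> + b *\<^sub>R \<beta>) = a * T \<alpha> + b * T \<beta>"
    and pos: "\<And>\<alpha>. \<alpha> \<in> O_cone M p X C U \<Longrightarrow> 0 < T \<alpha>"
  shows "current M p T"
proof -
  let ?G = "{{\<beta> \<in> test_forms M p. \<forall>x\<in>K.
        norm (partials (cimage c) is (\<lambda>y. \<beta> c (cinv c y)) (cmap c x)
            - partials (cimage c) is (\<lambda>y. \<alpha> c (cinv c y)) (cmap c x)) < \<epsilon>} | \<alpha> c K is \<epsilon>.
      \<alpha> \<in> test_forms M p \<and> c \<in> atlas M \<and> compactin (mtop M) K \<and> K \<subseteq> cdom c \<and> 0 < \<epsilon>}"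
  have Cinf: "Cinf_topology M p = topology_generated_by ?G"
    by (simp add: Cinf_topology_def)
  have top: "topspace (Cinf_topology M p) \<subseteq> test_forms M p"
    unfolding Cinf topology_generated_by_topspace by blast
  obtain F \<delta> where F0: "finite F" "0 < \<delta>" "\<forall>c K. (c, K) \<in> F \<longrightarrow> c \<in> atlas M \<and> compactin (mtop M) K \<and> K \<subseteq> cdom c"
    and O0: "\<forall>\<eta>\<in>test_forms M p. (\<forall>(c, K)\<in>F. \<forall>x\<in>K. norm (\<eta> c x) < \<delta>) \<longrightarrow> e + \<eta> \<in> O_cone M p X C U"
    by (rule O_cone_open[OF U e])
  note F = F0(1,2) F0(3)[THEN spec, THEN spec, THEN mp] and O = O0[THEN bspec, THEN mp]
  have e': "e \<in> test_forms M p" and Te: "0 < T e"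
    using e pos by (auto simp: O_cone_def)
  have bound: "\<bar>T \<eta>\<bar> < s * T e"
    if \<eta>: "\<eta> \<in> test_forms M p" and s: "0 < s" and small: "\<And>c K x. (c, K) \<in> F \<Longrightarrow> x \<in> K \<Longrightarrow> norm (\<eta> c x) < s * \<delta>" for \<eta> s
  proof -
    have "0 < T e + (\<sigma> / s) * T \<eta>" if \<sigma>: "\<bar>\<sigma>\<bar> = 1" for \<sigma>
    proof -
      have "norm (((\<sigma> / s) *\<^sub>R \<eta>) c x) < \<delta>" if "(c, K) \<in> F" "x \<in> K" for c K x
        using small[OF that] s \<sigma> by (simp add: field_simps)
      then have "\<forall>(c, K)\<in>F. \<forall>x\<in>K. norm (((\<sigma> / s) *\<^sub>R \<eta>) c x) < \<delta>"
        by blast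
      then have "e + (\<sigma> / s) *\<^sub>R \<eta> \<in> O_cone M p X C U"
        by (rule O[OF subspace_scale[OF subspace_test_forms \<eta>]])
      then have "0 < T (1 *\<^sub>R e + (\<sigma> / s) *\<^sub>R \<eta>)"
        using pos by simp
      then show ?thesis
        using lin[OF e' \<eta>, of 1 "\<sigma> / s"] by simp
    qed
    from this[of 1] this[of "- 1"] show ?thesis
      using s by (auto simp: field_simps abs_less_iff)
  qed
  have "continuous_map (Cinf_topology M p) euclideanreal T"
    unfolding continuous_map_def
  proof (intro conjI allI impI)
    fix V :: "real set" assume "openin euclidean V"
    then have V: "open V"
      by simp
    show "openin (Cinf_topology M p) {\<alpha> \<in> topspace (Cinf_topology M p). T \<alpha> \<in> V}"
    proof (subst openin_subopen, intro ballI)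
      fix \<alpha> assume "\<alpha> \<in> {\<alpha> \<in> topspace (Cinf_topology M p). T \<alpha> \<in> V}"
      then have \<alpha>: "\<alpha> \<in> topspace (Cinf_topology M p)" "\<alpha> \<in> test_forms M p" "T \<alpha> \<in> V"
        using top by auto
      obtain r where r: "r > 0" "ball (T \<alpha>) r \<subseteq> V"
        using V \<alpha>(3) open_contains_ball by blast
      define s where "s = r / T e"
      have s: "0 < s" "s * T e = r"
        using r Te by (auto simp: s_def)
      define Q where "Q i = {\<beta> \<in> test_forms M p. \<forall>x\<in>snd i.
        norm (partials (cimage (fst i)) [] (\<lambda>y. \<beta> (fst i) (cinv (fst i) y)) (cmap (fst i) x)
            - partials (cimage (fst i)) [] (\<lambda>y. \<alpha> (fst i) (cinv (fst i) y)) (cmap (fst i) x)) < s * \<delta>}" for i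
      have Q_open: "openin (Cinf_topology M p) (Q i)" if i: "i \<in> F" for i
      proof -
        have "Q i \<in> ?G"
          unfolding Q_def using F(3)[of "fst i" "snd i"] i \<alpha>(2) F(2) s(1)
          by (intro CollectI exI[of _ \<alpha>] exI[of _ "fst i"] exI[of _ "snd i"] exI[of _ "[]"] exI[of _ "s * \<delta>"]) simp
        then show ?thesis
          unfolding Cinf by (rule topology_generated_by_Basis)
      qed
      let ?Q = "(\<Inter>i\<in>F. Q i) \<inter> topspace (Cinf_topology M p)"
      have "openin (Cinf_topology M p) ?Q"
        by (rule openin_INT[OF F(1) Q_open])
      moreover have "\<alpha> \<in> ?Q"
        using \<alpha> F(2) s(1) by (simp add: Q_def)
      moreover have "T \<beta> \<in> V" if \<beta>: "\<beta> \<in> ?Q" for \<beta>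
      proof -
        have \<beta>': "\<beta> \<in> test_forms M p"
          using \<beta> top by blast
        have diff: "\<beta> - \<alpha> \<in> test_forms M p"
          by (rule subspace_diff[OF subspace_test_forms \<beta>' \<alpha>(2)])
        have "norm ((\<beta> - \<alpha>) c x) < s * \<delta>" if "(c, K) \<in> F" "x \<in> K" for c K x
        proof -
          have "\<beta> \<in> Q (c, K)" "c \<in> atlas M" "x \<in> cdom c"
            using \<beta> that F(3)[OF that(1)] by auto
          then show ?thesis
            using that(2) by (auto simp: Q_def)
        qed
        then have "\<bar>T (\<beta> - \<alpha>)\<bar> < r"
          using bound[OF diff s(1)] s(2) by simp
        moreover have "T (\<beta> - \<alpha>) = T \<beta> - T \<alpha>"
          using lin[OF \<beta>' \<alpha>(2), of 1 "- 1"] by simp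
        ultimately show ?thesis
          using r(2) by (auto simp: dist_real_def abs_minus_commute)
      qed
      ultimately show "\<exists>Q. openin (Cinf_topology M p) Q \<and> \<alpha> \<in> Q \<and> Q \<subseteq> {\<alpha> \<in> topspace (Cinf_topology M p). T \<alpha> \<in> V}"
        by (intro exI[of _ ?Q]) auto
    qed
  qed simp
  from continuous_map_from_subtopology[OF this] show ?thesis
    unfolding current_def form_lincomb_eq using lin by simp
qed

text \<open>If \<open>\<O>\<^sub>U\<close> missed \<open>\<omega> + \<A>\<^bsub>U,0\<^esub>\<close>, it would also miss the convex cone generated by \<open>\<omega>\<close> and \<open>\<A>\<^bsub>U,0\<^esub>\<close>, and
  a functional separating the two cones would be a structure cycle that is not positive on \<open>\<omega>\<close>.\<close>

lemma O_cone_meets_A_cone_translate: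
  assumes U: "openin (mtop M) U" "Z \<subseteq> U" and \<omega>: "\<omega> \<in> test_forms M p"
    and cycles: "\<And>T. structure_cycle M p X Z C U T \<Longrightarrow> 0 < T \<omega>"
  shows "\<exists>\<alpha>. \<alpha> \<in> O_cone M p X C U \<and> \<alpha> - \<omega> \<in> A_cone M p X Z C U"
proof (rule ccontr)
  assume neg: "\<not> ?thesis"
  \<comment> \<open>If \<open>\<O>\<^sub>U\<close> were empty, the zero functional would be a structure cycle.\<close>
  have O_ne: "O_cone M p X C U \<noteq> {}"
  proof
    assume "O_cone M p X C U = {}"
    then have "structure_cycle M p X Z C U (\<lambda>\<alpha>. 0)"
      by (simp add: structure_cycle_def structure_current_def current_def)
    from cycles[OF this] show False by simp
  qed
  then obtain e where e: "e \<in> O_cone M p X C U"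
    by blast
  have avoid: "\<omega> + a \<notin> O_cone M p X C U" if "a \<in> A_cone M p X Z C U" for a
  proof
    assume "\<omega> + a \<in> O_cone M p X C U"
    moreover have "\<omega> + a - \<omega> \<in> A_cone M p X Z C U"
      using that by simp
    ultimately show False
      using neg by blast
  qed
  define N where "N = {t *\<^sub>R \<omega> + a | t a. 0 \<le> t \<and> a \<in> A_cone M p X Z C U}"
  have NI: "t *\<^sub>R \<omega> + a \<in> N" if "0 \<le> t" "a \<in> A_cone M p X Z C U" for t a
    unfolding N_def using that by blast
  have A_test: "\<And>a. a \<in> A_cone M p X Z C U \<Longrightarrow> a \<in> test_forms M p"
    by (simp add: A_cone_iff)
  have disj: "O_cone M p X C U \<inter> N = {}"
  proof (rule ccontr)
    assume "O_cone M p X C U \<inter> N \<noteq> {}"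
    then obtain t a where ta: "0 \<le> t" "a \<in> A_cone M p X Z C U" "t *\<^sub>R \<omega> + a \<in> O_cone M p X C U"
      by (auto simp: N_def)
    \<comment> \<open>A multiple of \<open>\<omega>\<close> can be added when \<open>t = 0\<close>, since \<open>\<O>\<^sub>U\<close> is open.\<close>
    obtain s where s: "0 < s" "s *\<^sub>R \<omega> + a \<in> O_cone M p X C U"
    proof (cases "t = 0")
      case True
      then have "a \<in> O_cone M p X C U"
        using ta(3) by simp
      from O_cone_core[OF U this \<omega>] obtain s where "0 < s" "a + s *\<^sub>R \<omega> \<in> O_cone M p X C U"
        by (elim exE conjE)
      then show ?thesis
        using that[of s] by (simp only: add.commute[of a])
    next
      case False
      then show ?thesis
        using ta that[of t] by simp
    qed
    have "(1 / s) *\<^sub>R (s *\<^sub>R \<omega> + a) \<in> O_cone M p X C U" "(1 / s) *\<^sub>R a \<in> A_cone M p X Z C U"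
      using s ta by (auto intro!: O_cone_scale A_cone_scale)
    then show False
      using avoid[of "(1 / s) *\<^sub>R a"] s(1) by (simp add: scaleR_add_right)
  qed
  have O_test: "O_cone M p X C U \<subseteq> test_forms M p"
    by (auto simp: O_cone_def)
  have N_test: "N \<subseteq> test_forms M p"
  proof
    fix x assume "x \<in> N"
    then obtain t a where "x = t *\<^sub>R \<omega> + a" "a \<in> A_cone M p X Z C U"
      by (auto simp: N_def)
    then show "x \<in> test_forms M p"
      using subspace_add[OF subspace_test_forms subspace_scale[OF subspace_test_forms \<omega>] A_test] by simp
  qed
  have N_zero: "0 \<in> N"
    using NI[of 0 0] A_cone_zero by simp
  have N_add: "x + y \<in> N" if "x \<in> N" "y \<in> N" for x y
  proof -
    obtain s a where "x = s *\<^sub>R \<omega> + a" "0 \<le> s" "a \<in> A_cone M p X Z C U"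
      using \<open>x \<in> N\<close> by (auto simp: N_def)
    moreover obtain t b where "y = t *\<^sub>R \<omega> + b" "0 \<le> t" "b \<in> A_cone M p X Z C U"
      using \<open>y \<in> N\<close> by (auto simp: N_def)
    ultimately show ?thesis
      using NI[of "s + t" "a + b"] A_cone_add by (simp add: scaleR_add_left algebra_simps)
  qed
  have N_scale: "r *\<^sub>R x \<in> N" if "0 < r" "x \<in> N" for r x
  proof -
    obtain s a where "x = s *\<^sub>R \<omega> + a" "0 \<le> s" "a \<in> A_cone M p X Z C U"
      using \<open>x \<in> N\<close> by (auto simp: N_def)
    then show ?thesis
      using NI[of "r * s" "r *\<^sub>R a"] A_cone_scale \<open>0 < r\<close> by (simp add: scaleR_add_right)
  qed
  have "\<exists>T :: ('a, 'n) form \<Rightarrow> real.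
      (\<forall>x\<in>test_forms M p. \<forall>y\<in>test_forms M p. \<forall>a b. T (a *\<^sub>R x + b *\<^sub>R y) = a * T x + b * T y) \<and>
      (\<forall>x\<in>O_cone M p X C U. 0 < T x) \<and> (\<forall>x\<in>N. T x \<le> 0)"
    by (rule cone_separation[OF subspace_test_forms O_test _ _ _ N_test N_zero _ _ disj e])
      (erule (1) O_cone_add, erule (1) O_cone_scale, erule (1) O_cone_core[OF U], erule (1) N_add, erule (1) N_scale)
  then obtain T :: "('a, 'n) form \<Rightarrow> real" where
    T0: "\<forall>x\<in>test_forms M p. \<forall>y\<in>test_forms M p. \<forall>a b. T (a *\<^sub>R x + b *\<^sub>R y) = a * T x + b * T y"
      "\<forall>x\<in>O_cone M p X C U. 0 < T x" "\<forall>x\<in>N. T x \<le> 0"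
    by (elim exE conjE) (rule that)
  note T = T0(1)[THEN bspec, THEN bspec, THEN spec, THEN spec] T0(2,3)[THEN bspec]
  have T_A: "T a \<le> 0" if a: "a \<in> A_cone M p X Z C U" for a
  proof -
    have "0 *\<^sub>R \<omega> + a \<in> N"
      by (rule NI[OF order_refl a])
    from T(3)[OF this] show ?thesis by simp
  qed
  have "current M p T"
    by (rule positive_functional_current[OF U e]) (rule T(1), assumption+, rule T(2), assumption)
  then have "structure_cycle M p X Z C U T"
    unfolding structure_cycle_def structure_current_def using T0(2) T_A by blast
  then have "0 < T \<omega>"
    by (rule cycles)
  moreover have "1 *\<^sub>R \<omega> + 0 \<in> N"
    by (rule NI[OF zero_le_one A_cone_zero])
  from T(3)[OF this] have "T \<omega> \<le> 0"
    by simp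
  ultimately show False by simp
qed

end


section \<open>Relatively transversal forms\<close>

context cone_structure_space
begin

lemma neighbourhood_with_small_closure:
  assumes V: "openin (mtop M) V" "Z \<subseteq> V"
  shows "\<exists>U. openin (mtop M) U \<and> Z \<subseteq> U \<and> mtop M closure_of U \<subseteq> V"
proof -
  have "disjnt Z (topspace (mtop M) - V)"
    using V(2) by (auto simp: disjnt_def)
  from regular_space_compact_closed_separation[OF regular compact_Z closedin_diff[OF closedin_topspace V(1)] this]
  obtain U W where UW: "openin (mtop M) U" "openin (mtop M) W" "Z \<subseteq> U" "topspace (mtop M) - V \<subseteq> W" "disjnt U W"
    by (elim exE conjE) (rule that)
  have "mtop M closure_of U \<subseteq> topspace (mtop M) - W"
  proof (rule closure_of_minimal)
    show "U \<subseteq> topspace (mtop M) - W"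
      using openin_subset[OF UW(1)] UW(5) by (auto simp: disjnt_iff)
    show "closedin (mtop M) (topspace (mtop M) - W)"
      by (rule closedin_diff[OF closedin_topspace UW(2)])
  qed
  also have "\<dots> \<subseteq> V"
    using UW(4) by blast
  finally show ?thesis
    using UW by blast
qed

lemma transversal_imp_positive:
  assumes \<xi>: "\<xi> \<in> cohomology M p" and \<alpha>: "\<alpha> \<in> \<xi>" "rel_transversal M p X Z C \<alpha>"
    and U: "Z \<subseteq> U" and \<omega>: "\<omega> \<in> representatives_near M p (mtop M closure_of U) \<xi>"
    and U_top: "U \<subseteq> topspace (mtop M)"
    and T: "structure_cycle M p X Z C U T"
  shows "0 < T \<omega>"
proof -
  obtain V where V: "mtop M closure_of U \<subseteq> V" "vanishes_on V \<omega>"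
    and \<omega>': "\<omega> \<in> \<xi>" "\<omega> \<in> test_forms M p"
    using \<omega> by (auto simp: representatives_near_def)
  have \<alpha>': "\<alpha> \<in> test_forms M p" "pos_on M C (X - Z) \<alpha>" "vanishes_on Z \<alpha>"
    using \<alpha>(2) by (simp_all add: rel_transversal_def)
  have UV: "U \<subseteq> V"
    using closure_of_subset[OF U_top] V(1) by blast
  have coh: "\<omega> \<in> closed_forms M p" "\<alpha> \<in> closed_forms M p" "\<alpha> - \<omega> \<in> exact_forms M p"
    using in_cohomology_class[OF \<xi> \<omega>'(1), of \<alpha>] \<alpha>(1) by simp_all
  have "\<alpha> \<in> O_cone M p X C U"
    using \<alpha>' U by (auto simp: O_cone_def pos_on_def)
  then have T\<alpha>: "0 < T \<alpha>"
    using T by (simp add: structure_cycle_def structure_current_def)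
  have "\<alpha> - \<omega> \<in> A_cone M p X Z C U"
    unfolding A_cone_iff
  proof (intro conjI)
    show "\<alpha> - \<omega> \<in> test_forms M p"
      by (rule subspace_diff[OF subspace_test_forms \<alpha>'(1) \<omega>'(2)])
    show "\<alpha> - \<omega> \<in> closed_forms M p"
      by (rule subspace_diff[OF subspace_closed_forms coh(2,1)])
    show "\<alpha> - \<omega> \<in> exact_forms M p"
      by (rule coh)
    show "vanishes_on Z (\<alpha> - \<omega>)"
      unfolding vanishes_on_def
    proof (intro ballI allI)
      fix x c assume x: "x \<in> Z"
      then have "x \<in> V"
        using U UV by blast
      then show "(\<alpha> - \<omega>) c x = 0"
        using \<alpha>'(3) V(2) x by (simp add: vanishes_on_def)
    qed
    show "nonneg_on M C (X \<inter> mtop M closure_of U - Z) (\<alpha> - \<omega>)"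
      unfolding nonneg_on_def
    proof (intro ballI)
      fix c x v assume c: "c \<in> atlas M" and x: "x \<in> cdom c \<inter> (X \<inter> mtop M closure_of U - Z)" and v: "v \<in> C c x"
      have "x \<in> V"
        using x V(1) by blast
      then have "\<omega> c x = 0"
        using V(2) by (simp add: vanishes_on_def)
      moreover have "0 \<le> \<alpha> c x \<bullet> v"
      proof (cases "v = 0")
        case False
        have "x \<in> cdom c \<inter> (X - Z)"
          using x by blast
        then show ?thesis
          using \<alpha>'(2) c v False unfolding pos_on_def by (meson less_imp_le)
      qed simp
      ultimately show "0 \<le> (\<alpha> - \<omega>) c x \<bullet> v"
        by simp
    qed
  qed
  then have "T (\<alpha> - \<omega>) \<le> 0"
    using T by (simp add: structure_cycle_def)
  moreover have "T (form_lincomb 1 \<alpha> (- 1) \<omega>) = 1 * T \<alpha> + (- 1) * T \<omega>"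
    using T \<alpha>'(1) \<omega>'(2) unfolding structure_cycle_def structure_current_def current_def by blast
  then have "T (\<alpha> - \<omega>) = T \<alpha> - T \<omega>"
    by (simp add: form_lincomb_eq)
  ultimately show ?thesis
    using T\<alpha> by linarith
qed

text \<open>On \<open>X - U\<close> the form is positive as a member of \<open>\<O>\<^sub>U\<close>, and on \<open>U - Z\<close> it agrees with a member of
  \<open>\<A>\<^bsub>U,0\<^esub>\<close> because \<open>\<omega>\<close> vanishes there.\<close>

lemma partially_transversal_form:
  assumes \<xi>: "\<xi> \<in> cohomology M p"
    and U: "openin (mtop M) U" "Z \<subseteq> U" and \<omega>: "\<omega> \<in> representatives_near M p (mtop M closure_of U) \<xi>"
    and cycles: "\<And>T. structure_cycle M p X Z C U T \<Longrightarrow> 0 < T \<omega>"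
  shows "\<exists>\<alpha>\<in>\<xi>. \<alpha> \<in> test_forms M p \<and> vanishes_on Z \<alpha> \<and> nonneg_on M C (X - Z) \<alpha> \<and> pos_on M C (X - U) \<alpha>"
proof -
  obtain V where V: "mtop M closure_of U \<subseteq> V" "vanishes_on V \<omega>"
    and \<omega>': "\<omega> \<in> \<xi>" "\<omega> \<in> test_forms M p"
    using \<omega> by (auto simp: representatives_near_def)
  have UV: "U \<subseteq> V"
    using closure_of_subset[OF openin_subset[OF U(1)]] V(1) by blast
  have "\<exists>\<alpha>. \<alpha> \<in> O_cone M p X C U \<and> \<alpha> - \<omega> \<in> A_cone M p X Z C U"
    by (rule O_cone_meets_A_cone_translate[OF U \<omega>'(2)]) (rule cycles)
  then obtain \<alpha> where \<alpha>: "\<alpha> \<in> O_cone M p X C U" "\<alpha> - \<omega> \<in> A_cone M p X Z C U"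
    by (elim exE conjE) (rule that)
  have A: "\<alpha> - \<omega> \<in> closed_forms M p" "\<alpha> - \<omega> \<in> exact_forms M p" "vanishes_on Z (\<alpha> - \<omega>)"
    "nonneg_on M C (X \<inter> mtop M closure_of U - Z) (\<alpha> - \<omega>)"
    using \<alpha>(2) by (simp_all add: A_cone_iff)
  have \<alpha>O: "\<alpha> \<in> test_forms M p" "pos_on M C (X - U) \<alpha>"
    using \<alpha>(1) by (simp_all add: O_cone_def)
  have "\<omega> \<in> closed_forms M p"
    using in_cohomology_class[OF \<xi> \<omega>'(1), of \<omega>] \<omega>'(1) by simp
  then have "\<alpha> \<in> closed_forms M p"
    using subspace_add[OF subspace_closed_forms A(1)] by fastforce
  then have "\<alpha> \<in> \<xi>"
    using in_cohomology_class[OF \<xi> \<omega>'(1), of \<alpha>] A(2) \<open>\<omega> \<in> closed_forms M p\<close> by simp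
  moreover have "vanishes_on Z \<alpha>"
    unfolding vanishes_on_def
  proof (intro ballI allI)
    fix x c assume x: "x \<in> Z"
    then have "x \<in> V"
      using U UV by blast
    then have "\<omega> c x = 0"
      using V(2) by (simp add: vanishes_on_def)
    moreover have "(\<alpha> - \<omega>) c x = 0"
      using A(3) x by (simp add: vanishes_on_def)
    ultimately show "\<alpha> c x = 0"
      by simp
  qed
  moreover have "nonneg_on M C (X - Z) \<alpha>"
    unfolding nonneg_on_def
  proof (intro ballI)
    fix c x v assume c: "c \<in> atlas M" and x: "x \<in> cdom c \<inter> (X - Z)" and v: "v \<in> C c x"
    show "0 \<le> \<alpha> c x \<bullet> v"
    proof (cases "x \<in> U")
      case True
      then have "\<omega> c x = 0"
        using V(2) UV by (auto simp: vanishes_on_def)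
      moreover have "x \<in> cdom c \<inter> (X \<inter> mtop M closure_of U - Z)"
        using x True closure_of_subset[OF openin_subset[OF U(1)]] by blast
      then have "0 \<le> (\<alpha> - \<omega>) c x \<bullet> v"
        using A(4) c v unfolding nonneg_on_def by blast
      ultimately show ?thesis
        by simp
    next
      case False
      then have "x \<in> cdom c \<inter> (X - U)"
        using x by blast
      then have "v \<noteq> 0 \<longrightarrow> 0 < \<alpha> c x \<bullet> v"
        using \<alpha>O(2) c v unfolding pos_on_def by blast
      then show ?thesis
        by (cases "v = 0") auto
    qed
  qed
  ultimately show ?thesis
    using \<alpha>O by blast
qed

text \<open>Each point of \<open>X - Z\<close> has a neighbourhood disjoint from some admissible \<open>U\<close>, and \<open>X - Z\<close> is a Lindelof
  space.\<close>

lemma countable_punctured_cover: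
  assumes U0: "openin (mtop M) U0" "Z \<subseteq> U0"
  shows "\<exists>U :: nat \<Rightarrow> 'a set. (\<forall>k. openin (mtop M) (U k) \<and> Z \<subseteq> U k \<and> U k \<subseteq> U0) \<and> (\<forall>x\<in>X - Z. \<exists>k. x \<notin> U k)"
proof -
  define good where "good N U \<longleftrightarrow> openin (mtop M) U \<and> Z \<subseteq> U \<and> U \<subseteq> U0 \<and> N \<inter> U = {}" for N U
  define \<N> where "\<N> = {N. openin (mtop M) N \<and> (\<exists>U. good N U)}"
  have top: "X - Z \<subseteq> topspace (mtop M)"
    using compactin_subset_topspace[OF compact_X] by blast
  have "\<exists>N\<in>\<N>. x \<in> N" if x: "x \<in> X - Z" for x
  proof -
    have "openin (mtop M) (topspace (mtop M) - {x})"
      using top x by (intro openin_diff openin_topspace closedin_Hausdorff_singleton[OF Hausdorff]) auto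
    moreover have "Z \<subseteq> topspace (mtop M) - {x}"
      using x compactin_subset_topspace[OF compact_Z] by blast
    ultimately have "\<exists>U. openin (mtop M) U \<and> Z \<subseteq> U \<and> mtop M closure_of U \<subseteq> topspace (mtop M) - {x}"
      by (rule neighbourhood_with_small_closure)
    then obtain U where U: "openin (mtop M) U" "Z \<subseteq> U" "mtop M closure_of U \<subseteq> topspace (mtop M) - {x}"
      by (elim exE conjE) (rule that)
    let ?N = "topspace (mtop M) - mtop M closure_of U"
    have "?N \<inter> U = {}"
      using closure_of_subset[OF openin_subset[OF U(1)]] by blast
    then have "good ?N (U \<inter> U0)"
      using U U0 by (auto simp: good_def)
    moreover have "openin (mtop M) ?N" "x \<in> ?N"
      using U(3) x top closedin_closure_of[of "mtop M" U] by blast+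
    ultimately show ?thesis
      unfolding \<N>_def by blast
  qed
  then have cov: "X - Z \<subseteq> \<Union>\<N>"
    by blast
  have "Lindelof_space (subtopology (mtop M) (X - Z))"
    by (rule second_countable_imp_Lindelof_space[OF second_countable_subtopology[OF second_countable]])
  then have "\<forall>\<U>. (\<forall>N\<in>\<U>. openin (mtop M) N) \<and> X - Z \<subseteq> \<Union>\<U> \<longrightarrow> (\<exists>\<V>. countable \<V> \<and> \<V> \<subseteq> \<U> \<and> X - Z \<subseteq> \<Union>\<V>)"
    unfolding Lindelof_space_subtopology_subset[OF top] .
  moreover have "(\<forall>N\<in>\<N>. openin (mtop M) N) \<and> X - Z \<subseteq> \<Union>\<N>"
    using cov by (simp add: \<N>_def)
  ultimately have "\<exists>\<V>. countable \<V> \<and> \<V> \<subseteq> \<N> \<and> X - Z \<subseteq> \<Union>\<V>"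
    by (elim allE[of _ \<N>] mp)
  then obtain \<V> where \<V>: "countable \<V>" "\<V> \<subseteq> \<N>" "X - Z \<subseteq> \<Union>\<V>"
    by (elim exE conjE) (rule that)
  \<comment> \<open>The empty set makes the family nonempty, so that it can be enumerated even if \<open>X = Z\<close>.\<close>
  define \<V>' where "\<V>' = insert {} \<V>"
  have emp: "{} \<in> \<N>"
    using U0 by (auto simp: \<N>_def good_def)
  have range: "range (from_nat_into \<V>') = \<V>'"
    using \<V>(1) by (intro range_from_nat_into) (auto simp: \<V>'_def)
  have "\<exists>U. good (from_nat_into \<V>' k) U" for k
  proof -
    have "from_nat_into \<V>' k \<in> \<V>'"
      using range by blast
    then have "from_nat_into \<V>' k \<in> \<N>"
      using \<V>(2) emp by (auto simp: \<V>'_def)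
    then show ?thesis
      by (simp add: \<N>_def)
  qed
  then have "\<exists>U. \<forall>k. good (from_nat_into \<V>' k) (U k)"
    by (intro choice allI)
  then obtain U where U: "\<forall>k. good (from_nat_into \<V>' k) (U k)"
    by (elim exE) (rule that)
  have "\<exists>k. x \<notin> U k" if "x \<in> X - Z" for x
  proof -
    obtain N where N: "N \<in> \<V>'" "x \<in> N"
      using \<V>(3) \<open>x \<in> X - Z\<close> by (auto simp: \<V>'_def)
    then have "N \<in> range (from_nat_into \<V>')"
      by (simp only: range)
    then obtain k where "N = from_nat_into \<V>' k"
      by (elim rangeE) (rule that)
    moreover have "N \<inter> U k = {}" if "N = from_nat_into \<V>' k" for k
      using U that by (simp add: good_def)
    ultimately show ?thesis
      using N(2) by blast
  qed
  moreover have "\<forall>k. openin (mtop M) (U k) \<and> Z \<subseteq> U k \<and> U k \<subseteq> U0"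
    using U unfolding good_def by simp
  ultimately show ?thesis
    by (intro exI[of _ U] conjI ballI) simp_all
qed

text \<open>With \<open>\<alpha>\<^sub>k = \<omega> + d \<beta>\<^sub>k\<close>, \<open>\<gamma> = \<Sum>k. w\<^sub>k \<beta>\<^sub>k\<close> and \<open>s = \<Sum>k. w\<^sub>k\<close>, the form \<open>\<omega> + d (\<rho> \<gamma>) / s\<close> equals the
  weighted mean of the \<open>\<alpha>\<^sub>k\<close> on \<open>X\<close>, where it inherits their signs. It lies in \<open>\<xi>\<close> whatever the cutoff
  function \<open>\<rho>\<close> is, and its support is compact.\<close>

lemma weighted_sum_transversal:
  fixes \<alpha> :: "nat \<Rightarrow> ('a, 'n) form"
  assumes \<xi>: "\<xi> \<in> cohomology M p" and \<omega>: "\<omega> \<in> \<xi>" "\<omega> \<in> test_forms M p"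
    and \<alpha>: "\<And>k. \<alpha> k \<in> \<xi>" "\<And>k. vanishes_on Z (\<alpha> k)" "\<And>k. nonneg_on M C (X - Z) (\<alpha> k)"
    and pos: "\<And>x. x \<in> X - Z \<Longrightarrow> \<exists>k. \<forall>c\<in>atlas M. x \<in> cdom c \<longrightarrow> (\<forall>v\<in>C c x. v \<noteq> 0 \<longrightarrow> 0 < \<alpha> k c x \<bullet> v)"
    and p: "p = Suc q"
  shows "\<exists>\<alpha>\<in>\<xi>. rel_transversal M p X Z C \<alpha>"
proof -
  have coh: "\<omega> \<in> closed_forms M p" "\<alpha> k - \<omega> \<in> exact_forms M p" for k
    using in_cohomology_class[OF \<xi> \<omega>(1), of "\<alpha> k"] \<alpha>(1)[of k] by simp_all
  have d0: "ext_deriv M 0 = 0"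
    using ext_deriv_scaleR[OF zero_smooth_form, of 0] by simp
  have "\<exists>\<beta>. \<beta> \<in> smooth_forms M q \<and> \<alpha> k - \<omega> = ext_deriv M \<beta>" for k
  proof -
    have "\<alpha> k - \<omega> = 0 \<or> (\<exists>\<beta>. \<beta> \<in> smooth_forms M q \<and> \<alpha> k - \<omega> = ext_deriv M \<beta>)"
      using coh(2)[of k] p by (auto simp: exact_forms_def zero_form_eq)
    then show ?thesis
      using d0 zero_smooth_form[of q] by (elim disjE) (intro exI[of _ 0], simp_all)
  qed
  then have "\<exists>\<beta>. \<forall>k. \<beta> k \<in> smooth_forms M q \<and> \<alpha> k - \<omega> = ext_deriv M (\<beta> k)"
    by (intro choice allI)
  then obtain \<beta> where "\<forall>k. \<beta> k \<in> smooth_forms M q \<and> \<alpha> k - \<omega> = ext_deriv M (\<beta> k)"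
    by (elim exE) (rule that)
  then have \<beta>: "\<beta> k \<in> smooth_forms M q" "ext_deriv M (\<beta> k) = \<alpha> k - \<omega>" for k
    by simp_all
  obtain w \<gamma> where w0: "\<forall>k. 0 < w k" and w1: "summable w" and \<gamma>: "\<gamma> \<in> smooth_forms M q"
    and sums0: "\<forall>c x. (\<lambda>k. w k *\<^sub>R ext_deriv M (\<beta> k) c x) sums ext_deriv M \<gamma> c x"
    by (rule smooth_form_series[OF \<beta>(1)])
  note w = w0[THEN spec] w1 and sums = sums0[THEN spec, THEN spec]
  define s where "s = suminf w"
  have s: "0 < s"
    unfolding s_def by (rule suminf_pos[OF w(2,1)])
  obtain \<rho> N L where \<rho>: "smooth_function M \<rho>" "openin (mtop M) N" "X \<subseteq> N" "compactin (mtop M) L"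
    "\<forall>z\<in>N. \<rho> z = 1" "\<forall>z. z \<notin> L \<longrightarrow> \<rho> z = 0"
    by (rule cutoff[OF compact_X])
  define \<sigma> where "\<sigma> = (\<lambda>c x. \<rho> x *\<^sub>R \<gamma> c x)"
  have \<sigma>: "\<sigma> \<in> smooth_forms M q"
    unfolding \<sigma>_def by (rule smooth_forms_scaled[OF \<rho>(1) \<gamma>])
  define d\<sigma> where "d\<sigma> = (1 / s) *\<^sub>R ext_deriv M \<sigma>"
  have closed: "ext_deriv M \<sigma> \<in> closed_forms M p"
    unfolding p by (rule ext_deriv_smooth_closed[OF \<sigma>])
  have "ext_deriv M \<sigma> \<in> exact_forms M p"
    using \<sigma> p by (auto simp: exact_forms_def)
  then have exact: "d\<sigma> \<in> exact_forms M p" and closed': "d\<sigma> \<in> closed_forms M p"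
    unfolding d\<sigma>_def using closed by (simp_all add: subspace_scale[OF subspace_exact_forms] subspace_scale[OF subspace_closed_forms])
  have "ext_deriv M \<sigma> \<in> test_forms M p"
  proof (rule test_formsI[OF closed_formsD(1)[OF closed] \<rho>(4)])
    fix c x assume nz: "ext_deriv M \<sigma> c x \<noteq> 0"
    show "x \<in> L"
    proof (rule ccontr)
      assume xL: "x \<notin> L"
      have "x \<in> topspace (mtop M)"
        using nz ext_deriv_outside[of c x \<sigma>] cdom_subset[of c] by blast
      moreover have "openin (mtop M) (topspace (mtop M) - L)"
        by (rule openin_diff[OF openin_topspace compactin_imp_closedin[OF Hausdorff \<rho>(4)]])
      ultimately have "ext_deriv M \<sigma> c x = ext_deriv M 0 c x"
        using xL \<rho>(6) by (intro ext_deriv_local[of "topspace (mtop M) - L"]) (auto simp: \<sigma>_def)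
      then show False
        using nz d0 by simp
    qed
  qed
  then have test: "d\<sigma> \<in> test_forms M p"
    unfolding d\<sigma>_def by (rule subspace_scale[OF subspace_test_forms])
  have sum_eq: "(\<lambda>k. w k *\<^sub>R \<alpha> k c x) sums (s *\<^sub>R (\<omega> + d\<sigma>) c x)" if x: "x \<in> X" for c x
  proof -
    \<comment> \<open>The cutoff function is \<open>1\<close> on a neighbourhood of \<open>X\<close>, so the derivatives agree on \<open>X\<close>.\<close>
    have "ext_deriv M \<sigma> c x = ext_deriv M \<gamma> c x"
      using \<rho>(3,5) x by (intro ext_deriv_local[OF \<rho>(2)]) (auto simp: \<sigma>_def)
    then have "s *\<^sub>R (\<omega> + d\<sigma>) c x = ext_deriv M \<gamma> c x + s *\<^sub>R \<omega> c x"
      using s by (simp add: d\<sigma>_def scaleR_add_right)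
    moreover have "(\<lambda>k. w k *\<^sub>R ext_deriv M (\<beta> k) c x + w k *\<^sub>R \<omega> c x) sums (ext_deriv M \<gamma> c x + s *\<^sub>R \<omega> c x)"
      unfolding s_def by (rule sums_add[OF sums sums_scaleR_left[OF summable_sums[OF w(2)]]])
    moreover have "w k *\<^sub>R ext_deriv M (\<beta> k) c x + w k *\<^sub>R \<omega> c x = w k *\<^sub>R \<alpha> k c x" for k
      by (simp add: \<beta>(2) scaleR_diff_right)
    ultimately show ?thesis
      by simp
  qed
  have "\<omega> + d\<sigma> \<in> \<xi>"
    using in_cohomology_class[OF \<xi> \<omega>(1), of "\<omega> + d\<sigma>"] coh(1) exact subspace_add[OF subspace_closed_forms coh(1) closed']
    by simp
  moreover have "\<omega> + d\<sigma> \<in> test_forms M p"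
    by (rule subspace_add[OF subspace_test_forms \<omega>(2) test])
  moreover have "vanishes_on Z (\<omega> + d\<sigma>)"
    unfolding vanishes_on_def
  proof (intro ballI allI)
    fix x c assume x: "x \<in> Z"
    have "(\<lambda>k. w k *\<^sub>R \<alpha> k c x) = (\<lambda>k. 0)"
      using \<alpha>(2) x by (simp add: vanishes_on_def)
    then have "(\<lambda>k. 0) sums (s *\<^sub>R (\<omega> + d\<sigma>) c x)"
      using sum_eq[of x c] x ZX by auto
    then have "s *\<^sub>R (\<omega> + d\<sigma>) c x = 0"
      by (rule sums_unique2[OF _ sums_zero])
    then show "(\<omega> + d\<sigma>) c x = 0"
      using s by simp
  qed
  moreover have "pos_on M C (X - Z) (\<omega> + d\<sigma>)"
    unfolding pos_on_def
  proof (intro ballI impI)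
    fix c x v assume c: "c \<in> atlas M" and x: "x \<in> cdom c \<inter> (X - Z)" and v: "v \<in> C c x" "v \<noteq> 0"
    obtain k where k: "0 < \<alpha> k c x \<bullet> v"
      using pos[of x] c x v by blast
    have sv: "(\<lambda>k. w k * (\<alpha> k c x \<bullet> v)) sums (s * ((\<omega> + d\<sigma>) c x \<bullet> v))"
      using bounded_linear.sums[OF bounded_linear_inner_left sum_eq[of x c], of v] x
      by (simp only: inner_scaleR_left Int_iff Diff_iff)
    have "0 \<le> w k * (\<alpha> k c x \<bullet> v)" for k
      using \<alpha>(3)[of k] c x v(1) less_imp_le[OF w(1)[of k]] unfolding nonneg_on_def
      by (intro mult_nonneg_nonneg) blast+
    moreover have "0 < w k * (\<alpha> k c x \<bullet> v)"
      using w(1) k by simp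
    ultimately have "0 < (\<Sum>k. w k * (\<alpha> k c x \<bullet> v))"
      by (rule suminf_pos2[OF sums_summable[OF sv]])
    then have "0 < s * ((\<omega> + d\<sigma>) c x \<bullet> v)"
      using sums_unique[OF sv] by simp
    then show "0 < (\<omega> + d\<sigma>) c x \<bullet> v"
      using s by (simp only: zero_less_mult_pos)
  qed
  ultimately show ?thesis
    by (auto simp: rel_transversal_def)
qed

text \<open>Neighbourhoods \<open>U\<close> whose closure lies in the region where a representative of \<open>\<xi>\<close> vanishes are admissible
  in the hypothesis; countably many of them reach every point of \<open>X - Z\<close>.\<close>

lemma positive_imp_transversal:
  assumes \<xi>: "\<xi> \<in> vanishing_classes M p Z"
    and pos: "\<And>U T. openin (mtop M) U \<Longrightarrow> Z \<subseteq> U \<Longrightarrow> \<xi> \<in> vanishing_classes M p (mtop M closure_of U) \<Longrightarrow>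
       structure_cycle M p X Z C U T \<Longrightarrow> 0 < induced_hom M p U T \<xi>"
  shows "\<exists>\<alpha>\<in>\<xi>. rel_transversal M p X Z C \<alpha>"
proof -
  have coh: "\<xi> \<in> cohomology M p"
    using \<xi> by (simp add: vanishing_classes_def)
  obtain \<omega> V where \<omega>: "\<omega> \<in> \<xi>" "\<omega> \<in> test_forms M p" and V: "openin (mtop M) V" "Z \<subseteq> V" "vanishes_on V \<omega>"
    using \<xi> by (auto simp: vanishing_classes_def representatives_near_def)
  from neighbourhood_with_small_closure[OF V(1,2)] obtain U0 where U0: "openin (mtop M) U0" "Z \<subseteq> U0" "mtop M closure_of U0 \<subseteq> V"
    by (elim exE conjE) (rule that)
  from countable_punctured_cover[OF U0(1,2)] obtain U :: "nat \<Rightarrow> 'a set" where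
    U: "\<forall>k. openin (mtop M) (U k) \<and> Z \<subseteq> U k \<and> U k \<subseteq> U0" and cov: "\<forall>x\<in>X - Z. \<exists>k. x \<notin> U k"
    by (elim exE conjE) (rule that)
  have "\<exists>\<alpha>. \<alpha> \<in> \<xi> \<and> \<alpha> \<in> test_forms M p \<and> vanishes_on Z \<alpha> \<and> nonneg_on M C (X - Z) \<alpha> \<and> pos_on M C (X - U k) \<alpha>" for k
  proof -
    have Uk: "openin (mtop M) (U k)" "Z \<subseteq> U k" "U k \<subseteq> U0"
      using U by simp_all
    have "mtop M closure_of U k \<subseteq> V"
      using closure_of_mono[OF Uk(3)] U0(3) by blast
    then have "\<omega> \<in> representatives_near M p (mtop M closure_of U k) \<xi>"
      using \<omega> V by (auto simp: representatives_near_def)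
    then have ne: "representatives_near M p (mtop M closure_of U k) \<xi> \<noteq> {}"
      by auto
    then have rep: "(SOME \<omega>. \<omega> \<in> representatives_near M p (mtop M closure_of U k) \<xi>) \<in>
        representatives_near M p (mtop M closure_of U k) \<xi>"
      by (simp add: some_in_eq)
    have van: "\<xi> \<in> vanishing_classes M p (mtop M closure_of U k)"
      using coh ne by (simp add: vanishing_classes_def)
    have "\<exists>\<alpha>\<in>\<xi>. \<alpha> \<in> test_forms M p \<and> vanishes_on Z \<alpha> \<and> nonneg_on M C (X - Z) \<alpha> \<and> pos_on M C (X - U k) \<alpha>"
      using pos[OF Uk(1,2) van] unfolding induced_hom_def
      by (intro partially_transversal_form[OF coh Uk(1,2) rep])
    then show ?thesis
      by blast
  qed
  then have "\<exists>\<alpha>. \<forall>k. \<alpha> k \<in> \<xi> \<and> \<alpha> k \<in> test_forms M p \<and> vanishes_on Z (\<alpha> k) \<and>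
      nonneg_on M C (X - Z) (\<alpha> k) \<and> pos_on M C (X - U k) (\<alpha> k)"
    by (intro choice allI)
  then obtain \<alpha> where "\<forall>k. \<alpha> k \<in> \<xi> \<and> \<alpha> k \<in> test_forms M p \<and> vanishes_on Z (\<alpha> k) \<and>
      nonneg_on M C (X - Z) (\<alpha> k) \<and> pos_on M C (X - U k) (\<alpha> k)"
    by (elim exE) (rule that)
  then have \<alpha>: "\<alpha> k \<in> \<xi>" "\<alpha> k \<in> test_forms M p" "vanishes_on Z (\<alpha> k)"
    "nonneg_on M C (X - Z) (\<alpha> k)" "pos_on M C (X - U k) (\<alpha> k)" for k
    by simp_all
  have pos_k: "\<exists>k. \<forall>c\<in>atlas M. x \<in> cdom c \<longrightarrow> (\<forall>v\<in>C c x. v \<noteq> 0 \<longrightarrow> 0 < \<alpha> k c x \<bullet> v)" if x: "x \<in> X - Z" for x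
  proof -
    obtain k where "x \<in> X - U k"
      using cov x by blast
    then show ?thesis
      using \<alpha>(5)[of k] unfolding pos_on_def by (intro exI[of _ k]) blast
  qed
  show ?thesis
  proof (cases p)
    case 0
    \<comment> \<open>The only exact \<open>0\<close>-form is \<open>0\<close>, so all the forms coincide.\<close>
    have eq: "\<alpha> k = \<omega>" for k
      using in_cohomology_class[OF coh \<omega>(1), of "\<alpha> k"] \<alpha>(1)[of k] 0 by (simp add: exact_forms_def zero_form_eq)
    have "pos_on M C (X - Z) \<omega>"
      using pos_k unfolding eq pos_on_def by blast
    then have "rel_transversal M p X Z C \<omega>"
      using \<alpha>(2,3) unfolding eq rel_transversal_def by blast
    then show ?thesis
      using \<omega>(1) by blast
  next
    case (Suc q)
    show ?thesis
      by (rule weighted_sum_transversal[OF coh \<omega> \<alpha>(1,3,4) pos_k Suc])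
  qed
qed

end

theorem theorem2p7:
  fixes M :: "('a, 'n::{finite,linorder}) manifold"
    and p :: nat
    and X Z :: "'a set"
    and C :: "('a, 'n) cone_field"
    and \<xi> :: "('a, 'n) form set"
  assumes "smooth_manifold M"
    and "compactin (mtop M) X" and "X \<subseteq> manifold_interior M"
    and "compactin (mtop M) Z" and "Z \<subseteq> X"
    and "cone_structure M p X Z C"
    and "\<xi> \<in> vanishing_classes M p Z"
  shows "(\<exists>\<alpha>\<in>\<xi>. rel_transversal M p X Z C \<alpha>) \<longleftrightarrow>
    (\<forall>U T. openin (mtop M) U \<and> Z \<subseteq> U \<and> \<xi> \<in> vanishing_classes M p (mtop M closure_of U) \<and>
       structure_cycle M p X Z C U T \<longrightarrow> 0 < induced_hom M p U T \<xi>)"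
proof -
  interpret cone_structure_space M p X Z C
    using assms by unfold_locales
  show ?thesis
  proof (intro iffI allI impI)
    fix U T
    assume "\<exists>\<alpha>\<in>\<xi>. rel_transversal M p X Z C \<alpha>"
      and U: "openin (mtop M) U \<and> Z \<subseteq> U \<and> \<xi> \<in> vanishing_classes M p (mtop M closure_of U) \<and> structure_cycle M p X Z C U T"
    then obtain \<alpha> where \<alpha>: "\<alpha> \<in> \<xi>" "rel_transversal M p X Z C \<alpha>"
      by blast
    have coh: "\<xi> \<in> cohomology M p" and "representatives_near M p (mtop M closure_of U) \<xi> \<noteq> {}"
      and U': "Z \<subseteq> U" "U \<subseteq> topspace (mtop M)" "structure_cycle M p X Z C U T"
      using U openin_subset[of "mtop M" U] by (simp_all add: vanishing_classes_def)
    then have rep: "(SOME \<omega>. \<omega> \<in> representatives_near M p (mtop M closure_of U) \<xi>) \<in>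
        representatives_near M p (mtop M closure_of U) \<xi>"
      by (simp add: some_in_eq)
    show "0 < induced_hom M p U T \<xi>"
      unfolding induced_hom_def by (rule transversal_imp_positive[OF coh \<alpha> U'(1) rep U'(2,3)])
  next
    assume "\<forall>U T. openin (mtop M) U \<and> Z \<subseteq> U \<and> \<xi> \<in> vanishing_classes M p (mtop M closure_of U) \<and>
       structure_cycle M p X Z C U T \<longrightarrow> 0 < induced_hom M p U T \<xi>"
    then show "\<exists>\<alpha>\<in>\<xi>. rel_transversal M p X Z C \<alpha>"
      using assms(7) by (intro positive_imp_transversal) simp_all
  qed
qed

end
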